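(* Let $n\geq 3$, $l=2^{n-2}-1$, and let $$A=K\oplus K\oplus K\oplus K^{3\times3}\oplus K^{2\times2}\oplus K^{2\times2}\oplus\bigoplus_{i=7}^{6+l}K^{2\times2},$$ with Wedderburn components numbered $1,\dots,6+l$ in the order written. Let $\Lambda\subseteq A$ and $\Gamma\subseteq A$ be $\mathcal{O}$-orders with $K\Lambda=K\Gamma=A$ such that: (i) $k\otimes_{\mathcal{O}}\Lambda\cong k\otimes_{\mathcal{O}}\Gamma\cong\bar\Lambda$; (ii) $\Lambda$ and $\Gamma$ are symmetric; (iii) both $\Lambda$ and $\Gamma$ have decomposition matrix $D_0$, where the $i$-th row corresponds to the simple module of the $i$-th Wedderburn component of $A$ (columns being a suitable labelling of the three simple modules); (iv) $Z(\Lambda)=Z(\Gamma)$ as subsets of $Z(A)$. Then there is a unit $u\in A^\times$ with $u\Lambda u^{-1}=\Gamma$.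
   Context: $(K,\mathcal{O},k)$: $\mathcal{O}$ a complete discrete valuation ring of characteristic $0$, $K$ its fraction field, $k$ its residue field, algebraically closed of characteristic $2$. $\bar\Lambda=kQ/I$ is Erdmann's algebra $Q(3\mathcal{K})^c$ with $c=2^{n-2}$: $Q$ has vertices $1,2,3$ and arrows $\beta:1\to2$, $\gamma:2\to1$, $\delta:2\to3$, $\eta:3\to2$, $\kappa:1\to3$, $\lambda:3\to1$ (paths composed left to right), and $I$ is generated by $\beta\delta-\kappa\lambda\kappa$, $\eta\gamma-\lambda\kappa\lambda$, $\delta\lambda-\gamma\beta\gamma$, $\kappa\eta-\beta\gamma\beta$, $\lambda\beta-(\eta\delta)^{c-1}\eta$, $\gamma\kappa-(\delta\eta)^{c-1}\delta$, $\gamma\beta\delta$, $\delta\eta\gamma$, $\lambda\kappa\eta$. $D_0$ is the $(6+l)\times3$ matrix with rows, in order, $(1,0,0),(0,1,0),(0,0,1),(1,1,1),(1,1,0),(1,0,1)$ followed by $l$ rows $(0,1,1)$. A symmetric $\mathcal{O}$-order $\Lambda\subseteq A$ is one for which there is a symmetric associative non-degenerate $K$-bilinear form $T$ on $A$ with $\Lambda=\{a\in A\mid T(a,\Lambda)\subseteq\mathcal{O}\}$. The decomposition number for a simple $A$-module $V$ and simple $k\otimes\Lambda$-module $S$ is the multiplicity of $S$ in $k\otimes_{\mathcal O}M$ for a full $\Lambda$-lattice $M\subseteq V$. *)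

theory Defs
  imports "HOL-Computational_Algebra.Polynomial"
begin

definition piO :: "'a::field set \<Rightarrow> 'a \<Rightarrow> nat \<Rightarrow> 'a set" where
  "piO Ov pu m = {pu ^ m * x | x. x \<in> Ov}"

definition complete_dvr :: "'a::field set \<Rightarrow> 'a \<Rightarrow> bool" where
  "complete_dvr Ov pu \<longleftrightarrow>
     0 \<in> Ov \<and> 1 \<in> Ov \<and> (\<forall>x\<in>Ov. \<forall>y\<in>Ov. x + y \<in> Ov \<and> x * y \<in> Ov \<and> - x \<in> Ov) \<and>
     pu \<in> Ov \<and> pu \<noteq> 0 \<and> inverse pu \<notin> Ov \<and>
     (\<forall>x. x \<noteq> 0 \<longrightarrow> (\<exists>u m. u \<in> Ov \<and> inverse u \<in> Ov \<and> x = u * pu powi m)) \<and>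
     (\<forall>s :: nat \<Rightarrow> 'a. (\<forall>j. s j \<in> Ov) \<longrightarrow>
        (\<forall>m. \<exists>N. \<forall>p\<ge>N. \<forall>q\<ge>N. s p - s q \<in> piO Ov pu m) \<longrightarrow>
        (\<exists>L\<in>Ov. \<forall>m. \<exists>N. \<forall>p\<ge>N. s p - L \<in> piO Ov pu m))"

definition residue_map :: "'a::field set \<Rightarrow> 'a \<Rightarrow> ('a \<Rightarrow> 'k::field) \<Rightarrow> bool" where
  "residue_map Ov pu red \<longleftrightarrow>
     (\<forall>x\<in>Ov. \<forall>y\<in>Ov. red (x + y) = red x + red y \<and> red (x * y) = red x * red y) \<and>
     red 1 = 1 \<and> (\<forall>z. \<exists>x\<in>Ov. red x = z) \<and> (\<forall>x\<in>Ov. red x = 0 \<longleftrightarrow> x \<in> piO Ov pu 1)"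

definition alg_closed :: "'k::field itself \<Rightarrow> bool" where
  "alg_closed _ \<longleftrightarrow> (\<forall>p :: 'k poly. 0 < degree p \<longrightarrow> (\<exists>x. poly p x = 0))"

type_synonym 'a elem = "nat \<Rightarrow> nat \<Rightarrow> nat \<Rightarrow> 'a"  \<comment> \<open>component, row, column\<close>
type_synonym 'a vect = "nat \<Rightarrow> 'a"

text \<open>Components (0-based): 0,1,2 are K; 3 is K^(3x3); all further ones are K^(2x2).\<close>
definition adim :: "nat \<Rightarrow> nat" where
  "adim i = (if i < 3 then 1 else if i = 3 then 3 else 2)"

definition Aset :: "nat \<Rightarrow> 'a::field elem set" where
  "Aset N = {x. \<forall>i r s. (N \<le> i \<or> adim i \<le> r \<or> adim i \<le> s) \<longrightarrow> x i r s = 0}"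

definition eadd :: "'a::field elem \<Rightarrow> 'a elem \<Rightarrow> 'a elem" where
  "eadd x y = (\<lambda>i r s. x i r s + y i r s)"
definition escal :: "'a::field \<Rightarrow> 'a elem \<Rightarrow> 'a elem" where
  "escal c x = (\<lambda>i r s. c * x i r s)"
definition ezero :: "'a::field elem" where
  "ezero = (\<lambda>i r s. 0)"
definition amul :: "'a::field elem \<Rightarrow> 'a elem \<Rightarrow> 'a elem" where
  "amul x y = (\<lambda>i r s. \<Sum>t<adim i. x i r t * y i t s)"
definition aone :: "nat \<Rightarrow> 'a::field elem" where
  "aone N = (\<lambda>i r s. if i < N \<and> r < adim i \<and> r = s then 1 else 0)"

definition esum :: "nat \<Rightarrow> (nat \<Rightarrow> 'a::field elem) \<Rightarrow> 'a elem" where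
  "esum m g = (\<lambda>i r s. \<Sum>j<m. g j i r s)"

definition olattice_A :: "nat \<Rightarrow> 'a::field set \<Rightarrow> 'a elem set \<Rightarrow> bool" where
  "olattice_A N Ov L \<longleftrightarrow> (\<exists>m g. (\<forall>j<m. g j \<in> Aset N) \<and>
      L = {esum m (\<lambda>j. escal (c j) (g j)) | c. \<forall>j<m. c j \<in> Ov})"

definition kspan_A :: "'a::field elem set \<Rightarrow> 'a elem set" where
  "kspan_A S = {esum m (\<lambda>j. escal (c j) (g j)) | m c g. \<forall>j<m. g j \<in> S}"

definition is_order :: "nat \<Rightarrow> 'a::field set \<Rightarrow> 'a elem set \<Rightarrow> bool" where
  "is_order N Ov L \<longleftrightarrow> olattice_A N Ov L \<and> aone N \<in> L \<and>
     (\<forall>x\<in>L. \<forall>y\<in>L. amul x y \<in> L) \<and> kspan_A L = Aset N"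

definition symmetric_order :: "nat \<Rightarrow> 'a::field set \<Rightarrow> 'a elem set \<Rightarrow> bool" where
  "symmetric_order N Ov L \<longleftrightarrow> (\<exists>T :: 'a elem \<Rightarrow> 'a elem \<Rightarrow> 'a.
     (\<forall>x\<in>Aset N. \<forall>y\<in>Aset N. \<forall>z\<in>Aset N. \<forall>c.
         T (eadd x y) z = T x z + T y z \<and> T (escal c x) z = c * T x z \<and>
         T x (eadd y z) = T x y + T x z \<and> T x (escal c y) = c * T x y) \<and>
     (\<forall>x\<in>Aset N. \<forall>y\<in>Aset N. T x y = T y x) \<and>
     (\<forall>x\<in>Aset N. \<forall>y\<in>Aset N. \<forall>z\<in>Aset N. T (amul x y) z = T x (amul y z)) \<and>
     (\<forall>x\<in>Aset N. (\<forall>y\<in>Aset N. T x y = 0) \<longrightarrow> x = ezero) \<and>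
     L = {x \<in> Aset N. \<forall>y\<in>L. T x y \<in> Ov})"

definition center :: "'a::field elem set \<Rightarrow> 'a elem set" where
  "center L = {z \<in> L. \<forall>x\<in>L. amul z x = amul x z}"

definition Vset :: "nat \<Rightarrow> 'a::field vect set" where
  "Vset i = {v. \<forall>r. adim i \<le> r \<longrightarrow> v r = 0}"
definition vact :: "nat \<Rightarrow> 'a::field elem \<Rightarrow> 'a vect \<Rightarrow> 'a vect" where
  "vact i a v = (\<lambda>r. if r < adim i then \<Sum>s<adim i. a i r s * v s else 0)"
definition vadd :: "'a::field vect \<Rightarrow> 'a vect \<Rightarrow> 'a vect" where
  "vadd v w = (\<lambda>r. v r + w r)"
definition vsub :: "'a::field vect \<Rightarrow> 'a vect \<Rightarrow> 'a vect" where
  "vsub v w = (\<lambda>r. v r - w r)"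
definition vscal :: "'a::field \<Rightarrow> 'a vect \<Rightarrow> 'a vect" where
  "vscal c v = (\<lambda>r. c * v r)"
definition vsum :: "nat \<Rightarrow> (nat \<Rightarrow> 'a::field vect) \<Rightarrow> 'a vect" where
  "vsum m g = (\<lambda>r. \<Sum>j<m. g j r)"

definition full_lattice :: "'a::field set \<Rightarrow> 'a elem set \<Rightarrow> nat \<Rightarrow> 'a vect set \<Rightarrow> bool" where
  "full_lattice Ov L i M \<longleftrightarrow>
     (\<exists>m g. (\<forall>j<m. g j \<in> Vset i) \<and> M = {vsum m (\<lambda>j. vscal (c j) (g j)) | c. \<forall>j<m. c j \<in> Ov}) \<and>
     (\<forall>a\<in>L. \<forall>v\<in>M. vact i a v \<in> M) \<and>
     {vsum m (\<lambda>j. vscal (c j) (g j)) | m c g. \<forall>j<m. g j \<in> M} = Vset i"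

definition submod :: "'a::field elem set \<Rightarrow> nat \<Rightarrow> 'a vect set \<Rightarrow> bool" where
  "submod L i X \<longleftrightarrow> (\<lambda>r. 0) \<in> X \<and> (\<forall>v\<in>X. \<forall>w\<in>X. vadd v w \<in> X) \<and>
     (\<forall>a\<in>L. \<forall>v\<in>X. vact i a v \<in> X)"

text \<open>A composition series of k \<otimes> M = M / pi M as k \<otimes> Lambda-module, i.e. a maximal chain
  M = Ms!0 \<supset> Ms!1 \<supset> ... \<supset> Ms!r = pu M of Lambda-submodules with simple factors.\<close>
definition comp_series :: "'a::field elem set \<Rightarrow> 'a \<Rightarrow> nat \<Rightarrow> 'a vect set \<Rightarrow> 'a vect set list \<Rightarrow> bool" where
  "comp_series L pu i M Ms \<longleftrightarrow> Ms \<noteq> [] \<and> Ms ! 0 = M \<and> last Ms = {vscal pu v | v. v \<in> M} \<and>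
     (\<forall>t<length Ms. submod L i (Ms ! t)) \<and>
     (\<forall>t. Suc t < length Ms \<longrightarrow> Ms ! Suc t \<subset> Ms ! t \<and>
        (\<forall>Z. submod L i Z \<and> Ms ! Suc t \<subseteq> Z \<and> Z \<subseteq> Ms ! t \<longrightarrow> Z = Ms ! Suc t \<or> Z = Ms ! t))"

text \<open>Isomorphism of Lambda-modules X1/Y1 (in V_i1) and X2/Y2 (in V_i2).\<close>
definition sq_iso :: "'a::field elem set \<Rightarrow> nat \<Rightarrow> 'a vect set \<Rightarrow> 'a vect set \<Rightarrow>
     nat \<Rightarrow> 'a vect set \<Rightarrow> 'a vect set \<Rightarrow> bool" where
  "sq_iso L i1 X1 Y1 i2 X2 Y2 \<longleftrightarrow> (\<exists>f. (\<forall>x\<in>X1. f x \<in> X2) \<and>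
     (\<forall>x\<in>X1. \<forall>y\<in>X1. vsub (f (vadd x y)) (vadd (f x) (f y)) \<in> Y2) \<and>
     (\<forall>a\<in>L. \<forall>x\<in>X1. vsub (f (vact i1 a x)) (vact i2 a (f x)) \<in> Y2) \<and>
     (\<forall>x\<in>X1. f x \<in> Y2 \<longleftrightarrow> x \<in> Y1) \<and>
     (\<forall>z\<in>X2. \<exists>x\<in>X1. vsub (f x) z \<in> Y2))"

definition has_decomp_matrix :: "nat \<Rightarrow> 'a::field set \<Rightarrow> 'a \<Rightarrow> 'a elem set \<Rightarrow>
     (nat \<Rightarrow> nat \<Rightarrow> nat) \<Rightarrow> bool" where
  "has_decomp_matrix N Ov pu L D \<longleftrightarrow> (\<exists>(M :: nat \<Rightarrow> 'a vect set) Ms (lab :: nat \<Rightarrow> nat \<Rightarrow> nat).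
     (\<forall>i<N. full_lattice Ov L i (M i) \<and> comp_series L pu i (M i) (Ms i)) \<and>
     (\<forall>i<N. \<forall>t. Suc t < length (Ms i) \<longrightarrow> lab i t < 3) \<and>
     (\<forall>i<N. \<forall>t. \<forall>i'<N. \<forall>t'. Suc t < length (Ms i) \<longrightarrow> Suc t' < length (Ms i') \<longrightarrow>
        (sq_iso L i (Ms i ! t) (Ms i ! Suc t) i' (Ms i' ! t') (Ms i' ! Suc t')
          \<longleftrightarrow> lab i t = lab i' t')) \<and>
     (\<forall>i<N. \<forall>j<3. card {t. Suc t < length (Ms i) \<and> lab i t = j} = D i j))"

definition D0row :: "nat \<Rightarrow> nat list" where
  "D0row i = (if i = 0 then [1,0,0] else if i = 1 then [0,1,0] else if i = 2 then [0,0,1]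
     else if i = 3 then [1,1,1] else if i = 4 then [1,1,0] else if i = 5 then [1,0,1]
     else [0,1,1])"
definition D0 :: "nat \<Rightarrow> nat \<Rightarrow> nat" where
  "D0 i j = D0row i ! j"

datatype arrow = Beta | Gamma | Delta | Eta | Kappa | Lam

fun asrc :: "arrow \<Rightarrow> nat" where
  "asrc Beta = 1" | "asrc Gamma = 2" | "asrc Delta = 2" | "asrc Eta = 3" | "asrc Kappa = 1" | "asrc Lam = 3"
fun atgt :: "arrow \<Rightarrow> nat" where
  "atgt Beta = 2" | "atgt Gamma = 1" | "atgt Delta = 3" | "atgt Eta = 2" | "atgt Kappa = 3" | "atgt Lam = 1"

fun walk :: "nat \<Rightarrow> arrow list \<Rightarrow> nat option" where
  "walk v [] = Some v"
| "walk v (a # as) = (if asrc a = v then walk (atgt a) as else None)"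

text \<open>A path is a start vertex together with an arrow list; (v, []) is the trivial path e_v.\<close>
definition valid_path :: "nat \<times> arrow list \<Rightarrow> bool" where
  "valid_path p \<longleftrightarrow> fst p \<in> {1,2,3} \<and> walk (fst p) (snd p) \<noteq> None"

definition ptgt :: "nat \<Rightarrow> arrow list \<Rightarrow> nat" where
  "ptgt v as = (case walk v as of Some w \<Rightarrow> w | None \<Rightarrow> 0)"

type_synonym 'k palg = "nat \<times> arrow list \<Rightarrow> 'k"

definition kQ :: "'k::field palg set" where
  "kQ = {f. finite {p. f p \<noteq> 0} \<and> (\<forall>p. \<not> valid_path p \<longrightarrow> f p = 0)}"

definition padd :: "'k::field palg \<Rightarrow> 'k palg \<Rightarrow> 'k palg" where
  "padd f g = (\<lambda>p. f p + g p)"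
definition psub :: "'k::field palg \<Rightarrow> 'k palg \<Rightarrow> 'k palg" where
  "psub f g = (\<lambda>p. f p - g p)"
definition psc :: "'k::field \<Rightarrow> 'k palg \<Rightarrow> 'k palg" where
  "psc c f = (\<lambda>p. c * f p)"
definition pmul :: "'k::field palg \<Rightarrow> 'k palg \<Rightarrow> 'k palg" where
  "pmul f g = (\<lambda>(v, as). \<Sum>i\<le>length as. f (v, take i as) * g (ptgt v (take i as), drop i as))"
definition pone :: "'k::field palg" where
  "pone = (\<lambda>p. if fst p \<in> {1,2,3} \<and> snd p = [] then 1 else 0)"
definition pind :: "nat \<times> arrow list \<Rightarrow> 'k::field palg" where
  "pind q = (\<lambda>p. if p = q then 1 else 0)"

definition rels :: "nat \<Rightarrow> 'k::field palg set" where
  "rels c = {psub (pind (1, [Beta, Delta])) (pind (1, [Kappa, Lam, Kappa])),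
             psub (pind (3, [Eta, Gamma])) (pind (3, [Lam, Kappa, Lam])),
             psub (pind (2, [Delta, Lam])) (pind (2, [Gamma, Beta, Gamma])),
             psub (pind (1, [Kappa, Eta])) (pind (1, [Beta, Gamma, Beta])),
             psub (pind (3, [Lam, Beta])) (pind (3, concat (replicate (c - 1) [Eta, Delta]) @ [Eta])),
             psub (pind (2, [Gamma, Kappa])) (pind (2, concat (replicate (c - 1) [Delta, Eta]) @ [Delta])),
             pind (2, [Gamma, Beta, Delta]),
             pind (2, [Delta, Eta, Gamma]),
             pind (3, [Lam, Kappa, Eta])}"

inductive_set Iideal :: "nat \<Rightarrow> 'k::field palg set" for c where
  zero: "(\<lambda>p. 0) \<in> Iideal c"
| gen: "x \<in> kQ \<Longrightarrow> y \<in> kQ \<Longrightarrow> r \<in> rels c \<Longrightarrow> pmul (pmul x r) y \<in> Iideal c"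
| add: "a \<in> Iideal c \<Longrightarrow> b \<in> Iideal c \<Longrightarrow> padd a b \<in> Iideal c"

text \<open>k \<otimes>_O Lambda = Lambda / pi Lambda is isomorphic, as k-algebra, to kQ/I (with c):
  there is a map f : Lambda \<rightarrow> kQ inducing a well-defined bijective k-algebra
  homomorphism Lambda / pu Lambda \<rightarrow> kQ / I.\<close>
definition reduction_iso :: "nat \<Rightarrow> 'a::field set \<Rightarrow> 'a \<Rightarrow> ('a \<Rightarrow> 'k::field) \<Rightarrow> nat \<Rightarrow>
     'a elem set \<Rightarrow> bool" where
  "reduction_iso N Ov pu red c L \<longleftrightarrow> (\<exists>f :: 'a elem \<Rightarrow> 'k palg.
     (\<forall>x\<in>L. f x \<in> kQ) \<and>
     (\<forall>x\<in>L. \<forall>y\<in>L. psub (f (eadd x y)) (padd (f x) (f y)) \<in> Iideal c) \<and>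
     (\<forall>x\<in>L. \<forall>y\<in>L. psub (f (amul x y)) (pmul (f x) (f y)) \<in> Iideal c) \<and>
     psub (f (aone N)) pone \<in> Iideal c \<and>
     (\<forall>a\<in>Ov. \<forall>x\<in>L. psub (f (escal a x)) (psc (red a) (f x)) \<in> Iideal c) \<and>
     (\<forall>z\<in>kQ. \<exists>x\<in>L. psub (f x) z \<in> Iideal c) \<and>
     (\<forall>x\<in>L. f x \<in> Iideal c \<longleftrightarrow> x \<in> {escal pu y | y. y \<in> L}))"

end

(*
  Lift the vertices of the quiver to idempotents e_i of the order L and the arrows to elements of L. By
  Nakayama's lemma e_1 L e_2, e_2 L e_3 and e_1 L e_3 are generated, as right modules over the adjacent diagonal
  blocks, by the lifts b, d, k of beta, delta, kappa, and e_1 L e_3 is spanned by k and b d. The symmetrising form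
  shows that Z(L) maps onto each diagonal block e_i L e_i. The decomposition matrix gives the ranks of the e_i in the
  components of A; so after conjugation the e_i are fixed diagonal idempotents, b and d have all their
  entries equal to 1, and k has both entries equal to some scalar kp. Now Z(L) determines the diagonal blocks, hence the
  blocks above the diagonal up to the choice of kp. Since b d is the pure vector (1, 0) in e_1 L e_3, Z(L) also determines
  kp up to a unit of the valuation ring, and multiplying k by a unit does not change e_1 L e_3. Finally
  the blocks below the diagonal are dual to those above it.
*)
theory Submission
  imports Defs "Jordan_Normal_Form.Determinant"
begin

text \<open>An isomorphism of the reduction with the path algebra does not say which vertex carries
  which column of \<open>D0\<close>, so vertices and columns have to be matched. The relations allow
  vertices 2 and 3 to be exchanged and, for \<open>c = 2\<close>, all three vertices to be rotated;
  for larger \<open>c\<close> a count of closed paths ties vertex 1 to column 0. The scalar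
  \<open>kp\<close> comes from the 3x3 component. Any two columns meet there and in some 2x2
  components that no other pair shares. Conjugation by a diagonal matrix can give the single arrow
  entry of a 2x2 component any nonzero value, but the 3x3 component has three arrow entries and only
  two free ratios, so one scalar survives. The same fact makes \<open>b * d\<close> pure: only the
  3x3 component sees both arrows. The two orders come with unrelated symmetrising forms, so the
  forms are never compared; each one only tests membership in its own order.\<close>

section \<open>The ambient algebra as a ring\<close>

text \<open>Serves three times: for the values of the symmetrising form on closed paths, for the
  change to an adapted basis, and, after padding with a zero row, for underdetermined
  systems.\<close>

lemma square_system_inverse:
  fixes a :: "nat \<Rightarrow> nat \<Rightarrow> 'a::field"
  assumes inj: "\<And>z. (\<forall>j<n. (\<Sum>i<n. a j i * z i) = 0) \<Longrightarrow> \<forall>i<n. z i = 0"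
  shows "\<exists>b. (\<forall>i<n. \<forall>j<n. (\<Sum>t<n. a i t * b t j) = (if i = j then 1 else 0)) \<and>
             (\<forall>i<n. \<forall>j<n. (\<Sum>t<n. b i t * a t j) = (if i = j then 1 else 0))"
proof -
  define A where "A = mat n n (\<lambda>(i,j). a i j)"
  have A: "A \<in> carrier_mat n n" by (simp add: A_def)
  have "det A \<noteq> 0"
  proof
    assume "det A = 0"
    then obtain v where v: "v \<in> carrier_vec n" "v \<noteq> 0\<^sub>v n" "A *\<^sub>v v = 0\<^sub>v n"
      using det_0_iff_vec_prod_zero_field[OF A] by blast
    have "(\<Sum>i<n. a j i * v $ i) = 0" if "j < n" for j
    proof -
      have "(A *\<^sub>v v) $ j = (\<Sum>i<n. a j i * v $ i)"
        using that v(1) by (simp add: A_def scalar_prod_def lessThan_atLeast0)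
      then show ?thesis using v(3) that by simp
    qed
    then have "\<forall>i<n. v $ i = 0" using inj by blast
    then have "v = 0\<^sub>v n" using v(1) by (intro eq_vecI) auto
    then show False using v(2) by simp
  qed
  then obtain B where B: "B \<in> carrier_mat n n" "A * B = 1\<^sub>m n" "B * A = 1\<^sub>m n"
    using det_non_zero_imp_unit[OF A] A
    by (auto simp: Units_def ring_mat_def)
  have 1: "(\<Sum>t<n. a i t * B $$ (t,j)) = (if i = j then 1 else 0)" if "i < n" "j < n" for i j
  proof -
    have "(A * B) $$ (i,j) = (\<Sum>t<n. a i t * B $$ (t,j))"
      using that B(1) by (simp add: A_def scalar_prod_def lessThan_atLeast0)
    then show ?thesis using B(2) that by simp
  qed
  have 2: "(\<Sum>t<n. B $$ (i,t) * a t j) = (if i = j then 1 else 0)" if "i < n" "j < n" for i j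
  proof -
    have "(B * A) $$ (i,j) = (\<Sum>t<n. B $$ (i,t) * a t j)"
      using that B(1) by (simp add: A_def scalar_prod_def lessThan_atLeast0)
    then show ?thesis using B(3) that by simp
  qed
  show ?thesis
    by (rule exI[of _ "\<lambda>i j. B $$ (i,j)"]) (use 1 2 in blast)
qed

text \<open>All components at once, including those with index at least \<open>N\<close>, so that the ring has a type-class unit
  independent of \<open>N\<close>; \<open>Aset N\<close> is the ideal generated by the central idempotent \<open>idn N\<close>.\<close>

typedef (overloaded) 'a alg = "{x :: 'a::zero elem. \<forall>i r s. adim i \<le> r \<or> adim i \<le> s \<longrightarrow> x i r s = 0}"
  morphisms ent Alg
  by (rule exI[of _ "\<lambda>_ _ _. 0"]) simp

setup_lifting type_definition_alg

lemma alg_eqI: "(\<And>i r s. r < adim i \<Longrightarrow> s < adim i \<Longrightarrow> ent x i r s = ent y i r s) \<Longrightarrow> x = y"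
  by transfer (auto simp: fun_eq_iff, metis not_le)

lemma ent_outside: "adim i \<le> r \<or> adim i \<le> s \<Longrightarrow> ent x i r s = 0"
  using ent by blast

instantiation alg :: (field) ring_1
begin
lift_definition zero_alg :: "'a alg" is "\<lambda>_ _ _. 0" by simp
lift_definition one_alg :: "'a alg" is "\<lambda>i r s. if r < adim i \<and> r = s then 1 else 0" by auto
lift_definition plus_alg :: "'a alg \<Rightarrow> 'a alg \<Rightarrow> 'a alg" is "\<lambda>x y i r s. x i r s + y i r s" by simp
lift_definition minus_alg :: "'a alg \<Rightarrow> 'a alg \<Rightarrow> 'a alg" is "\<lambda>x y i r s. x i r s - y i r s" by simp
lift_definition uminus_alg :: "'a alg \<Rightarrow> 'a alg" is "\<lambda>x i r s. - x i r s" by simp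
lift_definition times_alg :: "'a alg \<Rightarrow> 'a alg \<Rightarrow> 'a alg" is
  "\<lambda>x y i r s. \<Sum>t<adim i. x i r t * y i t s" by (auto intro: sum.neutral)
instance
proof
  fix a b c :: "'a alg"
  show "a * b * c = a * (b * c)"
  proof (transfer, intro ext)
    fix a b c :: "'a elem" and i r s
    have "(\<Sum>t<adim i. (\<Sum>u<adim i. a i r u * b i u t) * c i t s)
        = (\<Sum>t<adim i. \<Sum>u<adim i. a i r u * (b i u t * c i t s))"
      by (simp add: sum_distrib_right mult.assoc)
    also have "\<dots> = (\<Sum>u<adim i. \<Sum>t<adim i. a i r u * (b i u t * c i t s))" by (rule sum.swap)
    finally show "(\<Sum>t<adim i. (\<Sum>u<adim i. a i r u * b i u t) * c i t s) =
        (\<Sum>u<adim i. a i r u * (\<Sum>t<adim i. b i u t * c i t s))"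
      by (simp add: sum_distrib_left)
  qed
  show "1 * a = a"
  proof (transfer, intro ext)
    fix a :: "'a elem" and i r s
    assume a: "\<forall>i r s. adim i \<le> r \<or> adim i \<le> s \<longrightarrow> a i r s = 0"
    show "(\<Sum>t<adim i. (if r < adim i \<and> r = t then 1 else 0) * a i t s) = a i r s"
    proof (cases "r < adim i")
      case True
      have "(\<Sum>t<adim i. (if r < adim i \<and> r = t then 1 else 0) * a i t s) = (\<Sum>t<adim i. if r = t then a i t s else 0)"
        using True by (intro sum.cong) auto
      then show ?thesis using True by simp
    qed (use a in auto)
  qed
  show "a * 1 = a"
  proof (transfer, intro ext)
    fix a :: "'a elem" and i r s
    assume a: "\<forall>i r s. adim i \<le> r \<or> adim i \<le> s \<longrightarrow> a i r s = 0"
    show "(\<Sum>t<adim i. a i r t * (if t < adim i \<and> t = s then 1 else 0)) = a i r s"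
    proof (cases "s < adim i")
      case True
      have "(\<Sum>t<adim i. a i r t * (if t < adim i \<and> t = s then 1 else 0)) = (\<Sum>t<adim i. if t = s then a i r t else 0)"
        by (intro sum.cong) auto
      then show ?thesis using True by simp
    qed (use a in auto)
  qed
  show "(0::'a alg) \<noteq> 1" 
  proof
    assume "(0::'a alg) = 1"
    then have "ent (0::'a alg) 0 0 0 = ent 1 0 0 0" by simp
    then show False by (simp add: zero_alg.rep_eq one_alg.rep_eq adim_def)
  qed
qed (transfer; auto simp: fun_eq_iff algebra_simps sum.distrib)+
end

lift_definition sc :: "'a::field \<Rightarrow> 'a alg \<Rightarrow> 'a alg" is "\<lambda>c x i r s. c * x i r s" by simp

lemmas ent_simps = zero_alg.rep_eq one_alg.rep_eq plus_alg.rep_eq minus_alg.rep_eq uminus_alg.rep_eq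
  times_alg.rep_eq sc.rep_eq

lemma ent_sum: "ent (sum f A) i r s = (\<Sum>x\<in>A. ent (f x) i r s)"
  by (induction A rule: infinite_finite_induct) (auto simp: ent_simps)

lemma sc_simps [simp]:
  "sc 0 x = 0" "sc a 0 = 0" "sc 1 x = x" "sc a (sc b x) = sc (a * b) x"
  "sc a x * y = sc a (x * y)" "x * sc a y = sc a (x * y)"
  by (transfer, auto simp: fun_eq_iff sum_distrib_left algebra_simps)+

lemma sc_distrib:
  "sc a (x + y) = sc a x + sc a y" "sc (a + b) x = sc a x + sc b x"
  "sc a (x - y) = sc a x - sc a y" "sc (a - b) x = sc a x - sc b x"
  "sc a (- x) = - sc a x" "sc (- a) x = - sc a x"
  by (transfer, auto simp: fun_eq_iff algebra_simps)+

lemma sc_sum: "sc a (sum f A) = (\<Sum>x\<in>A. sc a (f x))"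
  by (induction A rule: infinite_finite_induct) (auto simp: sc_distrib)

lemma sc_inj: "a \<noteq> 0 \<Longrightarrow> sc a x = sc a y \<longleftrightarrow> x = y"
  by transfer (auto simp: fun_eq_iff)

definition ANset :: "nat \<Rightarrow> 'a::field alg set" where
  "ANset N = {x. ent x \<in> Aset N}"

definition cen :: "nat \<Rightarrow> (nat \<Rightarrow> 'a::field) \<Rightarrow> 'a alg" where
  "cen N z = Alg (\<lambda>i r s. if i < N \<and> r < adim i \<and> r = s then z i else 0)"

text \<open>The matrix unit of component \<open>i\<close>, and zero when the indices are out of
  range.\<close>

definition mu :: "nat \<Rightarrow> nat \<Rightarrow> nat \<Rightarrow> 'a::field alg" where
  "mu i r s = Alg (\<lambda>j p q. if j = i \<and> p = r \<and> q = s \<and> r < adim i \<and> s < adim i then 1 else 0)"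

lemma ent_cen: "ent (cen N z) i r s = (if i < N \<and> r < adim i \<and> r = s then z i else 0)"
  unfolding cen_def by (subst Alg_inverse) auto

lemma ent_mu: "ent (mu i r s) j p q = (if j = i \<and> p = r \<and> q = s \<and> r < adim i \<and> s < adim i then 1 else 0)"
  unfolding mu_def by (subst Alg_inverse) auto

lemma ANset_iff: "x \<in> ANset N \<longleftrightarrow> (\<forall>i r s. N \<le> i \<longrightarrow> ent x i r s = 0)"
  using ent_outside by (auto simp: ANset_def Aset_def)

lemma ANset_closed:
  "0 \<in> ANset N" "x \<in> ANset N \<Longrightarrow> y \<in> ANset N \<Longrightarrow> x + y \<in> ANset N"
  "x \<in> ANset N \<Longrightarrow> y \<in> ANset N \<Longrightarrow> x - y \<in> ANset N" "x \<in> ANset N \<Longrightarrow> - x \<in> ANset N"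
  "x \<in> ANset N \<Longrightarrow> x * y \<in> ANset N" "y \<in> ANset N \<Longrightarrow> x * y \<in> ANset N"
  "x \<in> ANset N \<Longrightarrow> sc a x \<in> ANset N"
  by (auto simp: ANset_iff ent_simps)

lemma ANset_sum: "(\<And>j. j \<in> J \<Longrightarrow> f j \<in> ANset N) \<Longrightarrow> sum f J \<in> ANset N"
  by (auto simp: ANset_iff ent_sum)

lemma cen_ANset: "cen N z \<in> ANset N" by (simp add: ANset_iff ent_cen)
lemma mu_ANset: "i < N \<Longrightarrow> mu i r s \<in> ANset N" by (simp add: ANset_iff ent_mu)

lemma ent_cen_mult_left: "ent (cen N z * x) i r s = (if i < N then z i * ent x i r s else 0)"
proof (cases "r < adim i")
  case True
  have "ent (cen N z * x) i r s = (\<Sum>t<adim i. if r = t then (if i < N then z i else 0) * ent x i t s else 0)"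
    unfolding ent_simps ent_cen using True by (intro sum.cong) auto
  then show ?thesis using True by (simp add: ent_simps)
qed (simp add: ent_outside)

lemma ent_cen_mult_right: "ent (x * cen N z) i r s = (if i < N then z i * ent x i r s else 0)"
proof (cases "s < adim i")
  case True
  have "ent (x * cen N z) i r s = (\<Sum>t<adim i. if t = s then (if i < N then z i else 0) * ent x i r t else 0)"
    unfolding ent_simps ent_cen using True by (intro sum.cong) auto
  then show ?thesis using True by (simp add: ent_simps)
qed (simp add: ent_outside)

lemma cen_commute: "cen N z * x = x * cen N z"
  by (rule alg_eqI) (simp add: ent_cen_mult_left ent_cen_mult_right)

abbreviation idn :: "nat \<Rightarrow> 'a::field alg" where "idn N \<equiv> cen N (\<lambda>_. 1)"

lemma idn_mult: "x \<in> ANset N \<Longrightarrow> idn N * x = x" "x \<in> ANset N \<Longrightarrow> x * idn N = x"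
  by (rule alg_eqI; auto simp: ent_cen_mult_left ent_cen_mult_right ANset_iff)+

lemma cen_eq_sum: "cen N z = (\<Sum>i<N. sc (z i) (cen N (\<lambda>j. if j = i then 1 else 0)))"
proof (rule alg_eqI)
  fix i r s
  assume rs: "r < adim i" "s < adim i"
  have *: "ent (\<Sum>i<N. sc (z i) (cen N (\<lambda>j. if j = i then 1 else 0))) i r s
      = (\<Sum>j<N. if i = j then (if r = s then z j else 0) else 0)"
    unfolding ent_sum ent_simps ent_cen using rs by (intro sum.cong) auto
  show "ent (cen N z) i r s = ent (\<Sum>i<N. sc (z i) (cen N (\<lambda>j. if j = i then 1 else 0))) i r s"
    unfolding * using rs by (simp add: ent_cen)
qed

section \<open>Discrete valuation rings and orders\<close>

locale dvr =
  fixes Ov :: "'a::field set" and pu :: 'a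
  assumes cdvr: "complete_dvr Ov pu"
begin

lemma O_closed [simp, intro]:
  "0 \<in> Ov" "1 \<in> Ov" "pu \<in> Ov"
  "x \<in> Ov \<Longrightarrow> y \<in> Ov \<Longrightarrow> x + y \<in> Ov" "x \<in> Ov \<Longrightarrow> y \<in> Ov \<Longrightarrow> x * y \<in> Ov" "x \<in> Ov \<Longrightarrow> - x \<in> Ov"
  using cdvr unfolding complete_dvr_def by blast+

lemma O_diff [simp, intro]: "x \<in> Ov \<Longrightarrow> y \<in> Ov \<Longrightarrow> x - y \<in> Ov"
  using O_closed(4)[of x "- y"] by auto

lemma O_sum [simp, intro]: "(\<And>j. j \<in> J \<Longrightarrow> f j \<in> Ov) \<Longrightarrow> sum f J \<in> Ov"
  by (induction J rule: infinite_finite_induct) auto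

lemma O_pow [simp, intro]: "x \<in> Ov \<Longrightarrow> x ^ m \<in> Ov"
  by (induction m) auto

lemma pu_nz [simp]: "pu \<noteq> 0" and inv_pu: "inverse pu \<notin> Ov"
  using cdvr unfolding complete_dvr_def by blast+

lemma uniform_rep: "x \<noteq> 0 \<Longrightarrow> \<exists>u m. u \<in> Ov \<and> inverse u \<in> Ov \<and> x = u * pu powi m"
  using cdvr unfolding complete_dvr_def by blast

lemma piO_closed: 
  "0 \<in> piO Ov pu m" "x \<in> piO Ov pu m \<Longrightarrow> y \<in> piO Ov pu m \<Longrightarrow> x + y \<in> piO Ov pu m"
  "x \<in> piO Ov pu m \<Longrightarrow> y \<in> piO Ov pu m \<Longrightarrow> x - y \<in> piO Ov pu m"
  "x \<in> piO Ov pu m \<Longrightarrow> y \<in> Ov \<Longrightarrow> x * y \<in> piO Ov pu m"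
  "x \<in> Ov \<Longrightarrow> y \<in> piO Ov pu m \<Longrightarrow> x * y \<in> piO Ov pu m"
proof -
  have I: "z \<in> Ov \<Longrightarrow> x = pu ^ m * z \<Longrightarrow> x \<in> piO Ov pu m" for x z by (auto simp: piO_def)
  have E: "x \<in> piO Ov pu m \<Longrightarrow> \<exists>z\<in>Ov. x = pu ^ m * z" for x by (auto simp: piO_def)
  show "0 \<in> piO Ov pu m" by (rule I[of 0]) auto
  show "x + y \<in> piO Ov pu m" if xy: "x \<in> piO Ov pu m" "y \<in> piO Ov pu m"
    using E[OF xy(1)] E[OF xy(2)] by (elim bexE) (rule I, erule (1) O_closed(4), simp add: distrib_left)
  show "x - y \<in> piO Ov pu m" if xy: "x \<in> piO Ov pu m" "y \<in> piO Ov pu m"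
    using E[OF xy(1)] E[OF xy(2)] by (elim bexE) (rule I, erule (1) O_diff, simp add: right_diff_distrib)
  show "x * y \<in> piO Ov pu m" if xy: "x \<in> piO Ov pu m" "y \<in> Ov"
    using E[OF xy(1)] xy(2) by (elim bexE) (rule I, erule (1) O_closed(5), simp)
  show "x * y \<in> piO Ov pu m" if xy: "x \<in> Ov" "y \<in> piO Ov pu m"
    using E[OF xy(2)] xy(1) by (elim bexE) (rule I, erule (1) O_closed(5), simp)
qed

lemma piO_mono: "m \<le> m' \<Longrightarrow> piO Ov pu m' \<subseteq> piO Ov pu m"
proof
  fix x assume m: "m \<le> m'" and "x \<in> piO Ov pu m'"
  then obtain y where y: "x = pu ^ m' * y" "y \<in> Ov" by (auto simp: piO_def)
  have "pu ^ m' = pu ^ m * pu ^ (m' - m)" using m by (simp flip: power_add)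
  then show "x \<in> piO Ov pu m" using y by (auto simp: piO_def mult.assoc)
qed

lemma O_total: "x \<in> Ov \<or> inverse x \<in> Ov"
proof (cases "x = 0")
  case False
  then obtain u m where um: "u \<in> Ov" "inverse u \<in> Ov" "x = u * pu powi m" using uniform_rep by blast
  show ?thesis
  proof (cases "m \<ge> 0")
    case True
    then show ?thesis using um by (auto simp: power_int_def)
  next
    case False
    then have "inverse x = inverse u * pu ^ nat (- m)" using um by (simp add: power_int_def power_inverse)
    then show ?thesis using um by auto
  qed
qed auto

lemma O_scale: "\<exists>m. pu ^ m * x \<in> Ov"
proof (cases "x = 0")
  case False
  then obtain u m where um: "u \<in> Ov" "inverse u \<in> Ov" "x = u * pu powi m" using uniform_rep by blast
  have "pu ^ nat (- m) * x = u * pu ^ nat m"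
    using um by (auto simp: power_int_def power_inverse field_simps)
  then show ?thesis using um by (metis O_closed(3,5) O_pow)
qed auto

lemma O_unit: assumes "x \<in> Ov" "x \<notin> piO Ov pu 1" shows "inverse x \<in> Ov"
proof (cases "x = 0")
  case False
  then obtain u m where um: "u \<in> Ov" "inverse u \<in> Ov" "x = u * pu powi m" using uniform_rep by blast
  show ?thesis
  proof (cases "m \<ge> 1")
    case True
    then have "pu powi m = pu * pu ^ (nat m - 1)"
      by (cases "nat m") (auto simp: power_int_def)
    then have "x = pu ^ 1 * (u * pu ^ (nat m - 1))" using um by simp
    then have "x \<in> piO Ov pu 1" using um unfolding piO_def by blast
    then show ?thesis using assms by simp
  next
    case False
    then have "inverse x = inverse u * pu ^ nat (- m)" using um by (cases "m = 0") (simp_all add: power_int_def power_inverse)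
    then show ?thesis using um by auto
  qed
qed auto

lemma one_notin_piO: "1 \<notin> piO Ov pu 1"
proof
  assume "1 \<in> piO Ov pu 1"
  then obtain x where "1 = pu * x" "x \<in> Ov" by (auto simp: piO_def)
  then have "inverse pu = x" by (simp add: inverse_unique)
  then show False using \<open>x \<in> Ov\<close> inv_pu by simp
qed

lemma one_minus_unit: assumes "a \<in> Ov" shows "1 - pu * a \<noteq> 0" "inverse (1 - pu * a) \<in> Ov"
proof -
  have *: "1 - pu * a \<notin> piO Ov pu 1"
  proof
    assume "1 - pu * a \<in> piO Ov pu 1"
    moreover have "pu * a \<in> piO Ov pu 1" using assms by (auto simp: piO_def)
    ultimately have "1 - pu * a + pu * a \<in> piO Ov pu 1" by (rule piO_closed)
    then show False using one_notin_piO by simp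
  qed
  then show "1 - pu * a \<noteq> 0" using piO_closed(1) by metis
  show "inverse (1 - pu * a) \<in> Ov" using * assms by (intro O_unit) auto
qed

lemma piO_inter: assumes "\<And>m. x \<in> piO Ov pu m" shows "x = 0"
proof (rule ccontr)
  assume nz: "x \<noteq> 0"
  obtain m where m: "pu ^ m * inverse x \<in> Ov" using O_scale by blast
  obtain y where y: "x = pu ^ Suc m * y" "y \<in> Ov" using assms[of "Suc m"] by (auto simp: piO_def)
  have "inverse pu = pu ^ m * inverse x * y" using y(1) nz by (simp add: field_simps)
  moreover have "pu ^ m * inverse x * y \<in> Ov" using m y(2) by blast
  ultimately show False using inv_pu by simp
qed

lemma O_scale_finite: assumes "finite F" shows "\<exists>m. \<forall>x\<in>F. pu ^ m * x \<in> Ov"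
  using assms
proof (induction F)
  case (insert y F)
  then obtain m where m: "\<forall>x\<in>F. pu ^ m * x \<in> Ov" by blast
  obtain m' where m': "pu ^ m' * y \<in> Ov" using O_scale by blast
  have "\<forall>x\<in>insert y F. pu ^ (m + m') * x \<in> Ov"
  proof
    fix x assume "x \<in> insert y F"
    then consider "x = y" | "x \<in> F" by blast
    then show "pu ^ (m + m') * x \<in> Ov"
    proof cases
      case 1
      then have eq: "pu ^ (m + m') * x = pu ^ m * (pu ^ m' * y)" by (simp add: power_add)
      show ?thesis unfolding eq using m' by blast
    next
      case 2
      have eq: "pu ^ (m + m') * x = pu ^ m' * (pu ^ m * x)" by (simp add: power_add)
      show ?thesis unfolding eq using m 2 by blast
    qed
  qed
  then show ?case by blast
qed auto

text \<open>A minimal valuation without a valuation function: divisibility is total by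
  \<open>O_total\<close>, so one of the \<open>c i\<close> divides all the others.\<close>

lemma min_valuation:
  assumes "finite I" "I \<noteq> {}" "\<And>i. i \<in> I \<Longrightarrow> c i \<noteq> 0"
  shows "\<exists>i\<in>I. \<forall>j\<in>I. c j * inverse (c i) \<in> Ov"
  using assms
proof (induction I rule: finite_ne_induct)
  case (singleton x)
  then show ?case by auto
next
  case (insert x F)
  then obtain i where i: "i \<in> F" "\<forall>j\<in>F. c j * inverse (c i) \<in> Ov" by auto
  have nz: "c i \<noteq> 0" "c x \<noteq> 0" using insert i by auto
  show ?case
  proof (cases "c x * inverse (c i) \<in> Ov")
    case True
    then show ?thesis using i by auto
  next
    case False
    then have 1: "c i * inverse (c x) \<in> Ov" using O_total[of "c x * inverse (c i)"] by (simp add: field_simps)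
    have "c j * inverse (c x) \<in> Ov" if "j \<in> F" for j
    proof -
      have "c j * inverse (c x) = (c j * inverse (c i)) * (c i * inverse (c x))" using nz by (simp add: field_simps)
      then show ?thesis using 1 i that by (metis O_closed(5))
    qed
    then show ?thesis using nz by auto
  qed
qed

text \<open>Completeness yields a limit with an unspecified rate. Comparing both \<open>l\<close>
  and \<open>s k\<close> with one late term recovers the rate that the sequence itself has.\<close>

lemma O_complete:
  assumes "\<And>j. s j \<in> Ov" "\<And>k p. k \<le> p \<Longrightarrow> s p - s k \<in> piO Ov pu k"
  shows "\<exists>l\<in>Ov. \<forall>k. l - s k \<in> piO Ov pu k"
proof -
  have cauchy: "\<exists>n0. \<forall>p\<ge>n0. \<forall>q\<ge>n0. s p - s q \<in> piO Ov pu m" for m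
  proof (intro exI[of _ m] allI impI)
    fix p q assume pq: "m \<le> p" "m \<le> q"
    show "s p - s q \<in> piO Ov pu m"
      using piO_closed(3)[OF assms(2)[OF pq(1)] assms(2)[OF pq(2)]] by simp
  qed
  have "\<forall>s :: nat \<Rightarrow> 'a. (\<forall>j. s j \<in> Ov) \<longrightarrow>
        (\<forall>m. \<exists>N. \<forall>p\<ge>N. \<forall>q\<ge>N. s p - s q \<in> piO Ov pu m) \<longrightarrow>
        (\<exists>L\<in>Ov. \<forall>m. \<exists>N. \<forall>p\<ge>N. s p - L \<in> piO Ov pu m)"
    using cdvr unfolding complete_dvr_def by (elim conjE)
  from this[THEN spec, of s] have "\<exists>l\<in>Ov. \<forall>m. \<exists>n0. \<forall>p\<ge>n0. s p - l \<in> piO Ov pu m"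
    using assms(1) cauchy by simp
  then obtain l where l: "l \<in> Ov" "\<forall>m. \<exists>n0. \<forall>p\<ge>n0. s p - l \<in> piO Ov pu m" by blast
  have "l - s k \<in> piO Ov pu k" for k
  proof -
    obtain n0 where n0: "\<forall>p\<ge>n0. s p - l \<in> piO Ov pu k" using l by blast
    have "(s (max n0 k) - s k) - (s (max n0 k) - l) \<in> piO Ov pu k"
      by (rule piO_closed(3)) (use n0 assms(2)[of k "max n0 k"] in auto)
    then show ?thesis by simp
  qed
  then show ?thesis using l by blast
qed

section \<open>Submodules over the valuation ring and Nakayama's lemma\<close>

definition osub :: "'a alg set \<Rightarrow> bool" where
  "osub X \<longleftrightarrow> 0 \<in> X \<and> (\<forall>x\<in>X. \<forall>y\<in>X. x + y \<in> X) \<and> (\<forall>a\<in>Ov. \<forall>x\<in>X. sc a x \<in> X)"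

lemma osubD:
  assumes "osub X"
  shows "0 \<in> X" "x \<in> X \<Longrightarrow> y \<in> X \<Longrightarrow> x + y \<in> X" "a \<in> Ov \<Longrightarrow> x \<in> X \<Longrightarrow> sc a x \<in> X"
    "x \<in> X \<Longrightarrow> - x \<in> X" "x \<in> X \<Longrightarrow> y \<in> X \<Longrightarrow> x - y \<in> X"
proof -
  show 1: "0 \<in> X" "x \<in> X \<Longrightarrow> y \<in> X \<Longrightarrow> x + y \<in> X" "a \<in> Ov \<Longrightarrow> x \<in> X \<Longrightarrow> sc a x \<in> X" for x y a
    using assms by (auto simp: osub_def)
  show 2: "x \<in> X \<Longrightarrow> - x \<in> X" for x using 1(3)[of "-1" x] by (simp add: sc_distrib)
  show "x \<in> X \<Longrightarrow> y \<in> X \<Longrightarrow> x - y \<in> X" using 1(2)[of x "- y"] 2 by simp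
qed

lemma osub_sum: "osub X \<Longrightarrow> (\<And>j. j \<in> J \<Longrightarrow> f j \<in> X) \<Longrightarrow> sum f J \<in> X"
  by (induction J rule: infinite_finite_induct) (simp_all add: osubD(1,2))

definition gspan :: "nat \<Rightarrow> (nat \<Rightarrow> 'a alg) \<Rightarrow> 'a alg set" where
  "gspan m g = {\<Sum>j<m. sc (c j) (g j) | c. \<forall>j<m. c j \<in> Ov}"

lemma gspanI: "\<forall>j<m. c j \<in> Ov \<Longrightarrow> x = (\<Sum>j<m. sc (c j) (g j)) \<Longrightarrow> x \<in> gspan m g"
  unfolding gspan_def by blast

lemma gspanE:
  assumes "x \<in> gspan m g" obtains c where "\<forall>j<m. c j \<in> Ov" "x = (\<Sum>j<m. sc (c j) (g j))"
  using assms unfolding gspan_def by blast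

lemma gspan_osub: "osub (gspan m g)"
  unfolding osub_def
proof (intro conjI ballI)
  show "0 \<in> gspan m g" by (rule gspanI[of _ "\<lambda>_. 0"]) simp_all
  show "x + y \<in> gspan m g" if x: "x \<in> gspan m g" and y: "y \<in> gspan m g" for x y
  proof -
    obtain c where c: "\<forall>j<m. c j \<in> Ov" "x = (\<Sum>j<m. sc (c j) (g j))" using gspanE[OF x] .
    obtain d where d: "\<forall>j<m. d j \<in> Ov" "y = (\<Sum>j<m. sc (d j) (g j))" using gspanE[OF y] .
    show ?thesis
      by (rule gspanI[of _ "\<lambda>j. c j + d j"]) (use c d in \<open>simp_all add: sc_distrib sum.distrib\<close>)
  qed
  show "sc a x \<in> gspan m g" if a: "a \<in> Ov" and x: "x \<in> gspan m g" for a x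
  proof -
    obtain c where c: "\<forall>j<m. c j \<in> Ov" "x = (\<Sum>j<m. sc (c j) (g j))" using gspanE[OF x] .
    show ?thesis
      by (rule gspanI[of _ "\<lambda>j. a * c j"]) (use a c in \<open>simp_all add: sc_sum\<close>)
  qed
qed

lemma gspan_gen:
  assumes "j < m" shows "g j \<in> gspan m g"
proof (rule gspanI[of _ "\<lambda>i. if i = j then 1 else 0"])
  have "(\<Sum>i<m. sc (if i = j then 1 else 0) (g i)) = (\<Sum>i<m. if i = j then g i else 0)"
    by (intro sum.cong) auto
  then show "g j = (\<Sum>i<m. sc (if i = j then 1 else 0) (g i))" using assms by simp
qed simp

text \<open>Generators are eliminated one at a time, from the last to the first. While
  \<open>L\<close> is \<open>Y\<close> plus the span of the first \<open>k + 1\<close> generators,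
  the hypothesis for \<open>g k\<close> expresses it through \<open>Y\<close>, earlier generators
  and a multiple of itself divisible by \<open>pu\<close>; the collected coefficient
  \<open>1 - pu * c k\<close> is a unit, so \<open>g k\<close> can be solved for.\<close>

lemma nakayama:
  assumes L: "L = gspan m g" and Y: "osub Y"
    and *: "\<And>x. x \<in> L \<Longrightarrow> \<exists>y\<in>Y. \<exists>z\<in>L. x = y + sc pu z"
  shows "L \<subseteq> Y"
proof -
  have g: "g j \<in> L" if "j < m" for j using gspan_gen that L by simp
  have "k \<le> m \<Longrightarrow> (\<forall>x\<in>L. \<exists>y\<in>Y. \<exists>z\<in>gspan k g. x = y + z) \<Longrightarrow> L \<subseteq> Y" for k
  proof (induction k)
    case 0
    have "gspan 0 g = {0}" by (auto simp: gspan_def)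
    then show ?case using 0 by auto
  next
    case (Suc k)
    obtain y z where yz: "y \<in> Y" "z \<in> L" "g k = y + sc pu z" using * g[of k] Suc.prems(1) by fastforce
    obtain y' z' where yz': "y' \<in> Y" "z' \<in> gspan (Suc k) g" "z = y' + z'" using Suc.prems(2) yz by blast
    obtain c where c: "\<forall>j<Suc k. c j \<in> Ov" "z' = (\<Sum>j<Suc k. sc (c j) (g j))" using gspanE[OF yz'(2)] .
    define r where "r = (\<Sum>j<k. sc (c j) (g j))"
    have r: "r \<in> gspan k g" unfolding r_def by (rule gspanI) (use c in auto)
    have z': "z' = r + sc (c k) (g k)" using c by (simp add: r_def)
    let ?u = "1 - pu * c k"
    have u: "?u \<noteq> 0" "inverse ?u \<in> Ov" using one_minus_unit[of "c k"] c by auto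
    have "g k - sc pu (sc (c k) (g k)) = (y + sc pu y') + sc pu r"
      using yz(3) yz'(3) z' by (simp add: sc_distrib algebra_simps)
    then have "sc ?u (g k) = (y + sc pu y') + sc pu r" by (simp add: sc_distrib)
    then have "sc (inverse ?u) (sc ?u (g k)) = sc (inverse ?u) (y + sc pu y') + sc (inverse ?u) (sc pu r)" by (simp only: sc_distrib)
    then have gk: "g k = sc (inverse ?u) (y + sc pu y') + sc (inverse ?u) (sc pu r)" using u by simp
    have Yk: "sc (inverse ?u) (y + sc pu y') \<in> Y" using Y u yz yz' by (intro osubD[OF Y]) auto
    have Rk: "sc (inverse ?u) (sc pu r) \<in> gspan k g" using r u by (intro osubD[OF gspan_osub]) auto
    show ?case
    proof (rule Suc.IH)
      show "k \<le> m" using Suc.prems by simp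
      show "\<forall>x\<in>L. \<exists>y\<in>Y. \<exists>z\<in>gspan k g. x = y + z"
      proof
        fix x assume "x \<in> L"
        then obtain y1 z1 where 1: "y1 \<in> Y" "z1 \<in> gspan (Suc k) g" "x = y1 + z1" using Suc.prems(2) by blast
        obtain d where d: "\<forall>j<Suc k. d j \<in> Ov" "z1 = (\<Sum>j<Suc k. sc (d j) (g j))" using gspanE[OF 1(2)] .
        have dk: "(\<Sum>j<k. sc (d j) (g j)) \<in> gspan k g" by (rule gspanI) (use d in auto)
        have "x = (y1 + sc (d k) (sc (inverse ?u) (y + sc pu y'))) + ((\<Sum>j<k. sc (d j) (g j)) + sc (d k) (sc (inverse ?u) (sc pu r)))"
        proof -
          have "x = y1 + ((\<Sum>j<k. sc (d j) (g j)) + sc (d k) (g k))" using 1(3) d(2) by simp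
          then show ?thesis unfolding gk by (simp add: sc_distrib algebra_simps)
        qed
        moreover have "y1 + sc (d k) (sc (inverse ?u) (y + sc pu y')) \<in> Y" using d(1) by (intro osubD(2)[OF Y 1(1) osubD(3)[OF Y _ Yk]]) simp
        moreover have "(\<Sum>j<k. sc (d j) (g j)) + sc (d k) (sc (inverse ?u) (sc pu r)) \<in> gspan k g"
          using d(1) by (intro osubD(2)[OF gspan_osub dk osubD(3)[OF gspan_osub _ Rk]]) simp
        ultimately show "\<exists>y\<in>Y. \<exists>z\<in>gspan k g. x = y + z" by blast
      qed
    qed
  qed
  moreover have "\<forall>x\<in>L. \<exists>y\<in>Y. \<exists>z\<in>gspan m g. x = y + z"
    using L osubD(1)[OF Y] by force
  ultimately show ?thesis by blast
qed

end

section \<open>Full orders, congruence modulo powers of the uniformiser, and lifting of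
  idempotents\<close>

locale full_order = dvr Ov pu for Ov :: "'a::field set" and pu +
  fixes N :: nat and L :: "'a alg set"
  assumes LA: "L \<subseteq> ANset N"
    and Lfg: "\<exists>m g. L = gspan m g"
    and Lone: "idn N \<in> L"
    and Lmult: "x \<in> L \<Longrightarrow> y \<in> L \<Longrightarrow> x * y \<in> L"
    and Lfull: "x \<in> ANset N \<Longrightarrow> \<exists>m. sc (pu ^ m) x \<in> L"
begin

lemma Losub: "osub L" using Lfg gspan_osub by blast

lemmas L0 [simp, intro] = osubD(1)[OF Losub]
lemmas Lcl [simp, intro] = osubD(2-)[OF Losub] Lmult
lemmas Lun [simp] = idn_mult[OF subsetD[OF LA]]

definition cong :: "nat \<Rightarrow> 'a alg \<Rightarrow> 'a alg \<Rightarrow> bool" where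
  "cong m x y \<longleftrightarrow> (\<exists>z\<in>L. x - y = sc (pu ^ m) z)"

lemma cong_refl [simp]: "cong m x x" unfolding cong_def by (rule bexI[of _ 0]) auto

lemma cong_sym: "cong m x y \<Longrightarrow> cong m y x"
proof -
  assume "cong m x y"
  then obtain z where z: "z \<in> L" "x - y = sc (pu ^ m) z" by (auto simp: cong_def)
  have "y - x = sc (pu ^ m) (- z)" by (simp add: sc_distrib flip: z(2))
  then show ?thesis using z(1) unfolding cong_def by blast
qed

lemma cong_trans [trans]: "cong m x y \<Longrightarrow> cong m y z \<Longrightarrow> cong m x z"
proof -
  assume "cong m x y" "cong m y z"
  then obtain a b where ab: "a \<in> L" "b \<in> L" "x - y = sc (pu ^ m) a" "y - z = sc (pu ^ m) b" by (auto simp: cong_def)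
  then have "x - z = sc (pu ^ m) (a + b)" by (simp add: sc_distrib flip: ab(3,4))
  then show ?thesis using ab(1,2) unfolding cong_def by blast
qed

lemma cong_add: "cong m x y \<Longrightarrow> cong m x' y' \<Longrightarrow> cong m (x + x') (y + y')"
proof -
  assume "cong m x y" "cong m x' y'"
  then obtain a b where ab: "a \<in> L" "b \<in> L" "x - y = sc (pu ^ m) a" "x' - y' = sc (pu ^ m) b" by (auto simp: cong_def)
  then have "(x + x') - (y + y') = sc (pu ^ m) (a + b)" by (simp add: sc_distrib flip: ab(3,4))
  then show ?thesis using ab(1,2) unfolding cong_def by blast
qed

lemma cong_diff: "cong m x y \<Longrightarrow> cong m x' y' \<Longrightarrow> cong m (x - x') (y - y')"
proof -
  assume "cong m x y" "cong m x' y'"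
  then obtain a b where ab: "a \<in> L" "b \<in> L" "x - y = sc (pu ^ m) a" "x' - y' = sc (pu ^ m) b" by (auto simp: cong_def)
  then have "(x - x') - (y - y') = sc (pu ^ m) (a - b)" by (simp add: sc_distrib flip: ab(3,4))
  then show ?thesis using ab(1,2) unfolding cong_def by blast
qed

lemma cong_left: assumes "p \<in> L" "cong m x y" shows "cong m (p * x) (p * y)"
proof -
  obtain z where z: "z \<in> L" "x - y = sc (pu ^ m) z" using assms(2) by (auto simp: cong_def)
  have "p * x - p * y = sc (pu ^ m) (p * z)" by (simp add: z(2) flip: right_diff_distrib)
  then show ?thesis using z(1) assms(1) unfolding cong_def by blast
qed

lemma cong_right: assumes "p \<in> L" "cong m x y" shows "cong m (x * p) (y * p)"
proof -
  obtain z where z: "z \<in> L" "x - y = sc (pu ^ m) z" using assms(2) by (auto simp: cong_def)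
  have "x * p - y * p = sc (pu ^ m) (z * p)" by (simp add: z(2) flip: left_diff_distrib)
  then show ?thesis using z(1) assms(1) unfolding cong_def by blast
qed

lemma cong_mult: "x \<in> L \<Longrightarrow> y' \<in> L \<Longrightarrow> cong m x y \<Longrightarrow> cong m x' y' \<Longrightarrow> cong m (x * x') (y * y')"
  using cong_left[of x m x' y'] cong_right[of y' m x y] cong_trans by blast

lemma cong_mono: "cong m x y \<Longrightarrow> m' \<le> m \<Longrightarrow> cong m' x y"
proof -
  assume "cong m x y" and m: "m' \<le> m"
  then obtain z where z: "z \<in> L" "x - y = sc (pu ^ m) z" by (auto simp: cong_def)
  have "pu ^ m = pu ^ m' * pu ^ (m - m')" using m by (simp flip: power_add)
  then have "x - y = sc (pu ^ m') (sc (pu ^ (m - m')) z)" using z by simp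
  then show ?thesis using z unfolding cong_def by blast
qed

text \<open>Finite generation gives all matrix entries of elements of \<open>L\<close> a common
  denominator at each place, so \<open>piO_inter\<close> applies to the cleared entries.\<close>

lemma cong_all: assumes "\<And>m. cong m x y" shows "x = y"
proof -
  obtain m g where L: "L = gspan m g" using Lfg by blast
  have "ent (x - y) i r s = 0" for i r s
  proof -
    obtain k where k: "\<forall>a\<in>(\<lambda>j. ent (g j) i r s) ` {..<m}. pu ^ k * a \<in> Ov"
      using O_scale_finite[of "(\<lambda>j. ent (g j) i r s) ` {..<m}"] by auto
    have kL: "pu ^ k * ent z i r s \<in> Ov" if "z \<in> L" for z
    proof -
      obtain c where c: "\<forall>j<m. c j \<in> Ov" "z = (\<Sum>j<m. sc (c j) (g j))" using gspanE \<open>z \<in> L\<close> unfolding L .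
      have "pu ^ k * ent z i r s = (\<Sum>j<m. c j * (pu ^ k * ent (g j) i r s))"
        unfolding c(2) by (simp add: ent_sum ent_simps sum_distrib_left algebra_simps)
      then show ?thesis using k c by (auto intro!: O_sum)
    qed
    have "pu ^ k * ent (x - y) i r s \<in> piO Ov pu n" for n
    proof -
      obtain z where z: "z \<in> L" "x - y = sc (pu ^ n) z" using assms[of n] by (auto simp: cong_def)
      then have "pu ^ k * ent (x - y) i r s = pu ^ n * (pu ^ k * ent z i r s)" by (simp add: ent_simps)
      then show ?thesis using kL z by (auto simp: piO_def)
    qed
    then have "pu ^ k * ent (x - y) i r s = 0" by (rule piO_inter)
    then show ?thesis by simp
  qed
  then have "x - y = 0" by (intro alg_eqI) (simp add: ent_simps)
  then show ?thesis by simp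
qed

text \<open>Newton iteration for \<open>e * e = e\<close>: the step 3 e^2 - 2 e^3 moves
  \<open>e\<close> by a multiple of the defect \<open>t\<close> and replaces the defect by t^2 (4 t
  - 3).\<close>

lemma idempotent_step:
  fixes e :: "'a alg"
  defines "t \<equiv> e * e - e" and "e' \<equiv> sc 3 (e * e) - sc 2 (e * e * e)"
  shows "e' - e = t - sc 2 (t * e)" "e' * e' - e' = t * (sc 4 (t * t) - sc 3 t)"
proof -
  have n: "sc 2 x = x + x" "sc 3 x = x + x + x" "sc 4 x = x + x + x + x" for x :: "'a alg"
    using sc_distrib(2)[of 1 1 x] sc_distrib(2)[of 2 1 x] sc_distrib(2)[of 3 1 x] by simp_all
  show "e' - e = t - sc 2 (t * e)" unfolding t_def e'_def n by (simp add: algebra_simps)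
  show "e' * e' - e' = t * (sc 4 (t * t) - sc 3 t)" unfolding t_def e'_def n by (simp add: algebra_simps)
qed

text \<open>Each Newton iterate is a polynomial in \<open>x\<close> without constant term, so a
  one-sided identity \<open>p\<close> of \<open>x\<close> remains one for every iterate and for the
  limit. The last two clauses record this; they are what makes a second lifted idempotent exactly
  orthogonal to a first.\<close>

lemma idempotent_lift:
  assumes x: "x \<in> L" and xx: "cong 1 (x * x) x"
  shows "\<exists>e\<in>L. e * e = e \<and> cong 1 e x \<and> (\<forall>p\<in>L. p * x = x \<longrightarrow> p * e = e) \<and> (\<forall>p\<in>L. x * p = x \<longrightarrow> e * p = e)"
proof -
  define F where "F = (\<lambda>e :: 'a alg. sc 3 (e * e) - sc 2 (e * e * e))"
  define xs where "xs k = (F ^^ k) x" for k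
  have xs_Suc: "xs (Suc k) = F (xs k)" for k by (simp add: xs_def)
  have num: "of_nat q \<in> Ov" for q by (induction q) auto
  have num': "2 \<in> Ov" "3 \<in> Ov" "4 \<in> Ov" using num[of 2] num[of 3] num[of 4] by simp_all
  have xs_L: "xs k \<in> L" for k
    by (induction k) (use x num' in \<open>auto simp: xs_Suc F_def, simp add: xs_def\<close>)
  have step: "cong (Suc k) (xs (Suc k)) (xs k)" if idk: "cong (Suc k) (xs k * xs k) (xs k)" for k
  proof -
    obtain w where w: "w \<in> L" "xs k * xs k - xs k = sc (pu ^ Suc k) w" using idk by (auto simp: cong_def)
    have "xs (Suc k) - xs k = sc (pu ^ Suc k) (w - sc 2 (w * xs k))"
      unfolding xs_Suc F_def idempotent_step(1) w(2) by (simp add: sc_distrib mult.commute)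
    then show ?thesis using w xs_L num' by (auto simp: cong_def)
  qed
  have idem: "cong (Suc k) (xs k * xs k) (xs k)" for k
  proof (induction k)
    case 0
    then show ?case using xx by (simp add: xs_def)
  next
    case (Suc k)
    obtain w where w: "w \<in> L" "xs k * xs k - xs k = sc (pu ^ Suc k) w" using Suc by (auto simp: cong_def)
    define y where "y = w * (sc (pu ^ Suc k * 4) (w * w) - sc 3 w)"
    have "xs (Suc k) * xs (Suc k) - xs (Suc k) = sc (pu ^ Suc k * pu ^ Suc k) y"
      unfolding xs_Suc F_def idempotent_step(2) w(2) y_def by (simp add: sc_distrib right_diff_distrib ac_simps)
    \<comment> \<open>The defect is divisible by the square of the previous power; one additional
      factor \<open>pu\<close> per step is all that the limit argument keeps.\<close>
    also have "pu ^ Suc k * pu ^ Suc k = pu ^ Suc (Suc k) * pu ^ k" by simp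
    finally have "xs (Suc k) * xs (Suc k) - xs (Suc k) = sc (pu ^ Suc (Suc k)) (sc (pu ^ k) y)" by (simp add: mult.assoc)
    moreover have "y \<in> L" unfolding y_def using w num' by (intro Lcl) auto
    ultimately show ?case unfolding cong_def by blast
  qed
  obtain m g where L: "L = gspan m g" using Lfg by blast
  \<comment> \<open>The limit is taken coefficientwise in \<open>Ov\<close>. The generators may be
    dependent, so coefficients are chosen for each difference of iterates and then summed, rather
    than for the iterates themselves.\<close>
  have "\<forall>k. \<exists>c. (\<forall>j<m. c j \<in> Ov) \<and> xs (Suc k) - xs k = sc (pu ^ Suc k) (\<Sum>j<m. sc (c j) (g j))"
  proof
    fix k
    obtain w where w: "w \<in> L" "xs (Suc k) - xs k = sc (pu ^ Suc k) w" using step[OF idem, of k] unfolding cong_def by blast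
    obtain c where c: "\<forall>j<m. c j \<in> Ov" "w = (\<Sum>j<m. sc (c j) (g j))" using gspanE w(1) unfolding L .
    show "\<exists>c. (\<forall>j<m. c j \<in> Ov) \<and> xs (Suc k) - xs k = sc (pu ^ Suc k) (\<Sum>j<m. sc (c j) (g j))"
      by (rule exI[of _ c]) (use c(1) w(2) in \<open>simp add: c(2)\<close>)
  qed
  then obtain c where c: "\<And>k j. j < m \<Longrightarrow> c k j \<in> Ov"
    "\<And>k. xs (Suc k) - xs k = sc (pu ^ Suc k) (\<Sum>j<m. sc (c k j) (g j))"
    unfolding choice_iff by blast
  define s where "s j k = (\<Sum>p<k. pu ^ Suc p * c p j)" for j k
  have xs_eq: "xs k = x + (\<Sum>j<m. sc (s j k) (g j))" for k
  proof (induction k)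
    case 0
    then show ?case by (simp add: xs_def s_def)
  next
    case (Suc k)
    have "xs (Suc k) = xs k + (xs (Suc k) - xs k)" by simp
    also have "\<dots> = x + (\<Sum>j<m. sc (s j k) (g j)) + (\<Sum>j<m. sc (pu ^ Suc k * c k j) (g j))"
      unfolding c(2) unfolding Suc by (simp add: sc_sum)
    also have "\<dots> = x + (\<Sum>j<m. sc (s j (Suc k)) (g j))" by (simp add: s_def sc_distrib sum.distrib)
    finally show ?case .
  qed
  have s_diff: "s j p - s j k \<in> piO Ov pu k" if "j < m" "k \<le> p" for j k p
    using that(2)
  proof (induction p rule: dec_induct)
    case (step p)
    have "pu ^ Suc p * c p j \<in> piO Ov pu (Suc p)" using c(1) that by (auto simp: piO_def)
    then have "pu ^ Suc p * c p j \<in> piO Ov pu k" using piO_mono[of k "Suc p"] step by auto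
    from piO_closed(2)[OF step.IH this] show ?case by (simp add: s_def algebra_simps)
  qed (simp add: piO_closed)
  have "\<exists>l\<in>Ov. \<forall>k. l - s j k \<in> piO Ov pu k" if "j < m" for j
    by (rule O_complete) (use that s_diff c(1) in \<open>auto simp: s_def\<close>)
  then obtain l where l: "\<And>j. j < m \<Longrightarrow> l j \<in> Ov" "\<And>j k. j < m \<Longrightarrow> l j - s j k \<in> piO Ov pu k" by metis
  define e where "e = x + (\<Sum>j<m. sc (l j) (g j))"
  have eL: "e \<in> L" unfolding e_def using x l L gspan_gen by (intro Lcl(1) osub_sum[OF Losub] Lcl(2)) auto
  have e_xs: "cong k e (xs k)" for k
  proof -
    have "\<forall>j<m. \<exists>d\<in>Ov. l j - s j k = pu ^ k * d" using l(2) by (auto simp: piO_def)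
    then obtain d where d: "\<And>j. j < m \<Longrightarrow> d j \<in> Ov \<and> l j - s j k = pu ^ k * d j" by metis
    have "e - xs k = (\<Sum>j<m. sc (l j - s j k) (g j))" unfolding e_def xs_eq by (simp add: sc_distrib sum_subtractf)
    also have "\<dots> = sc (pu ^ k) (\<Sum>j<m. sc (d j) (g j))" using d by (simp add: sc_sum)
    finally have "e - xs k = sc (pu ^ k) (\<Sum>j<m. sc (d j) (g j))" .
    moreover have "(\<Sum>j<m. sc (d j) (g j)) \<in> L" using d L gspan_gen by (intro osub_sum[OF Losub] Lcl(2)) auto
    ultimately show ?thesis by (auto simp: cong_def)
  qed
  have "e * e = e"
  proof (rule cong_all)
    fix k
    have "cong k (e * e) (xs k * xs k)" using e_xs eL xs_L by (intro cong_mult) auto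
    also have "cong k (xs k * xs k) (xs k)" using idem by (rule cong_mono) simp
    also have "cong k (xs k) e" using e_xs by (rule cong_sym)
    finally show "cong k (e * e) e" .
  qed
  moreover have "cong 1 e x"
  proof -
    have "cong 1 e (xs 1)" by (rule e_xs)
    also have "cong 1 (xs 1) (xs 0)" using step[OF idem, of 0] by simp
    finally show ?thesis by (simp add: xs_def)
  qed
  moreover have "p * e = e" if p: "p \<in> L" "p * x = x" for p
  proof (rule cong_all)
    fix k
    have px: "p * xs k = xs k" 
      by (induction k) (use p in \<open>simp_all add: xs_Suc F_def right_diff_distrib flip: mult.assoc, simp add: xs_def\<close>)
    have "cong k (p * e) (p * xs k)" using e_xs p by (intro cong_left)
    then show "cong k (p * e) e" unfolding px using cong_sym[OF e_xs[of k]] by (rule cong_trans)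
  qed
  moreover have "e * p = e" if p: "p \<in> L" "x * p = x" for p
  proof (rule cong_all)
    fix k
    have px: "xs k * p = xs k" 
      by (induction k) (use p in \<open>simp_all add: xs_Suc F_def left_diff_distrib mult.assoc, simp add: xs_def\<close>)
    have "cong k (e * p) (xs k * p)" using e_xs p by (intro cong_right)
    then show "cong k (e * p) e" unfolding px using cong_sym[OF e_xs[of k]] by (rule cong_trans)
  qed
  ultimately show ?thesis using eL by blast
qed

end

section \<open>The path algebra and its ideal\<close>

lemma walk_append: "walk v (xs @ ys) = (case walk v xs of Some w \<Rightarrow> walk w ys | None \<Rightarrow> None)"
  by (induction xs arbitrary: v) auto

lemma walk_0: "ys \<noteq> [] \<Longrightarrow> walk 0 ys = None"
  by (cases ys) (auto, metis asrc.simps arrow.exhaust zero_neq_one zero_neq_numeral)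

text \<open>The default target 0 of an invalid word is not a vertex, and no arrow starts there, so
  an invalid prefix stays invalid. This gives the rule for arbitrary words.\<close>

lemma ptgt_append: "ptgt (ptgt v xs) ys = ptgt v (xs @ ys)"
  by (cases "ys = []") (auto simp: ptgt_def walk_append walk_0 split: option.splits)

lemma walk_in: "v \<in> {1,2,3} \<Longrightarrow> walk v as = Some w \<Longrightarrow> w \<in> {1,2,3}"
proof (induction as arbitrary: v)
  case (Cons a as)
  have "atgt a \<in> {1,2,3}" by (cases a) auto
  then show ?case using Cons by (auto split: if_splits)
qed auto

text \<open>Both sides sum over the cuts of a word into three pieces; the triangle reindexing passes
  from the positions of the two cuts to the lengths of the first two pieces.\<close>

lemma pmul_assoc: "pmul (pmul f g) h = pmul f (pmul g h)"
proof
  fix p :: "nat \<times> arrow list"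
  obtain v as where p: "p = (v, as)" by (cases p)
  let ?n = "length as"
  let ?F = "\<lambda>j k. f (v, take j as) * (g (ptgt v (take j as), take k (drop j as)) *
    h (ptgt v (take (j + k) as), drop (j + k) as))"
  have "pmul (pmul f g) h p = (\<Sum>i\<le>?n. \<Sum>j\<le>i. ?F j (i - j))"
    unfolding p pmul_def prod.case
  proof (rule sum.cong)
    fix i assume "i \<in> {..?n}"
    then have i: "length (take i as) = i" by simp
    show "(\<Sum>j\<le>length (take i as). f (v, take j (take i as)) * g (ptgt v (take j (take i as)), drop j (take i as))) *
        h (ptgt v (take i as), drop i as) = (\<Sum>j\<le>i. ?F j (i - j))"
      unfolding i sum_distrib_right by (rule sum.cong) (simp_all add: drop_take mult.assoc min_absorb1)
  qed simp
  also have "\<dots> = (\<Sum>(j,k)\<in>{(j,k). j + k \<le> ?n}. ?F j k)" by (rule sum.triangle_reindex_eq[symmetric])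
  also have "{(j,k). j + k \<le> ?n} = (SIGMA j:{..?n}. {..?n - j})" by auto
  also have "(\<Sum>(j,k)\<in>(SIGMA j:{..?n}. {..?n - j}). ?F j k) = (\<Sum>j\<le>?n. \<Sum>k\<le>?n - j. ?F j k)"
    by (rule sum.Sigma[symmetric]) auto
  also have "\<dots> = pmul f (pmul g h) p"
    unfolding p pmul_def
    unfolding prod.case
  proof (rule sum.cong)
    fix j assume "j \<in> {..?n}"
    show "(\<Sum>k\<le>?n - j. ?F j k) = f (v, take j as) * (\<Sum>k\<le>length (drop j as). g (ptgt v (take j as), take k (drop j as)) *
        h (ptgt (ptgt v (take j as)) (take k (drop j as)), drop k (drop j as)))"
      unfolding sum_distrib_left ptgt_append length_drop
      by (rule sum.cong) (simp_all add: take_add add.commute[of _ j])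
  qed simp
  finally show "pmul (pmul f g) h p = pmul f (pmul g h) p" .
qed

lemma pmul_distrib:
  "pmul (padd f g) h = padd (pmul f h) (pmul g h)" "pmul h (padd f g) = padd (pmul h f) (pmul h g)"
  "pmul (psub f g) h = psub (pmul f h) (pmul g h)" "pmul h (psub f g) = psub (pmul h f) (pmul h g)"
  "pmul (psc a f) g = psc a (pmul f g)" "pmul f (psc a g) = psc a (pmul f g)"
  "pmul (\<lambda>_. 0) f = (\<lambda>_. 0)" "pmul f (\<lambda>_. 0) = (\<lambda>_. 0)"
  by (auto simp: pmul_def padd_def psub_def psc_def fun_eq_iff sum.distrib sum_subtractf sum_distrib_left algebra_simps)

lemma pmul_support:
  assumes "pmul f g (v, as) \<noteq> 0"
  shows "\<exists>i\<le>length as. f (v, take i as) \<noteq> 0 \<and> g (ptgt v (take i as), drop i as) \<noteq> 0"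
proof (rule ccontr)
  assume "\<not> ?thesis"
  then have "pmul f g (v, as) = 0" unfolding pmul_def by (auto intro!: sum.neutral)
  then show False using assms by simp
qed

lemma kQ_pmul: assumes f: "f \<in> kQ" and g: "g \<in> kQ" shows "pmul f g \<in> kQ"
proof -
  have "{p. pmul f g p \<noteq> 0} \<subseteq> (\<lambda>(p, q). (fst p, snd p @ snd q)) ` ({p. f p \<noteq> 0} \<times> {p. g p \<noteq> 0})"
  proof
    fix p assume "p \<in> {p. pmul f g p \<noteq> 0}"
    then have "pmul f g (fst p, snd p) \<noteq> 0" by simp
    from pmul_support[OF this] obtain i where i: "f (fst p, take i (snd p)) \<noteq> 0" 
      "g (ptgt (fst p) (take i (snd p)), drop i (snd p)) \<noteq> 0" by blast
    show "p \<in> (\<lambda>(p, q). (fst p, snd p @ snd q)) ` ({p. f p \<noteq> 0} \<times> {p. g p \<noteq> 0})"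
      by (rule image_eqI[of _ _ "((fst p, take i (snd p)), (ptgt (fst p) (take i (snd p)), drop i (snd p)))"])
         (use i in auto)
  qed
  moreover have "finite ({p. f p \<noteq> 0} \<times> {p. g p \<noteq> 0})" using f g by (auto simp: kQ_def)
  ultimately have "finite {p. pmul f g p \<noteq> 0}" using finite_surj by blast
  moreover have "valid_path p" if nz: "pmul f g p \<noteq> 0" for p
  proof -
    have "pmul f g (fst p, snd p) \<noteq> 0" using nz by simp
    from pmul_support[OF this] obtain i where i: "f (fst p, take i (snd p)) \<noteq> 0" 
      "g (ptgt (fst p) (take i (snd p)), drop i (snd p)) \<noteq> 0" by blast
    then have 1: "valid_path (fst p, take i (snd p))" "valid_path (ptgt (fst p) (take i (snd p)), drop i (snd p))"
      using f g by (auto simp: kQ_def)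
    then obtain w where w: "walk (fst p) (take i (snd p)) = Some w" by (auto simp: valid_path_def)
    then have "walk (fst p) (snd p) = walk w (drop i (snd p))"
      using walk_append[of "fst p" "take i (snd p)" "drop i (snd p)"] by simp
    then show ?thesis using 1 w by (auto simp: valid_path_def ptgt_def)
  qed
  ultimately show ?thesis by (auto simp: kQ_def)
qed

lemma kQ_closed:
  "(\<lambda>_. 0) \<in> kQ" "f \<in> kQ \<Longrightarrow> g \<in> kQ \<Longrightarrow> padd f g \<in> kQ" "f \<in> kQ \<Longrightarrow> psc a f \<in> kQ"
  "valid_path p \<Longrightarrow> pind p \<in> kQ" "f \<in> kQ \<Longrightarrow> g \<in> kQ \<Longrightarrow> psub f g \<in> kQ"
proof -
  show "(\<lambda>_. 0) \<in> kQ" by (simp add: kQ_def)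
  show "padd f g \<in> kQ" if "f \<in> kQ" "g \<in> kQ"
  proof -
    have "{p. padd f g p \<noteq> 0} \<subseteq> {p. f p \<noteq> 0} \<union> {p. g p \<noteq> 0}" by (auto simp: padd_def)
    moreover have "finite ({p. f p \<noteq> 0} \<union> {p. g p \<noteq> 0})" using that by (auto simp: kQ_def)
    ultimately have "finite {p. padd f g p \<noteq> 0}" by (rule finite_subset)
    then show ?thesis using that by (auto simp: kQ_def padd_def)
  qed
  show "psub f g \<in> kQ" if "f \<in> kQ" "g \<in> kQ"
  proof -
    have "{p. psub f g p \<noteq> 0} \<subseteq> {p. f p \<noteq> 0} \<union> {p. g p \<noteq> 0}" by (auto simp: psub_def)
    moreover have "finite ({p. f p \<noteq> 0} \<union> {p. g p \<noteq> 0})" using that by (auto simp: kQ_def)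
    ultimately have "finite {p. psub f g p \<noteq> 0}" by (rule finite_subset)
    then show ?thesis using that by (auto simp: kQ_def psub_def)
  qed
  show "psc a f \<in> kQ" if "f \<in> kQ"
  proof -
    have "{p. psc a f p \<noteq> 0} \<subseteq> {p. f p \<noteq> 0}" by (auto simp: psc_def)
    moreover have "finite {p. f p \<noteq> 0}" using that by (auto simp: kQ_def)
    ultimately have "finite {p. psc a f p \<noteq> 0}" by (rule finite_subset)
    then show ?thesis using that by (auto simp: kQ_def psc_def)
  qed
  show "pind p \<in> kQ" if "valid_path p" using that by (auto simp: kQ_def pind_def)
qed

lemma pone_kQ: "pone \<in> kQ"
proof -
  have "{p. pone p \<noteq> (0::'a)} \<subseteq> {1,2,3} \<times> {[]}" by (auto simp: pone_def split: if_splits)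
  then have "finite {p. pone p \<noteq> (0::'a)}" by (rule finite_subset) auto
  then show ?thesis by (auto simp: kQ_def pone_def valid_path_def split: if_splits)
qed

lemma pone_eq: "pone = padd (padd (pind (1,[])) (pind (2,[]))) (pind (3,[]))"
  by (auto simp: pone_def padd_def pind_def fun_eq_iff)

lemma pmul_pind: "pmul (pind (v, as)) (pind (w, bs) :: 'a::field palg) = (if w = ptgt v as then pind (v, as @ bs) else (\<lambda>_. 0))"
proof
  fix p :: "nat \<times> arrow list"
  obtain u cs where p: "p = (u, cs)" by (cases p)
  have *: "pind (v, as) (u, take i cs) * pind (w, bs) (ptgt u (take i cs), drop i cs)
      = (if i = length as then (if w = ptgt v as \<and> (u, cs) = (v, as @ bs) then 1 else 0) else (0::'a))" 
    if "i \<le> length cs" for i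
  proof (cases "take i cs = as")
    case True
    then have i: "i = length as" using that by auto
    have "cs = as @ drop i cs" using True append_take_drop_id[of i cs] by simp
    then have "drop i cs = bs \<longleftrightarrow> cs = as @ bs" by (metis same_append_eq)
    then show ?thesis using True i by (auto simp: pind_def)
  next
    case False
    then have "\<not> (i = length as \<and> cs = as @ bs)" by auto
    then show ?thesis using False by (auto simp: pind_def)
  qed
  have "pmul (pind (v, as)) (pind (w, bs)) p = (\<Sum>i\<le>length cs. if i = length as then (if w = ptgt v as \<and> (u, cs) = (v, as @ bs) then 1 else 0) else (0::'a))"
    unfolding p pmul_def prod.case by (rule sum.cong) (use * in auto)
  also have "\<dots> = (if w = ptgt v as \<and> (u, cs) = (v, as @ bs) then 1 else 0)"
    by (cases "(u, cs) = (v, as @ bs)") (auto simp: sum.delta)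
  also have "\<dots> = (if w = ptgt v as then pind (v, as @ bs) else (\<lambda>_. 0)) p" by (auto simp: p pind_def)
  finally show "pmul (pind (v, as)) (pind (w, bs) :: 'a palg) p = (if w = ptgt v as then pind (v, as @ bs) else (\<lambda>_. 0)) p" by simp
qed

lemma ptgt_Nil [simp]: "ptgt v [] = v" by (simp add: ptgt_def)

lemma pmul_pone: assumes f: "f \<in> kQ" shows "pmul pone f = f" "pmul f pone = f"
proof -
  show "pmul pone f = f"
  proof
    fix p :: "nat \<times> arrow list"
    obtain v as where p: "p = (v, as)" by (cases p)
    have "pmul pone f p = (\<Sum>i\<le>length as. if i = 0 then (if v \<in> {1,2,3} then f (v, as) else 0) else 0)"
      unfolding p pmul_def prod.case by (rule sum.cong) (auto simp: pone_def)
    also have "\<dots> = (if v \<in> {1,2,3} then f (v, as) else 0)" by (simp add: sum.delta)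
    also have "\<dots> = f p" using f by (auto simp: kQ_def valid_path_def p)
    finally show "pmul pone f p = f p" .
  qed
  show "pmul f pone = f"
  proof
    fix p :: "nat \<times> arrow list"
    obtain v as where p: "p = (v, as)" by (cases p)
    have "pmul f pone p = (\<Sum>i\<le>length as. if i = length as then (if ptgt v as \<in> {1,2,3} then f (v, as) else 0) else 0)"
      unfolding p pmul_def prod.case by (rule sum.cong) (auto simp: pone_def)
    also have "\<dots> = (if ptgt v as \<in> {1,2,3} then f (v, as) else 0)" by (simp add: sum.delta)
    also have "\<dots> = f p" 
    proof (cases "valid_path p")
      case True
      then obtain w where "v \<in> {1,2,3}" "walk v as = Some w" by (auto simp: valid_path_def p)
      then show ?thesis using walk_in[of v as w] by (simp add: ptgt_def p)
    qed (use f in \<open>auto simp: kQ_def p\<close>)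
    finally show "pmul f pone p = f p" .
  qed
qed

lemma I_mult: assumes "a \<in> Iideal c"
  shows "w \<in> kQ \<Longrightarrow> pmul w a \<in> Iideal c" "w \<in> kQ \<Longrightarrow> pmul a w \<in> Iideal c" "psc s a \<in> Iideal c"
proof -
  show "w \<in> kQ \<Longrightarrow> pmul w a \<in> Iideal c" using assms
  proof induction
    case (gen x y r)
    then have "pmul (pmul (pmul w x) r) y \<in> Iideal c" by (intro Iideal.gen kQ_pmul)
    then show ?case by (simp add: pmul_assoc)
  qed (auto simp: pmul_distrib intro: Iideal.intros)
  show "w \<in> kQ \<Longrightarrow> pmul a w \<in> Iideal c" using assms
  proof induction
    case (gen x y r)
    then have "pmul (pmul x r) (pmul y w) \<in> Iideal c" by (intro Iideal.gen kQ_pmul)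
    then show ?case by (simp add: pmul_assoc)
  qed (auto simp: pmul_distrib intro: Iideal.intros)
  show "psc s a \<in> Iideal c" using assms
  proof induction
    case zero
    have "psc s (\<lambda>p. 0) = (\<lambda>p. 0)" by (simp add: psc_def)
    then show ?case by (simp add: Iideal.zero)
  next
    case (gen x y r)
    then have "pmul (pmul (psc s x) r) y \<in> Iideal c" by (intro Iideal.gen kQ_closed)
    then show ?case by (simp add: pmul_distrib)
  next
    case (add a b)
    have "psc s (padd a b) = padd (psc s a) (psc s b)" by (simp add: psc_def padd_def algebra_simps)
    then show ?case using add by (simp add: Iideal.add)
  qed
qed

text \<open>The relations involve only paths of positive length. This is what later keeps the lifted
  vertices nonzero.\<close>

lemma I_Nil: "a \<in> Iideal c \<Longrightarrow> a (v, []) = 0"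
proof (induction rule: Iideal.induct)
  case (gen x y r)
  then have "r (v, []) = 0" by (auto simp: rels_def psub_def pind_def)
  then show ?case by (simp add: pmul_def)
qed (auto simp: padd_def)

definition peq :: "nat \<Rightarrow> 'k::field palg \<Rightarrow> 'k palg \<Rightarrow> bool" where
  "peq c f g \<longleftrightarrow> psub f g \<in> Iideal c"

lemma peq_refl [simp]: "peq c f f" by (simp add: peq_def psub_def Iideal.zero)

lemma peq_sym: "peq c f g \<Longrightarrow> peq c g f"
proof -
  have "psub g f = psc (-1) (psub f g)" by (auto simp: psub_def psc_def fun_eq_iff)
  then show "peq c f g \<Longrightarrow> peq c g f" unfolding peq_def by (simp add: I_mult)
qed

lemma peq_trans [trans]: "peq c f g \<Longrightarrow> peq c g h \<Longrightarrow> peq c f h"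
proof -
  have "psub f h = padd (psub f g) (psub g h)" by (auto simp: psub_def padd_def fun_eq_iff)
  then show "peq c f g \<Longrightarrow> peq c g h \<Longrightarrow> peq c f h" unfolding peq_def by (simp add: Iideal.add)
qed

lemma peq_add: "peq c f g \<Longrightarrow> peq c f' g' \<Longrightarrow> peq c (padd f f') (padd g g')"
proof -
  have "psub (padd f f') (padd g g') = padd (psub f g) (psub f' g')" by (auto simp: psub_def padd_def fun_eq_iff)
  then show "peq c f g \<Longrightarrow> peq c f' g' \<Longrightarrow> peq c (padd f f') (padd g g')" unfolding peq_def by (simp add: Iideal.add)
qed

lemma peq_sc: "peq c f g \<Longrightarrow> peq c (psc a f) (psc a g)"
proof -
  have "psub (psc a f) (psc a g) = psc a (psub f g)" by (auto simp: psub_def psc_def fun_eq_iff algebra_simps)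
  then show "peq c f g \<Longrightarrow> peq c (psc a f) (psc a g)" unfolding peq_def by (simp add: I_mult)
qed

lemma peq_mul: assumes "f' \<in> kQ" "g \<in> kQ" "peq c f g" "peq c f' g'" shows "peq c (pmul f f') (pmul g g')"
proof -
  have "psub (pmul f f') (pmul g g') = padd (pmul (psub f g) f') (pmul g (psub f' g'))"
    unfolding pmul_distrib by (auto simp: psub_def padd_def fun_eq_iff)
  then show ?thesis using assms unfolding peq_def by (simp add: I_mult Iideal.add)
qed

lemma rels_I: assumes "r \<in> rels c" "r \<in> kQ" shows "r \<in> Iideal c"
  using Iideal.gen[OF pone_kQ pone_kQ assms(1)] assms(2) by (simp add: pmul_pone)

section \<open>Lifting the quiver presentation to the order\<close>

fun path_lift :: "(nat \<Rightarrow> 'a::field alg) \<Rightarrow> (arrow \<Rightarrow> 'a alg) \<Rightarrow> nat \<Rightarrow> arrow list \<Rightarrow> 'a alg" where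
  "path_lift e ar v [] = e v"
| "path_lift e ar v (a # as) = ar a * path_lift e ar (atgt a) as"

context full_order begin

lemma cong_zero_iff: "cong 1 x 0 \<longleftrightarrow> (\<exists>z\<in>L. x = sc pu z)" by (simp add: cong_def)

lemma cong_diff_iff: "cong 1 x y \<longleftrightarrow> cong 1 (x - y) 0" by (simp add: cong_def)

end

locale reduced_order = full_order Ov pu N L for Ov :: "'a::field set" and pu N L +
  fixes red :: "'a \<Rightarrow> 'k::field" and f :: "'a alg \<Rightarrow> 'k palg" and c :: nat
  assumes rm: "residue_map Ov pu red"
    and fK: "x \<in> L \<Longrightarrow> f x \<in> kQ"
    and fadd: "x \<in> L \<Longrightarrow> y \<in> L \<Longrightarrow> peq c (f (x + y)) (padd (f x) (f y))"
    and fmul: "x \<in> L \<Longrightarrow> y \<in> L \<Longrightarrow> peq c (f (x * y)) (pmul (f x) (f y))"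
    and fone: "peq c (f (idn N)) pone"
    and fsc: "a \<in> Ov \<Longrightarrow> x \<in> L \<Longrightarrow> peq c (f (sc a x)) (psc (red a) (f x))"
    and fsurj: "z \<in> kQ \<Longrightarrow> \<exists>x\<in>L. peq c (f x) z"
    and fker: "x \<in> L \<Longrightarrow> peq c (f x) (\<lambda>_. 0) \<longleftrightarrow> cong 1 x 0"
begin

lemma red_add: "x \<in> Ov \<Longrightarrow> y \<in> Ov \<Longrightarrow> red (x + y) = red x + red y"
  and red_1: "red 1 = 1" and red_surj: "\<exists>x\<in>Ov. red x = z"
  using rm by (auto simp: residue_map_def)

lemma red_m1: "red (- 1) = - 1"
proof -
  have "red 0 = 0" using red_add[OF O_closed(1) O_closed(1)] by (metis add.right_neutral add_left_cancel)
  moreover have "red (1 + - 1) = red 1 + red (- 1)" by (rule red_add) auto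
  ultimately have "1 + red (-1) = 0" by (simp add: red_1)
  then show ?thesis by (simp add: eq_neg_iff_add_eq_0 add.commute)
qed

lemma f_cong: assumes "x \<in> L" "y \<in> L" shows "peq c (f x) (f y) \<longleftrightarrow> cong 1 x y"
proof -
  have "peq c (f (x + sc (-1) y)) (padd (f x) (f (sc (-1) y)))" using assms by (intro fadd) auto
  also have "peq c (padd (f x) (f (sc (-1) y))) (padd (f x) (psc (-1) (f y)))"
    using fsc[of "-1" y] assms by (intro peq_add) (auto simp: red_m1)
  also have "padd (f x) (psc (-1) (f y)) = psub (f x) (f y)"
    by (simp add: padd_def psc_def psub_def)
  finally have 1: "peq c (f (x - y)) (psub (f x) (f y))" by (simp add: sc_distrib)
  have 2: "peq c (f x) (f y) \<longleftrightarrow> peq c (psub (f x) (f y)) (\<lambda>_. 0)" by (simp add: peq_def psub_def)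
  have 3: "peq c (f (x - y)) (\<lambda>_. 0) \<longleftrightarrow> cong 1 x y" using fker[of "x - y"] assms cong_diff_iff[of x y] by auto
  show ?thesis using 1 2 3 peq_trans peq_sym by metis
qed

text \<open>A relation, since neither side determines the other: \<open>z\<close> fixes
  \<open>x\<close> only modulo \<open>pu\<close>, and \<open>x\<close> fixes \<open>z\<close> only
  modulo the ideal.\<close>

definition lifts :: "'a alg \<Rightarrow> 'k palg \<Rightarrow> bool" where
  "lifts x z \<longleftrightarrow> x \<in> L \<and> peq c (f x) z"

lemma lf_ex: "z \<in> kQ \<Longrightarrow> \<exists>x. lifts x z" using fsurj by (auto simp: lifts_def)

lemma lf_cong: "lifts x z \<Longrightarrow> lifts y z \<Longrightarrow> cong 1 x y"
  unfolding lifts_def using f_cong peq_trans peq_sym by metis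

lemma lf_peq: "lifts x z \<Longrightarrow> peq c z z' \<Longrightarrow> lifts x z'"
  unfolding lifts_def using peq_trans by metis

lemma cong_lf: "lifts x z \<Longrightarrow> cong 1 y x \<Longrightarrow> y \<in> L \<Longrightarrow> lifts y z"
  unfolding lifts_def using f_cong peq_trans by metis

lemma lf_add: "lifts x z \<Longrightarrow> lifts y w \<Longrightarrow> lifts (x + y) (padd z w)"
  unfolding lifts_def by (meson fadd peq_add peq_trans Lcl)

lemma lf_mul: "lifts x z \<Longrightarrow> lifts y w \<Longrightarrow> z \<in> kQ \<Longrightarrow> lifts (x * y) (pmul z w)"
  unfolding lifts_def by (meson fmul fK peq_mul peq_trans Lmult)

lemma lf_sc: "a \<in> Ov \<Longrightarrow> lifts x z \<Longrightarrow> lifts (sc a x) (psc (red a) z)"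
  unfolding lifts_def by (meson fsc peq_sc peq_trans Lcl)

lemma lf_0: "lifts 0 (\<lambda>_. 0)" unfolding lifts_def using fker[of 0] by auto
lemma lf_1: "lifts (idn N) pone" unfolding lifts_def using fone Lone by auto

lemma lf_pind_mul:
  assumes "lifts x (pind (v, as))" "lifts y (pind (w, bs))" "valid_path (v, as)"
  shows "w = ptgt v as \<Longrightarrow> lifts (x * y) (pind (v, as @ bs))" "w \<noteq> ptgt v as \<Longrightarrow> cong 1 (x * y) 0"
proof -
  have "lifts (x * y) (pmul (pind (v, as)) (pind (w, bs)))" using assms by (intro lf_mul kQ_closed)
  then show "w = ptgt v as \<Longrightarrow> lifts (x * y) (pind (v, as @ bs))" "w \<noteq> ptgt v as \<Longrightarrow> cong 1 (x * y) 0"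
    using lf_cong[OF _ lf_0] by (auto simp: pmul_pind)
qed

text \<open>The idempotents are exact, complete and orthogonal, while the quiver relations hold only
  modulo \<open>pu\<close>. The last clause is generation of \<open>L\<close> by the lifts and
  \<open>pu L\<close>, phrased as an induction principle over multiplicatively closed
  submodules.\<close>

lemma presentation:
  "\<exists>e ar. (\<forall>v\<in>{1,2,3}. e v \<in> L \<and> e v * e v = e v \<and> e v \<noteq> 0 \<and> (\<forall>w\<in>{1,2,3}. v \<noteq> w \<longrightarrow> e v * e w = 0)) \<and>
     e 1 + e 2 + e 3 = idn N \<and>
     (\<forall>a. ar a \<in> L \<and> e (asrc a) * ar a = ar a \<and> ar a * e (atgt a) = ar a) \<and>
     (\<forall>p q. psub (pind p) (pind q) \<in> (rels c :: 'k palg set) \<longrightarrow> valid_path p \<longrightarrow> valid_path q \<longrightarrow>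
        cong 1 (path_lift e ar (fst p) (snd p)) (path_lift e ar (fst q) (snd q))) \<and>
     (\<forall>p. pind p \<in> (rels c :: 'k palg set) \<longrightarrow> valid_path p \<longrightarrow> cong 1 (path_lift e ar (fst p) (snd p)) 0) \<and>
     (\<forall>S. osub S \<longrightarrow> (\<forall>x\<in>S. \<forall>y\<in>S. x * y \<in> S) \<longrightarrow> (\<forall>v\<in>{1,2,3}. e v \<in> S) \<longrightarrow> (\<forall>a. ar a \<in> S) \<longrightarrow>
        (\<forall>x\<in>L. sc pu x \<in> S) \<longrightarrow> L \<subseteq> S)"
proof -
  have vp: "valid_path (1, [])" "valid_path (2, [])" "valid_path (3, [])" by (auto simp: valid_path_def)
  obtain E1 E2 where E: "lifts E1 (pind (1, []))" "lifts E2 (pind (2, []))"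
    using lf_ex kQ_closed(4)[OF vp(1)] kQ_closed(4)[OF vp(2)] by meson
  then have EL: "E1 \<in> L" "E2 \<in> L" by (auto simp: lifts_def)
  have "cong 1 (E1 * E1) E1" using lf_pind_mul(1)[OF E(1) E(1) vp(1)] E by (intro lf_cong) auto
  then obtain e1 where e1: "e1 \<in> L" "e1 * e1 = e1" "cong 1 e1 E1" using idempotent_lift[OF EL(1)] by blast
  have le1: "lifts e1 (pind (1, []))" using E(1) e1(3,1) by (rule cong_lf)
  define p where "p = idn N - e1"
  have p: "p \<in> L" "p * p = p" "e1 * p = 0" "p * e1 = 0"
    unfolding p_def using e1 Lone by (auto simp: algebra_simps)
  \<comment> \<open>Compressing \<open>E2\<close> to the corner complementary to \<open>e1\<close>
    changes it only modulo \<open>pu\<close>, because both mixed products vanish there. The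
    idempotent lifted from \<open>F\<close> inherits \<open>p\<close> as a two-sided identity and is
    therefore orthogonal to \<open>e1\<close>.\<close>
  define F where "F = p * E2 * p"
  have FL: "F \<in> L" unfolding F_def using p EL by auto
  have F: "cong 1 F E2"
  proof -
    have F_eq: "F = E2 - e1 * E2 - E2 * e1 + e1 * E2 * e1"
      unfolding F_def p_def using EL e1 Lone by (simp add: algebra_simps)
    have 1: "cong 1 (e1 * E2) 0" using lf_pind_mul(2)[OF le1 E(2) vp(1)] by simp
    have 2: "cong 1 (E2 * e1) 0" using lf_pind_mul(2)[OF E(2) le1 vp(2)] by simp
    have 3: "cong 1 (e1 * E2 * e1) 0" using cong_right[OF e1(1) 1] by simp
    have "cong 1 F (E2 - 0 - 0 + 0)" unfolding F_eq by (intro cong_add cong_diff cong_refl 1 2 3)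
    then show ?thesis by simp
  qed
  have lF: "lifts F (pind (2, []))" using E(2) F FL by (rule cong_lf)
  have pF: "p * F = F" "F * p = F" unfolding F_def using p(2) by (simp_all add: mult.assoc) (simp flip: mult.assoc add: p(2))
  have "cong 1 (F * F) F" using lf_pind_mul(1)[OF lF lF vp(2)] lF by (intro lf_cong) auto
  then obtain e2 where e2: "e2 \<in> L" "e2 * e2 = e2" "cong 1 e2 F" "p * e2 = e2" "e2 * p = e2"
    using idempotent_lift[OF FL] pF p(1) by blast
  have le2: "lifts e2 (pind (2, []))" using lF e2(3,1) by (rule cong_lf)
  have e12: "e1 * e2 = 0" "e2 * e1 = 0" using e2(4,5) p(3,4) by (metis mult.assoc mult_zero_left mult_zero_right)+
  \<comment> \<open>Taking the remainder as third idempotent makes the sum exactly the unit; it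
    lifts vertex 3 because the trivial paths sum to \<open>pone\<close>.\<close>
  define e3 where "e3 = idn N - e1 - e2"
  have e3: "e3 \<in> L" "e3 * e3 = e3" "e1 * e3 = 0" "e3 * e1 = 0" "e2 * e3 = 0" "e3 * e2 = 0"
    unfolding e3_def using e1 e2 e12 Lone by (auto simp: algebra_simps)
  have le3: "lifts e3 (pind (3, []))"
  proof -
    have "lifts (idn N + sc (-1) e1 + sc (-1) e2) (padd (padd pone (psc (red (-1)) (pind (1,[])))) (psc (red (-1)) (pind (2,[]))))"
      by (intro lf_add lf_sc lf_1 le1 le2) auto
    moreover have "padd (padd pone (psc (red (-1)) (pind (1,[])))) (psc (red (-1)) (pind (2,[]))) = (pind (3,[]) :: 'k palg)"
      by (simp add: pone_eq red_m1 padd_def psc_def)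
    moreover have "idn N + sc (-1) e1 + sc (-1) e2 = e3" by (simp add: e3_def sc_distrib)
    ultimately show ?thesis by simp
  qed
  define e where "e = (\<lambda>v::nat. if v = 1 then e1 else if v = 2 then e2 else e3)"
  have le: "lifts (e v) (pind (v, []))" if "v \<in> {1,2,3}" for v
    using that le1 le2 le3 by (auto simp: e_def)
  have vpa: "valid_path (asrc a, [a])" for a by (cases a) (auto simp: valid_path_def)
  have sa: "asrc a \<in> {1,2,3}" "atgt a \<in> {1,2,3}" for a by (cases a; simp)+
  have "\<forall>a. \<exists>x. lifts x (pind (asrc a, [a]))" using lf_ex kQ_closed(4)[OF vpa] by blast
  then obtain A where A: "\<And>a. lifts (A a) (pind (asrc a, [a]))" by metis
  define ar where "ar a = e (asrc a) * A a * e (atgt a)" for a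
  have e_idem: "e v * e v = e v" for v using e1 e2 e3 by (simp add: e_def)
  have vpv: "valid_path (v, [])" if "v \<in> {1,2,3}" for v using that by (auto simp: valid_path_def)
  have lar: "lifts (ar a) (pind (asrc a, [a]))" for a
  proof -
    have "lifts (e (asrc a) * A a) (pind (asrc a, [] @ [a]))"
      by (rule lf_pind_mul(1)) (use le sa A vpv in auto)
    then have "lifts (e (asrc a) * A a * e (atgt a)) (pind (asrc a, ([] @ [a]) @ []))"
      by (rule lf_pind_mul(1)) (use le sa vpa in \<open>auto simp: ptgt_def\<close>)
    then show ?thesis by (simp add: ar_def)
  qed
  have eL: "e v \<in> L" for v using e1 e2 e3 by (simp add: e_def)
  have lpl: "valid_path (v, as) \<Longrightarrow> lifts (path_lift e ar v as) (pind (v, as))" for v as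
  proof (induction as arbitrary: v)
    case Nil
    then show ?case using le by (auto simp: valid_path_def)
  next
    case (Cons a as)
    then have v: "v = asrc a" "valid_path (atgt a, as)" using sa by (auto simp: valid_path_def split: if_splits)
    have "lifts (ar a * path_lift e ar (atgt a) as) (pind (asrc a, [a] @ as))"
      by (rule lf_pind_mul(1)) (use lar Cons v vpa in \<open>auto simp: ptgt_def\<close>)
    then show ?case using v by simp
  qed
  have nz: "e v \<noteq> 0" if v: "v \<in> {1,2,3}" for v
  proof
    assume "e v = 0"
    then have "lifts 0 (pind (v, []))" using le[OF v] by simp
    then have "peq c (pind (v, [])) (f 0)" "peq c (f 0) (\<lambda>_. 0 :: 'k)" using lf_0 peq_sym by (auto simp: lifts_def)
    then have "peq c (pind (v, [])) (\<lambda>_. 0 :: 'k)" by (rule peq_trans)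
    then have "psub (pind (v, [])) (\<lambda>_. 0) (v, []) = (0 :: 'k)" unfolding peq_def by (rule I_Nil)
    then show False by (simp add: psub_def pind_def)
  qed
  have rel1: "cong 1 (path_lift e ar (fst p) (snd p)) (path_lift e ar (fst q) (snd q))"
    if "psub (pind p) (pind q) \<in> (rels c :: 'k palg set)" "valid_path p" "valid_path q" for p q
  proof -
    have "peq c (pind p) (pind q :: 'k palg)" unfolding peq_def using that by (intro rels_I kQ_closed)
    moreover have "lifts (path_lift e ar (fst p) (snd p)) (pind p)" "lifts (path_lift e ar (fst q) (snd q)) (pind q)"
      using lpl[of "fst p" "snd p"] lpl[of "fst q" "snd q"] that by simp_all
    ultimately show ?thesis using lf_cong lf_peq by blast
  qed
  have rel2: "cong 1 (path_lift e ar (fst p) (snd p)) 0"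
    if "pind p \<in> (rels c :: 'k palg set)" "valid_path p" for p
  proof -
    have "pind p \<in> (Iideal c :: 'k palg set)" using that by (intro rels_I kQ_closed)
    then have "peq c (pind p) (\<lambda>_. 0 :: 'k)" unfolding peq_def psub_def by simp
    moreover have "lifts (path_lift e ar (fst p) (snd p)) (pind p)"
      using lpl[of "fst p" "snd p"] that by simp
    ultimately show ?thesis using lf_cong lf_peq lf_0 by blast
  qed
  \<comment> \<open>Elements of \<open>kQ\<close> are finite combinations of paths, so
    \<open>S\<close> contains a lift of each of them. Any other lift differs by an element of
    \<open>pu L\<close>, which \<open>S\<close> contains as well.\<close>
  have gen: "L \<subseteq> S" if S: "osub S" "\<forall>x\<in>S. \<forall>y\<in>S. x * y \<in> S" "\<forall>v\<in>{1,2,3}. e v \<in> S" "\<forall>a. ar a \<in> S" "\<forall>x\<in>L. sc pu x \<in> S" for S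
  proof -
    have plS: "v \<in> {1,2,3} \<Longrightarrow> path_lift e ar v as \<in> S" for v as
    proof (induction as arbitrary: v)
      case (Cons a as)
      then show ?case using S(2,4) sa by auto
    qed (use S in auto)
    have span: "\<exists>x\<in>S. lifts x z" if z: "z \<in> kQ" for z :: "'k palg"
    proof -
      have zfin: "finite {p. z p \<noteq> 0}" "\<forall>p\<in>{p. z p \<noteq> 0}. valid_path p" using z by (auto simp: kQ_def)
      have fin: "finite X \<Longrightarrow> \<forall>p\<in>X. valid_path p \<Longrightarrow> \<exists>x\<in>S. lifts x (\<lambda>p. if p \<in> X then z p else 0)" for X
      proof (induction X rule: finite_induct)
        case empty
        then show ?case using osubD(1)[OF S(1)] lf_0 by auto
      next
        case (insert p X)
        then obtain x where x: "x \<in> S" "lifts x (\<lambda>p. if p \<in> X then z p else 0)" by auto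
        obtain a where a: "a \<in> Ov" "red a = z p" using red_surj by blast
        have "lifts (path_lift e ar (fst p) (snd p)) (pind p)" using lpl[of "fst p" "snd p"] insert.prems by simp
        then have "lifts (x + sc a (path_lift e ar (fst p) (snd p))) (padd (\<lambda>p. if p \<in> X then z p else 0) (psc (red a) (pind p)))"
          using x a by (intro lf_add lf_sc)
        moreover have "padd (\<lambda>p. if p \<in> X then z p else 0) (psc (red a) (pind p)) = (\<lambda>q. if q \<in> insert p X then z q else 0)"
          using insert.hyps a by (auto simp: padd_def psc_def pind_def fun_eq_iff)
        moreover have "x + sc a (path_lift e ar (fst p) (snd p)) \<in> S"
          using insert.prems plS x a by (intro osubD(2,3)[OF S(1)]) (auto simp: valid_path_def)
        ultimately show ?case by auto
      qed
      have "\<exists>x\<in>S. lifts x (\<lambda>p. if p \<in> {p. z p \<noteq> 0} then z p else 0)" by (rule fin[OF zfin])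
      moreover have "(\<lambda>p. if p \<in> {p. z p \<noteq> 0} then z p else 0) = z" by auto
      ultimately show ?thesis by simp
    qed
    show "L \<subseteq> S"
    proof
      fix x assume x: "x \<in> L"
      then have lx: "lifts x (f x)" by (simp add: lifts_def)
      obtain y where y: "y \<in> S" "lifts y (f x)" using span[OF fK[OF x]] by blast
      obtain z where "z \<in> L" "x - y = sc pu z" using lf_cong[OF lx y(2)] by (auto simp: cong_def)
      then have "x - y \<in> S" using S by simp
      then have "(x - y) + y \<in> S" using y osubD(2)[OF S(1)] by blast
      then show "x \<in> S" by simp
    qed
  qed
  show ?thesis
  proof (intro exI[of _ e] exI[of _ ar] conjI ballI allI impI)
    show "e v * e w = 0" if "v \<in> {1,2,3}" "w \<in> {1,2,3}" "v \<noteq> w" for v w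
      using that e12 e3 by (auto simp: e_def)
    show "e 1 + e 2 + e 3 = idn N" by (simp add: e_def e3_def)
    show "ar a \<in> L" for a using lar by (simp add: lifts_def)
    show "e (asrc a) * ar a = ar a" "ar a * e (atgt a) = ar a" for a
      unfolding ar_def by (simp_all add: mult.assoc e_idem) (simp flip: mult.assoc add: e_idem)
  qed (use eL e_idem nz rel1 rel2 gen in blast)+
qed

end

section \<open>Normal forms of paths\<close>

text \<open>The alternating word x (y x)^i with 2 i + 1 letters; \<open>alt h d (c - 1)\<close> thus
  lifts the right-hand side of the relation for lambda beta.\<close>

fun alt :: "'a::field alg \<Rightarrow> 'a alg \<Rightarrow> nat \<Rightarrow> 'a alg" where
  "alt x y 0 = x"
| "alt x y (Suc i) = x * (y * alt x y i)"

lemma alt_mult: "alt x y i * y = x * alt y x i"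
  by (induction i) (simp_all add: mult.assoc)

context dvr begin

definition ospan :: "'a alg set \<Rightarrow> 'a alg set" where
  "ospan S = \<Inter>{X. osub X \<and> S \<subseteq> X}"

lemma ospan_osub: "osub (ospan S)"
  unfolding ospan_def osub_def by blast

lemma ospan_base: "S \<subseteq> ospan S" unfolding ospan_def by blast
lemma ospan_least: "osub X \<Longrightarrow> S \<subseteq> X \<Longrightarrow> ospan S \<subseteq> X" unfolding ospan_def by blast
lemma ospan_mono: "S \<subseteq> S' \<Longrightarrow> ospan S \<subseteq> ospan S'" unfolding ospan_def by blast

lemma ospan_map:
  assumes X: "osub X" and "\<And>x y. f (x + y) = f x + f y" "\<And>a x. f (sc a x) = sc a (f x)"
    and "\<And>x. x \<in> S \<Longrightarrow> f x \<in> X" and x: "x \<in> ospan S"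
  shows "f x \<in> X"
proof -
  have "f 0 = 0" using assms(3)[of 0 0] by simp
  then have "osub {x. f x \<in> X}" using assms(2,3) osubD[OF X] by (auto simp: osub_def)
  then have "ospan S \<subseteq> {x. f x \<in> X}" using assms(4) by (intro ospan_least) auto
  then show ?thesis using x by blast
qed

lemma ospan_pair: 
  assumes "x \<in> ospan {u, v}" shows "\<exists>a\<in>Ov. \<exists>b\<in>Ov. x = sc a u + sc b v"
proof -
  let ?X = "{sc a u + sc b v | a b. a \<in> Ov \<and> b \<in> Ov}"
  have I: "a \<in> Ov \<Longrightarrow> b \<in> Ov \<Longrightarrow> y = sc a u + sc b v \<Longrightarrow> y \<in> ?X" for y a b by blast
  have "osub ?X" unfolding osub_def
  proof (intro conjI ballI)
    show "0 \<in> ?X" by (rule I[of 0 0]) auto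
    show "y + z \<in> ?X" if yz: "y \<in> ?X" "z \<in> ?X" for y z
    proof -
      obtain a b a' b' where "a \<in> Ov" "b \<in> Ov" "a' \<in> Ov" "b' \<in> Ov" "y = sc a u + sc b v" "z = sc a' u + sc b' v"
        using yz by blast
      then show ?thesis by (intro I[of "a + a'" "b + b'"]) (auto simp: sc_distrib)
    qed
    show "sc s y \<in> ?X" if y: "s \<in> Ov" "y \<in> ?X" for y s
    proof -
      obtain a b where "a \<in> Ov" "b \<in> Ov" "y = sc a u + sc b v" using y by blast
      then show ?thesis using y by (intro I[of "s * a" "s * b"]) (auto simp: sc_distrib)
    qed
  qed
  moreover have "{u, v} \<subseteq> ?X" using I[of 1 0 u] I[of 0 1 v] by auto
  ultimately show ?thesis using assms ospan_least by blast
qed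

end

context full_order begin

text \<open>Permits generators to be exchanged for congruent elements: a set that spans modulo
  \<open>pu\<close> can be replaced by any \<open>B'\<close> whose span meets the same congruence
  classes.\<close>

lemma nakayama_ospan:
  assumes L: "L \<subseteq> ospan (B \<union> sc pu ` L)" and B': "B' \<subseteq> L"
    and *: "\<And>b. b \<in> B \<Longrightarrow> \<exists>b'\<in>ospan B'. cong 1 b b'"
  shows "L \<subseteq> ospan B'"
proof -
  obtain m g where g: "L = gspan m g" using Lfg by blast
  let ?X = "{y + sc pu z | y z. y \<in> ospan B' \<and> z \<in> L}"
  note oo = ospan_osub[of B']
  have I: "y \<in> ospan B' \<Longrightarrow> z \<in> L \<Longrightarrow> x = y + sc pu z \<Longrightarrow> x \<in> ?X" for x y z by blast
  have "osub ?X" unfolding osub_def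
  proof (intro conjI ballI)
    show "0 \<in> ?X" by (rule I[of 0 0]) (auto intro: osubD(1)[OF oo])
    show "y + z \<in> ?X" if yz: "y \<in> ?X" "z \<in> ?X" for y z
    proof -
      obtain a b a' b' where *: "a \<in> ospan B'" "b \<in> L" "a' \<in> ospan B'" "b' \<in> L" "y = a + sc pu b" "z = a' + sc pu b'"
        using yz by blast
      show ?thesis by (rule I[of "a + a'" "b + b'"]) (use * osubD(2)[OF oo] in \<open>auto simp: sc_distrib\<close>)
    qed
    show "sc s y \<in> ?X" if y: "s \<in> Ov" "y \<in> ?X" for y s
    proof -
      obtain a b where *: "a \<in> ospan B'" "b \<in> L" "y = a + sc pu b" using y by blast
      show ?thesis by (rule I[of "sc s a" "sc s b"]) (use * y osubD(3)[OF oo] in \<open>auto simp: sc_distrib mult.commute\<close>)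
    qed
  qed
  moreover have "B \<union> sc pu ` L \<subseteq> ?X"
  proof (intro Un_least subsetI)
    fix b assume "b \<in> B"
    then obtain b' z where "b' \<in> ospan B'" "z \<in> L" "b - b' = sc pu z" using * by (fastforce simp: cong_def)
    then show "b \<in> ?X" by (intro I[of b' z]) (auto simp: algebra_simps)
  next
    fix x assume "x \<in> sc pu ` L"
    then show "x \<in> ?X" using I[of 0] osubD(1)[OF oo] by auto
  qed
  ultimately have "L \<subseteq> ?X" using L ospan_least by blast
  then show ?thesis by (intro nakayama[OF g oo]) blast
qed

end

text \<open>The letters \<open>b\<close>, \<open>g\<close>, \<open>d\<close>, \<open>h\<close>,
  \<open>k\<close>, \<open>l\<close> lift beta, gamma, delta, eta, kappa, lambda. Vertices and
  arrows are parameters, so that a symmetry of the relations becomes another instance of the locale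
  over the same \<open>L\<close>.\<close>

locale quiver_presentation = full_order Ov pu N L for Ov :: "'a::field set" and pu N L +
  fixes c :: nat and e1 e2 e3 b g d h k l :: "'a alg"
  assumes c2: "c \<ge> 2"
    and inL [simp]: "e1 \<in> L" "e2 \<in> L" "e3 \<in> L" "b \<in> L" "g \<in> L" "d \<in> L" "h \<in> L" "k \<in> L" "l \<in> L"
    and e_nz: "e1 \<noteq> 0" "e2 \<noteq> 0" "e3 \<noteq> 0"
    and e_id [simp]: "e1 * e1 = e1" "e2 * e2 = e2" "e3 * e3 = e3"
    and e_orth [simp]: "e1 * e2 = 0" "e1 * e3 = 0" "e2 * e1 = 0" "e2 * e3 = 0" "e3 * e1 = 0" "e3 * e2 = 0"
    and e_sum: "e1 + e2 + e3 = idn N"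
    and blk [simp]: "e1 * b = b" "b * e2 = b" "e2 * g = g" "g * e1 = g" "e2 * d = d" "d * e3 = d"
      "e3 * h = h" "h * e2 = h" "e1 * k = k" "k * e3 = k" "e3 * l = l" "l * e1 = l"
    and r1: "cong 1 (b * d) (k * (l * k))" and r2: "cong 1 (h * g) (l * (k * l))"
    and r3: "cong 1 (d * l) (g * (b * g))" and r4: "cong 1 (k * h) (b * (g * b))"
    and r5: "cong 1 (l * b) (alt h d (c - 1))" and r6: "cong 1 (g * k) (alt d h (c - 1))"
    and r7: "cong 1 (g * (b * d)) 0" and r8: "cong 1 (d * (h * g)) 0" and r9: "cong 1 (l * (k * h)) 0"
    and gen: "osub S \<Longrightarrow> (\<And>x y. x \<in> S \<Longrightarrow> y \<in> S \<Longrightarrow> x * y \<in> S) \<Longrightarrow> {e1,e2,e3,b,g,d,h,k,l} \<subseteq> S \<Longrightarrow>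
        (\<And>x. x \<in> L \<Longrightarrow> sc pu x \<in> S) \<Longrightarrow> L \<subseteq> S"
begin

abbreviation eqv (infix "\<approx>" 50) where "x \<approx> y \<equiv> cong 1 x y"

text \<open>All words are kept associated to the right; this applies a relation to the first two
  letters of such a word.\<close>

lemma tail: "x * y \<approx> u \<Longrightarrow> z \<in> L \<Longrightarrow> x * (y * z) \<approx> u * z"
  using cong_right[of z 1 "x * y" u] by (simp add: mult.assoc)

lemma alt_L [simp]: "alt d h i \<in> L" "alt h d i \<in> L"
  by (induction i) auto

text \<open>Otherwise the simplifier turns \<open>cong 1\<close> into \<open>cong (Suc 0)\<close> and the relations no longer match.\<close>

declare One_nat_def [simp del]

lemma cm: "c - 1 = Suc (c - 2)" using c2 by simp

lemma zero_left: "x \<approx> 0 \<Longrightarrow> p \<in> L \<Longrightarrow> p * x \<approx> 0"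
  using cong_left[of p 1 x 0] by simp

lemma zero_right: "x \<approx> 0 \<Longrightarrow> p \<in> L \<Longrightarrow> x * p \<approx> 0"
  using cong_right[of p 1 x 0] by simp

text \<open>From here to \<open>gkl\<close> the three monomial relations are propagated to the other
  vanishing paths. Each chain trades a path of two arrows for its longer partner until a path
  already known to vanish appears as a factor. Where a power of \<open>h * d\<close> or
  \<open>d * h\<close> arises, \<open>c >= 2\<close> ensures that it begins with both
  letters.\<close>

lemma bdh: "b * (d * h) \<approx> 0"
proof -
  have "b * (d * h) \<approx> k * (l * (k * h))" using tail[OF r1, of h] by (simp add: mult.assoc)
  also have "k * (l * (k * h)) \<approx> 0" by (intro zero_left r9) simp
  finally show ?thesis .
qed

lemma bgk: "b * (g * k) \<approx> 0"
proof -
  have "b * (g * k) \<approx> b * (d * (h * alt d h (c - 2)))" using cong_left[OF _ r6, of b] by (simp add: cm)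
  also have "b * (d * (h * alt d h (c - 2))) \<approx> 0"
    using zero_right[OF bdh, of "alt d h (c - 2)"] by (simp add: mult.assoc)
  finally show ?thesis .
qed

lemma khd: "k * (h * d) \<approx> 0"
proof -
  have "k * (h * d) \<approx> b * (g * (b * d))" using tail[OF r4, of d] by (simp add: mult.assoc)
  also have "b * (g * (b * d)) \<approx> 0" by (intro zero_left r7) simp
  finally show ?thesis .
qed

lemma klb: "k * (l * b) \<approx> 0"
proof -
  have "k * (l * b) \<approx> k * (h * (d * alt h d (c - 2)))" using cong_left[OF _ r5, of k] by (simp add: cm)
  also have "k * (h * (d * alt h d (c - 2))) \<approx> 0"
    using zero_right[OF khd, of "alt h d (c - 2)"] by (simp add: mult.assoc)
  finally show ?thesis .
qed

lemma dQg: "d * (alt h d i * g) \<approx> 0"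
proof (induction i)
  case (Suc i)
  then show ?case using zero_left[of "d * (alt h d i * g)" "d * h"] by (simp add: mult.assoc)
qed (simp add: r8)

lemma lbg: "l * (b * g) \<approx> 0"
proof -
  have "l * (b * g) \<approx> h * (d * (alt h d (c - 2) * g))" using tail[OF r5, of g] by (simp add: cm mult.assoc)
  also have "h * (d * (alt h d (c - 2) * g)) \<approx> 0" by (intro zero_left dQg) simp
  finally show ?thesis .
qed

lemma hdl: "h * (d * l) \<approx> 0"
proof -
  have "h * (d * l) \<approx> h * (g * (b * g))" by (intro cong_left r3) simp
  also have "h * (g * (b * g)) \<approx> l * (k * (l * (b * g)))" using tail[OF r2, of "b * g"] by (simp add: mult.assoc)
  also have "l * (k * (l * (b * g))) \<approx> 0" by (intro zero_left lbg) simp_all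
  finally show ?thesis .
qed

lemma hPl: "h * (alt d h i * l) \<approx> 0"
proof (induction i)
  case (Suc i)
  then show ?case using zero_left[of "h * (alt d h i * l)" "h * d"] by (simp add: mult.assoc)
qed (simp add: hdl)

lemma gkl: "g * (k * l) \<approx> 0"
proof -
  have "g * (k * l) \<approx> d * (h * (alt d h (c - 2) * l))" using tail[OF r6, of l] by (simp add: cm mult.assoc)
  also have "d * (h * (alt d h (c - 2) * l)) \<approx> 0" by (intro zero_left hPl) simp
  finally show ?thesis .
qed

text \<open>Exchanges vertices 2 and 3, and with them beta and kappa, gamma and lambda, delta and
  eta. The relations are permuted, except that \<open>r8\<close> is carried to the derived zero path
  \<open>hdl\<close>.\<close>

lemma presentation_swap: "quiver_presentation Ov pu N L c e1 e3 e2 k l h d b g"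
proof unfold_locales
  show "h * (d * l) \<approx> 0" by (rule hdl)
  show "e1 + e3 + e2 = idn N" using e_sum by (simp add: algebra_simps)
  show "osub S \<Longrightarrow> (\<And>x y. x \<in> S \<Longrightarrow> y \<in> S \<Longrightarrow> x * y \<in> S) \<Longrightarrow> {e1, e3, e2, k, l, h, d, b, g} \<subseteq> S \<Longrightarrow>
        (\<And>x. x \<in> L \<Longrightarrow> sc pu x \<in> S) \<Longrightarrow> L \<subseteq> S" for S
    using gen[of S] by auto
qed (use c2 e_nz r1 r2 r3 r4 r5 r6 r7 r8 r9 in simp_all)

text \<open>With \<open>c = 2\<close> the alternating words in \<open>r5\<close> and
  \<open>r6\<close> have three letters, like the right-hand sides of \<open>r1\<close> to
  \<open>r4\<close>, so these six relations are permuted. The zero paths required in addition are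
  \<open>hdl\<close> and \<open>bgk\<close>.\<close>

lemma presentation_rotate: assumes "c = 2" shows "quiver_presentation Ov pu N L c e2 e3 e1 d h l k g b"
proof unfold_locales
  show "h * (d * l) \<approx> 0" by (rule hdl)
  show "b * (g * k) \<approx> 0" by (rule bgk)
  show "e2 + e3 + e1 = idn N" using e_sum by (simp add: algebra_simps)
  show "osub S \<Longrightarrow> (\<And>x y. x \<in> S \<Longrightarrow> y \<in> S \<Longrightarrow> x * y \<in> S) \<Longrightarrow> {e2, e3, e1, d, h, l, k, g, b} \<subseteq> S \<Longrightarrow>
        (\<And>x. x \<in> L \<Longrightarrow> sc pu x \<in> S) \<Longrightarrow> L \<subseteq> S" for S
    using gen[of S] by auto
qed (use c2 e_nz r1 r2 r3 r4 r5 r6 r7 r8 r9 assms in simp_all)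

text \<open>The number is a depth that right multiplication by an arrow strictly raises (\<open>nf_good\<close>). This yields at once
  that the listed paths span and that long products of arrows vanish modulo \<open>pu\<close>.\<close>

inductive nf :: "nat \<Rightarrow> 'a alg \<Rightarrow> bool" where
  "nf 0 e1" | "nf 0 e2" | "nf 0 e3"
| "nf 1 b" | "nf 1 k" | "nf 1 g" | "nf 1 l"
| "nf 2 (b * g)" | "nf 2 (k * l)" | "nf 2 (g * b)" | "nf 2 (l * k)"
| "nf 3 (k * h)" | "nf 3 (b * d)" | "nf 3 (d * l)" | "nf 3 (h * g)"
| "nf 4 (k * (h * g))" | "nf (2 * c) (g * (k * h))" | "nf (2 * c) (h * (g * k))"
| "nf (2 * c - 1) (g * k)" | "nf (2 * c - 1) (l * b)"
| "i < c - 1 \<Longrightarrow> nf (2 * i + 1) (alt d h i)"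
| "i < c - 1 \<Longrightarrow> nf (2 * i + 1) (alt h d i)"
| "i < c - 1 \<Longrightarrow> nf (2 * i + 2) (d * alt h d i)"
| "i < c - 1 \<Longrightarrow> nf (2 * i + 2) (h * alt d h i)"

lemma nf_L: "nf m x \<Longrightarrow> x \<in> L" by (induction rule: nf.induct) auto
lemma nf_bound: "nf m x \<Longrightarrow> m \<le> 2 * c" by (induction rule: nf.induct) (use c2 in auto)

definition NFset :: "nat \<Rightarrow> 'a alg set" where "NFset m = {x. \<exists>i\<ge>m. nf i x}"
text \<open>A filtration by depth with \<open>pu L\<close> added at every level, so that congruences
  may be used freely inside it. Depth counts letters after rewriting a short word into its longer
  partner: \<open>k * h\<close> counts like \<open>b * (g * b)\<close>, and \<open>g * k\<close>
  like the alternating word of \<open>2 * c - 1\<close> letters.\<close>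

definition W :: "nat \<Rightarrow> 'a alg set" where "W m = ospan (NFset m \<union> sc pu ` L)"

lemma W_osub: "osub (W m)" by (simp add: W_def ospan_osub)

lemma W_pi: "z \<in> L \<Longrightarrow> sc pu z \<in> W m"
  unfolding W_def by (rule subsetD[OF ospan_base]) simp

lemma W_nf: "nf i x \<Longrightarrow> m \<le> i \<Longrightarrow> x \<in> W m"
  unfolding W_def NFset_def by (rule subsetD[OF ospan_base]) blast

lemma W_cong: "y \<in> W m \<Longrightarrow> x \<approx> y \<Longrightarrow> x \<in> W m"
proof -
  assume y: "y \<in> W m" and "x \<approx> y"
  then obtain z where z: "z \<in> L" "x - y = sc pu z" by (auto simp: cong_def)
  then have "y + (x - y) \<in> W m" using osubD(2)[OF W_osub y W_pi] by simp
  then show ?thesis by simp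
qed

lemma W_nf': "nf i y \<Longrightarrow> m \<le> i \<Longrightarrow> x \<approx> y \<Longrightarrow> x \<in> W m"
  by (rule W_cong[OF W_nf])

lemma W_zero: "x \<approx> 0 \<Longrightarrow> x \<in> W m"
  using W_cong[OF osubD(1)[OF W_osub]] .

lemma W_0: "0 \<in> W m" by (rule osubD(1)[OF W_osub])

lemma W_mono: "m \<le> m' \<Longrightarrow> W m' \<subseteq> W m"
  unfolding W_def NFset_def by (intro ospan_mono) auto

lemma ends:
  "x * e1 = x \<Longrightarrow> x * g = 0 \<and> x * d = 0 \<and> x * h = 0 \<and> x * l = 0 \<and> x * e2 = 0 \<and> x * e3 = 0"
  "x * e2 = x \<Longrightarrow> x * b = 0 \<and> x * k = 0 \<and> x * h = 0 \<and> x * l = 0 \<and> x * e1 = 0 \<and> x * e3 = 0"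
  "x * e3 = x \<Longrightarrow> x * b = 0 \<and> x * k = 0 \<and> x * g = 0 \<and> x * d = 0 \<and> x * e1 = 0 \<and> x * e2 = 0"
proof -
  have *: "x * e = x \<Longrightarrow> e * y = 0 \<Longrightarrow> x * y = 0" for x e y :: "'a alg" by (metis mult.assoc mult_zero_right)
  have **: "e * f = 0 \<Longrightarrow> f * y = y \<Longrightarrow> e * y = 0" for e f y :: "'a alg" by (metis mult.assoc mult_zero_left)
  have z: "e1 * g = 0" "e1 * d = 0" "e1 * h = 0" "e1 * l = 0" "e2 * b = 0" "e2 * k = 0" "e2 * h = 0" "e2 * l = 0"
    "e3 * b = 0" "e3 * k = 0" "e3 * g = 0" "e3 * d = 0"
    by (rule **[OF e_orth(1) blk(3)] **[OF e_orth(1) blk(5)] **[OF e_orth(2) blk(7)] **[OF e_orth(2) blk(11)]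
         **[OF e_orth(3) blk(1)] **[OF e_orth(3) blk(9)] **[OF e_orth(4) blk(7)] **[OF e_orth(4) blk(11)]
         **[OF e_orth(5) blk(1)] **[OF e_orth(5) blk(9)] **[OF e_orth(6) blk(3)] **[OF e_orth(6) blk(5)])+
  show "x * e1 = x \<Longrightarrow> x * g = 0 \<and> x * d = 0 \<and> x * h = 0 \<and> x * l = 0 \<and> x * e2 = 0 \<and> x * e3 = 0"
    using *[of x e1] z by simp
  show "x * e2 = x \<Longrightarrow> x * b = 0 \<and> x * k = 0 \<and> x * h = 0 \<and> x * l = 0 \<and> x * e1 = 0 \<and> x * e3 = 0"
    using *[of x e2] z by simp
  show "x * e3 = x \<Longrightarrow> x * b = 0 \<and> x * k = 0 \<and> x * g = 0 \<and> x * d = 0 \<and> x * e1 = 0 \<and> x * e2 = 0"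
    using *[of x e3] z by simp
qed

lemma alt_right [simp]: "alt d h i * e3 = alt d h i" "alt h d i * e2 = alt h d i"
  by (induction i) (simp_all add: mult.assoc)

lemma alt_left [simp]: "e2 * alt d h i = alt d h i" "e3 * alt h d i = alt h d i"
  by (cases i; simp flip: mult.assoc)+

definition good :: "nat \<Rightarrow> 'a alg \<Rightarrow> bool" where
  "good m x \<longleftrightarrow> (\<forall>a\<in>{b,g,d,h,k,l}. x * a \<in> W (Suc m)) \<and> (\<forall>e\<in>{e1,e2,e3}. x * e \<in> {x, 0})"

lemma good1: "x * e1 = x \<Longrightarrow> x * b \<in> W (Suc m) \<Longrightarrow> x * k \<in> W (Suc m) \<Longrightarrow> good m x"
  using ends(1)[of x] W_0 by (auto simp: good_def)
lemma good2: "x * e2 = x \<Longrightarrow> x * g \<in> W (Suc m) \<Longrightarrow> x * d \<in> W (Suc m) \<Longrightarrow> good m x"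
  using ends(2)[of x] W_0 by (auto simp: good_def)
lemma good3: "x * e3 = x \<Longrightarrow> x * h \<in> W (Suc m) \<Longrightarrow> x * l \<in> W (Suc m) \<Longrightarrow> good m x"
  using ends(3)[of x] W_0 by (auto simp: good_def)

text \<open>For \<open>i = c - 1\<close> the alternating words are not among the normal forms;
  \<open>g * k\<close> and \<open>l * b\<close> stand for them there, at the same depth
  \<open>2 * c - 1\<close>.\<close>

lemma nf_alts: "i \<le> c - 1 \<Longrightarrow> m \<le> 2 * i + 1 \<Longrightarrow> alt d h i \<in> W m" "i \<le> c - 1 \<Longrightarrow> m \<le> 2 * i + 1 \<Longrightarrow> alt h d i \<in> W m"
proof -
  have *: "2 * c - 1 = 2 * (c - 1) + 1" using c2 by auto
  show "alt d h i \<in> W m" if "i \<le> c - 1" "m \<le> 2 * i + 1"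
  proof (cases "i = c - 1")
    case True
    then show ?thesis using W_nf'[OF nf.intros(19) _ cong_sym[OF r6], of m] that(2) unfolding * by simp
  next
    case False
    then show ?thesis using W_nf[OF nf.intros(21)] that by simp
  qed
  show "alt h d i \<in> W m" if "i \<le> c - 1" "m \<le> 2 * i + 1"
  proof (cases "i = c - 1")
    case True
    then show ?thesis using W_nf'[OF nf.intros(20) _ cong_sym[OF r5], of m] that(2) unfolding * by simp
  next
    case False
    then show ?thesis using W_nf[OF nf.intros(22)] that by simp
  qed
qed

text \<open>In each case only two arrows leave the end vertex. The two products are normal forms of
  greater depth up to congruence, or they vanish modulo \<open>pu\<close>.\<close>

lemma nf_good: "nf m x \<Longrightarrow> good m x"
proof (induction rule: nf.induct)
  case 1 show ?case by (rule good1) (auto intro: W_nf nf.intros)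
next
  case 2 show ?case by (rule good2) (use nf_alts(1)[of 0 "Suc 0"] in \<open>auto intro: W_nf nf.intros\<close>)
next
  case 3 show ?case by (rule good3) (use nf_alts(2)[of 0 "Suc 0"] in \<open>auto intro: W_nf nf.intros\<close>)
next
  case 4 show ?case by (rule good2) (auto intro: W_nf nf.intros)
next
  case 5 show ?case by (rule good3) (auto intro: W_nf nf.intros)
next
  case 6 show ?case by (rule good1) (use c2 in \<open>auto intro: W_nf nf.intros\<close>)
next
  case 7 show ?case by (rule good1) (use c2 in \<open>auto intro: W_nf nf.intros\<close>)
next
  case 8 
  show ?case
  proof (rule good1)
    show "b * g * b \<in> W (Suc 2)" using W_nf'[OF nf.intros(12) _ cong_sym[OF r4]] by (simp add: mult.assoc)
    show "b * g * k \<in> W (Suc 2)" using W_zero[OF bgk] by (simp add: mult.assoc)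
  qed (simp add: mult.assoc)
next
  case 9
  show ?case
  proof (rule good1)
    show "k * l * b \<in> W (Suc 2)" using W_zero[OF klb] by (simp add: mult.assoc)
    show "k * l * k \<in> W (Suc 2)" using W_nf'[OF nf.intros(13) _ cong_sym[OF r1]] by (simp add: mult.assoc)
  qed (simp add: mult.assoc)
next
  case 10
  show ?case
  proof (rule good2)
    show "g * b * g \<in> W (Suc 2)" using W_nf'[OF nf.intros(14) _ cong_sym[OF r3]] by (simp add: mult.assoc)
    show "g * b * d \<in> W (Suc 2)" using W_zero[OF r7] by (simp add: mult.assoc)
  qed (simp add: mult.assoc)
next
  case 11
  show ?case
  proof (rule good3)
    show "l * k * l \<in> W (Suc 2)" using W_nf'[OF nf.intros(15) _ cong_sym[OF r2]] by (simp add: mult.assoc)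
    show "l * k * h \<in> W (Suc 2)" using W_zero[OF r9] by (simp add: mult.assoc)
  qed (simp add: mult.assoc)
next
  case 12
  show ?case
  proof (rule good2)
    show "k * h * g \<in> W (Suc 3)" using W_nf[OF nf.intros(16)] by (simp add: mult.assoc)
    show "k * h * d \<in> W (Suc 3)" using W_zero[OF khd] by (simp add: mult.assoc)
  qed (simp add: mult.assoc)
next
  case 13
  \<comment> \<open>Both two-arrow routes out of vertex 1 end in the same deepest closed path:
    \<open>b * (d * l)\<close> and \<open>k * (h * g)\<close> are each congruent to
    \<open>b * g * b * g\<close>.\<close>
  have "b * (d * l) \<approx> b * (g * (b * g))" by (intro cong_left r3) simp
  also have "b * (g * (b * g)) \<approx> k * (h * g)" using cong_sym[OF tail[OF r4, of g]] by (simp add: mult.assoc)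
  finally have "b * (d * l) \<approx> k * (h * g)" .
  then show ?case 
    by (intro good3) (use W_zero[OF bdh] W_nf'[OF nf.intros(16)] in \<open>simp_all add: mult.assoc\<close>)
next
  case 14
  have "d * (l * b) \<approx> g * (b * (g * b))" using tail[OF r3, of b] by (simp add: mult.assoc)
  also have "g * (b * (g * b)) \<approx> g * (k * h)" by (intro cong_left cong_sym[OF r4]) simp
  finally have 1: "d * (l * b) \<approx> g * (k * h)" .
  have "d * (l * k) \<approx> g * (b * (g * k))" using tail[OF r3, of k] by (simp add: mult.assoc)
  also have "g * (b * (g * k)) \<approx> 0" by (intro zero_left bgk) simp
  finally have 2: "d * (l * k) \<approx> 0" .
  show ?case 
    by (rule good1) (use W_zero[OF 2] W_nf'[OF nf.intros(17) _ 1] c2 in \<open>simp_all add: mult.assoc\<close>)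
next
  case 15
  have "h * (g * b) \<approx> l * (k * (l * b))" using tail[OF r2, of b] by (simp add: mult.assoc)
  also have "l * (k * (l * b)) \<approx> 0" by (intro zero_left klb) simp
  finally have 1: "h * (g * b) \<approx> 0" .
  show ?case
    by (rule good1) (use W_zero[OF 1] W_nf[OF nf.intros(18)] c2 in \<open>simp_all add: mult.assoc\<close>)
next
  case 16
  have *: "k * (h * (g * x)) \<approx> b * (g * (b * (g * x)))" if "x \<in> L" for x
    using tail[OF r4, of "g * x"] that by (simp add: mult.assoc)
  have "b * (g * (b * (g * b))) \<approx> b * (g * (k * h))" by (intro cong_left cong_sym[OF r4]) simp_all
  also have "b * (g * (k * h)) \<approx> 0" using zero_right[OF bgk, of h] by (simp add: mult.assoc)
  finally have 1: "k * (h * (g * b)) \<approx> 0" using *[of b] cong_trans by auto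
  have "b * (g * (b * (g * k))) \<approx> 0" by (intro zero_left bgk) simp_all
  then have 2: "k * (h * (g * k)) \<approx> 0" using *[of k] cong_trans by auto
  show ?case
    by (rule good1) (use W_zero[OF 1] W_zero[OF 2] in \<open>simp_all add: mult.assoc\<close>)
next
  case 17
  have "g * (k * (h * g)) \<approx> g * (b * (g * (b * g)))" using cong_left[OF _ tail[OF r4, of g], of g] by (simp add: mult.assoc)
  also have "g * (b * (g * (b * g))) \<approx> d * (l * (b * g))" using cong_sym[OF tail[OF r3, of "b * g"]] by (simp add: mult.assoc)
  also have "d * (l * (b * g)) \<approx> 0" by (intro zero_left lbg) simp
  finally have 1: "g * (k * (h * g)) \<approx> 0" .
  have 2: "g * (k * (h * d)) \<approx> 0" by (intro zero_left khd) simp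
  show ?case
    by (rule good2) (use W_zero[OF 1] W_zero[OF 2] in \<open>simp_all add: mult.assoc\<close>)
next
  case 18
  have "h * (g * (k * h)) \<approx> l * (k * (l * (k * h)))" using tail[OF r2, of "k * h"] by (simp add: mult.assoc)
  also have "l * (k * (l * (k * h))) \<approx> 0" by (intro zero_left r9) simp_all
  finally have 1: "h * (g * (k * h)) \<approx> 0" .
  have 2: "h * (g * (k * l)) \<approx> 0" by (intro zero_left gkl) simp
  show ?case
    by (rule good3) (use W_zero[OF 1] W_zero[OF 2] in \<open>simp_all add: mult.assoc\<close>)
next
  case 19
  show ?case
    by (rule good3) (use W_zero[OF gkl] W_nf[OF nf.intros(17)] c2 in \<open>simp_all add: mult.assoc\<close>)
next
  case 20
  have "l * (b * d) \<approx> l * (k * (l * k))" by (intro cong_left r1) simp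
  also have "l * (k * (l * k)) \<approx> h * (g * k)" using cong_sym[OF tail[OF r2, of k]] by (simp add: mult.assoc)
  finally have 1: "l * (b * d) \<approx> h * (g * k)" .
  show ?case
    by (rule good2) (use W_zero[OF lbg] W_nf'[OF nf.intros(18) _ 1] c2 in \<open>simp_all add: mult.assoc\<close>)
next
  case (21 i)
  show ?case
  proof (rule good3)
    show "alt d h i * h \<in> W (Suc (2 * i + 1))" using W_nf[OF nf.intros(23)[OF 21]] by (simp add: alt_mult)
    show "alt d h i * l \<in> W (Suc (2 * i + 1))"
    proof (cases i)
      case 0
      then show ?thesis using W_nf[OF nf.intros(14)] by simp
    next
      case (Suc j)
      have "d * (h * (alt d h j * l)) \<approx> 0" by (intro zero_left hPl) simp
      then show ?thesis using W_zero Suc by (simp add: mult.assoc)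
    qed
  qed simp
next
  case (22 i)
  show ?case
  proof (rule good2)
    show "alt h d i * d \<in> W (Suc (2 * i + 1))" using W_nf[OF nf.intros(24)[OF 22]] by (simp add: alt_mult)
    show "alt h d i * g \<in> W (Suc (2 * i + 1))"
    proof (cases i)
      case 0
      then show ?thesis using W_nf[OF nf.intros(15)] by simp
    next
      case (Suc j)
      have "h * (d * (alt h d j * g)) \<approx> 0" by (intro zero_left dQg) simp
      then show ?thesis using W_zero Suc by (simp add: mult.assoc)
    qed
  qed simp
next
  case (23 i)
  show ?case
  proof (rule good2)
    show "d * alt h d i * g \<in> W (Suc (2 * i + 2))" using W_zero[OF dQg] by (simp add: mult.assoc)
    show "d * alt h d i * d \<in> W (Suc (2 * i + 2))" using nf_alts(1)[of "Suc i"] 23 by (simp add: mult.assoc alt_mult)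
  qed (simp add: mult.assoc)
next
  case (24 i)
  show ?case
  proof (rule good3)
    show "h * alt d h i * l \<in> W (Suc (2 * i + 2))" using W_zero[OF hPl] by (simp add: mult.assoc)
    show "h * alt d h i * h \<in> W (Suc (2 * i + 2))" using nf_alts(2)[of "Suc i"] 24 by (simp add: mult.assoc alt_mult)
  qed (simp add: mult.assoc)
qed

end

section \<open>Spanning sets of the diagonal and upper blocks, and nilpotence of the arrows modulo
  \<open>pu\<close>\<close>

context quiver_presentation begin

lemma W_L: "W m \<subseteq> L"
  unfolding W_def by (rule ospan_least[OF Losub]) (auto simp: NFset_def nf_L)

lemma W_arrow: assumes "x \<in> W m" "a \<in> {b,g,d,h,k,l}" shows "x * a \<in> W (Suc m)"
proof (rule ospan_map[of _ "\<lambda>x. x * a" "NFset m \<union> sc pu ` L"])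
  show "y * a \<in> W (Suc m)" if y: "y \<in> NFset m \<union> sc pu ` L" for y
  proof (cases "y \<in> NFset m")
    case True
    then obtain i where i: "m \<le> i" "nf i y" by (auto simp: NFset_def)
    then have "y * a \<in> W (Suc i)" using nf_good[OF i(2)] assms(2) by (auto simp: good_def)
    then show ?thesis using W_mono[of "Suc m" "Suc i"] i by auto
  next
    case False
    then obtain z where "z \<in> L" "y = sc pu z" using y by auto
    then show ?thesis using assms(2) by (auto intro!: W_pi)
  qed
qed (use assms(1) W_osub in \<open>auto simp: distrib_right W_def\<close>)

lemma W_idem: assumes "x \<in> W m" "e \<in> {e1,e2,e3}" shows "x * e \<in> W m"
proof (rule ospan_map[of _ "\<lambda>x. x * e" "NFset m \<union> sc pu ` L"])
  show "y * e \<in> W m" if y: "y \<in> NFset m \<union> sc pu ` L" for y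
  proof (cases "y \<in> NFset m")
    case True
    then obtain i where i: "m \<le> i" "nf i y" by (auto simp: NFset_def)
    then have "y * e \<in> {y, 0}" using nf_good[OF i(2)] assms(2) by (auto simp: good_def)
    then show ?thesis using W_nf[OF i(2,1)] W_0 by auto
  next
    case False
    then obtain z where "z \<in> L" "y = sc pu z" using y by auto
    then show ?thesis using assms(2) by (auto intro!: W_pi)
  qed
qed (use assms(1) W_osub in \<open>auto simp: distrib_right W_def\<close>)

lemma idn_W: "idn N \<in> W 0"
  unfolding e_sum[symmetric] by (intro osubD(2)[OF W_osub] W_nf[OF nf.intros(1)] W_nf[OF nf.intros(2)] W_nf[OF nf.intros(3)]) simp_all

text \<open>The elements of \<open>L\<close> that map \<open>W 0\<close> into itself by right
  multiplication satisfy the hypotheses of \<open>gen\<close>, so they are all of \<open>L\<close>;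
  evaluating at the unit puts \<open>L\<close> inside \<open>W 0\<close>.\<close>

lemma L_W0: "L \<subseteq> W 0"
proof -
  let ?S = "{y \<in> L. \<forall>x\<in>W 0. x * y \<in> W 0}"
  have "L \<subseteq> ?S"
  proof (rule gen)
    show "osub ?S" unfolding osub_def using osubD[OF W_osub] by (auto simp: distrib_left)
    show "x * y \<in> ?S" if "x \<in> ?S" "y \<in> ?S" for x y using that by (auto simp flip: mult.assoc)
    show "{e1, e2, e3, b, g, d, h, k, l} \<subseteq> ?S"
      using W_arrow[of _ 0] W_mono[of 0 "Suc 0"] W_idem by auto
    show "sc pu x \<in> ?S" if "x \<in> L" for x using that W_L by (auto intro!: W_pi)
  qed
  then show ?thesis using idn_W by (force dest: bspec[of _ _ "idn N"])
qed

lemma spanning: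
  assumes "B' \<subseteq> L" "\<And>m x. nf m x \<Longrightarrow> \<exists>y\<in>ospan B'. x \<approx> y"
  shows "L \<subseteq> ospan B'"
proof (rule nakayama_ospan[of "NFset 0"])
  show "L \<subseteq> ospan (NFset 0 \<union> sc pu ` L)" using L_W0 by (simp add: W_def)
  show "\<exists>b'\<in>ospan B'. x \<approx> b'" if "x \<in> NFset 0" for x
    using that assms(2) by (auto simp: NFset_def)
qed (rule assms(1))

lemma span1: "L \<subseteq> ospan {x. \<exists>m. nf m x}"
proof (rule spanning)
  show "\<exists>y\<in>ospan {x. \<exists>m. nf m x}. x \<approx> y" if "nf m x" for m x
    using that subsetD[OF ospan_base, of x "{x. \<exists>m. nf m x}"] by (intro bexI[of _ x]) auto
qed (auto simp: nf_L)

text \<open>Trading \<open>k * h\<close>, \<open>b * d\<close>, \<open>g * k\<close> for congruent paths beginning with \<open>b\<close>, \<open>k\<close>, \<open>d\<close> respectively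
  exhibits the blocks above the diagonal as principal right ideals.\<close>

definition left_basis :: "'a alg set" where
  "left_basis = {x. (\<exists>m. nf m x) \<and> x \<noteq> k * h \<and> x \<noteq> b * d \<and> x \<noteq> g * k} \<union> {b * (g * b), k * (l * k), alt d h (c - 1)}"

lemma span2: "L \<subseteq> ospan left_basis"
proof (rule spanning)
  have I: "y \<in> left_basis \<Longrightarrow> x \<approx> y \<Longrightarrow> \<exists>y\<in>ospan left_basis. x \<approx> y" for x y using subsetD[OF ospan_base] by blast
  show "\<exists>y\<in>ospan left_basis. x \<approx> y" if nf: "nf m x" for m x
  proof (cases "x = k * h \<or> x = b * d \<or> x = g * k")
    case True
    then show ?thesis using I[OF _ r1] I[OF _ r4] I[OF _ r6] by (auto simp: left_basis_def)
  next
    case False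
    then show ?thesis using nf by (intro I[of x]) (auto simp: left_basis_def)
  qed
qed (auto simp: left_basis_def nf_L)

lemma right_zero [simp]:
  "b * e1 = 0" "b * e3 = 0" "g * e2 = 0" "g * e3 = 0" "d * e1 = 0" "d * e2 = 0" "h * e1 = 0" "h * e3 = 0"
  "k * e1 = 0" "k * e2 = 0" "l * e2 = 0" "l * e3 = 0"
  "alt d h i * e1 = 0" "alt d h i * e2 = 0" "alt h d i * e1 = 0" "alt h d i * e3 = 0"
  using ends(2)[OF blk(2)] ends(1)[OF blk(4)] ends(3)[OF blk(6)] ends(2)[OF blk(8)] ends(3)[OF blk(10)] ends(1)[OF blk(12)]
    ends(3)[OF alt_right(1)] ends(2)[OF alt_right(2)]
  by simp_all

lemma left_zero [simp]:
  "e1 * g = 0" "e1 * d = 0" "e1 * h = 0" "e1 * l = 0" "e2 * b = 0" "e2 * k = 0" "e2 * h = 0" "e2 * l = 0"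
    "e3 * b = 0" "e3 * k = 0" "e3 * g = 0" "e3 * d = 0"
  using ends(1)[OF e_id(1)] ends(2)[OF e_id(2)] ends(3)[OF e_id(3)] by simp_all

lemma left_tail [simp]:
  "e1 * (g * x) = 0" "e1 * (d * x) = 0" "e1 * (h * x) = 0" "e1 * (l * x) = 0" "e2 * (b * x) = 0" "e2 * (k * x) = 0"
  "e2 * (h * x) = 0" "e2 * (l * x) = 0" "e3 * (b * x) = 0" "e3 * (k * x) = 0" "e3 * (g * x) = 0" "e3 * (d * x) = 0"
  "e1 * (b * x) = b * x" "e1 * (k * x) = k * x" "e2 * (g * x) = g * x" "e2 * (d * x) = d * x" "e3 * (h * x) = h * x" "e3 * (l * x) = l * x"
  by (simp_all flip: mult.assoc)

lemma left_alt [simp]: "e1 * alt d h i = 0" "e3 * alt d h i = 0" "e1 * alt h d i = 0" "e2 * alt h d i = 0"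
  by (cases i; simp)+

lemma left_alt_tail [simp]: "e1 * (alt d h i * x) = 0" "e3 * (alt d h i * x) = 0" "e1 * (alt h d i * x) = 0" "e2 * (alt h d i * x) = 0"
  "e2 * (alt d h i * x) = alt d h i * x" "e3 * (alt h d i * x) = alt h d i * x"
  by (simp_all flip: mult.assoc)

lemma block_span:
  assumes "osub X" "L \<subseteq> ospan S" "\<And>y. y \<in> S \<Longrightarrow> p * y * q \<in> X" "x \<in> L"
  shows "p * x * q \<in> X"
proof (rule ospan_map[of _ "\<lambda>x. p * x * q" S])
  show "x \<in> ospan S" using assms(2,4) by blast
qed (use assms in \<open>simp_all add: distrib_left distrib_right\<close>)

lemma left_ideal_osub: "p \<in> L \<Longrightarrow> osub {p * y | y. y \<in> L}"
proof -
  assume p: "p \<in> L"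
  have "osub ((\<lambda>y. p * y) ` L)" unfolding osub_def
  proof (intro conjI ballI)
    show "0 \<in> (\<lambda>y. p * y) ` L" by (rule image_eqI[of _ _ 0]) auto
    show "x + y \<in> (\<lambda>y. p * y) ` L" if "x \<in> (\<lambda>y. p * y) ` L" "y \<in> (\<lambda>y. p * y) ` L" for x y
      using that by (auto simp flip: distrib_left)
    show "sc a x \<in> (\<lambda>y. p * y) ` L" if "a \<in> Ov" "x \<in> (\<lambda>y. p * y) ` L" for a x
      using that by (auto simp flip: sc_simps(6))
  qed
  moreover have "{p * y | y. y \<in> L} = (\<lambda>y. p * y) ` L" by auto
  ultimately show ?thesis by simp
qed

text \<open>Closed paths at the three vertices. Up to rotation they form \<open>c + 5\<close>
  classes altogether: three trivial paths, \<open>b * g\<close>, \<open>k * l\<close>, the deepest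
  path at vertex 1, and \<open>c - 1\<close> powers of \<open>d * h\<close>.\<close>

definition S11 where "S11 = {e1, b * g, k * l, k * (h * g)}"
definition S22 where "S22 = {e2, g * b, g * (k * h)} \<union> {d * alt h d i | i. i < c - 1}"
definition S33 where "S33 = {e3, l * k, h * (g * k)} \<union> {h * alt d h i | i. i < c - 1}"

lemma block11: assumes "x \<in> L" shows "e1 * x * e1 \<in> ospan S11"
proof (rule block_span[OF ospan_osub span1 _ assms])
  fix y assume "y \<in> {x. \<exists>m. nf m x}"
  then obtain m where "nf m y" by blast
  then have "e1 * y * e1 \<in> S11 \<or> e1 * y * e1 = 0"
    by (cases rule: nf.cases) (simp_all add: mult.assoc S11_def)
  then show "e1 * y * e1 \<in> ospan S11" using osubD(1)[OF ospan_osub] subsetD[OF ospan_base] by metis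
qed

lemma block22: assumes "x \<in> L" shows "e2 * x * e2 \<in> ospan S22"
proof (rule block_span[OF ospan_osub span1 _ assms])
  fix y assume "y \<in> {x. \<exists>m. nf m x}"
  then obtain m where "nf m y" by blast
  then have "e2 * y * e2 \<in> S22 \<or> e2 * y * e2 = 0"
    by (cases rule: nf.cases) (auto simp add: mult.assoc S22_def)
  then show "e2 * y * e2 \<in> ospan S22" using osubD(1)[OF ospan_osub] subsetD[OF ospan_base] by metis
qed

lemma block33: assumes "x \<in> L" shows "e3 * x * e3 \<in> ospan S33"
proof (rule block_span[OF ospan_osub span1 _ assms])
  fix y assume "y \<in> {x. \<exists>m. nf m x}"
  then obtain m where "nf m y" by blast
  then have "e3 * y * e3 \<in> S33 \<or> e3 * y * e3 = 0"
    by (cases rule: nf.cases) (auto simp add: mult.assoc S33_def)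
  then show "e3 * y * e3 \<in> ospan S33" using osubD(1)[OF ospan_osub] subsetD[OF ospan_base] by metis
qed

text \<open>Provides the integral coordinates in which the scalars \<open>kp\<close> of two orders
  are eventually compared.\<close>

lemma block13: assumes "x \<in> L" shows "\<exists>s\<in>Ov. \<exists>t\<in>Ov. e1 * x * e3 = sc s k + sc t (b * d)"
proof (rule ospan_pair, rule block_span[OF ospan_osub span1 _ assms])
  fix y assume "y \<in> {x. \<exists>m. nf m x}"
  then obtain m where "nf m y" by blast
  then have "e1 * y * e3 \<in> {k, b * d} \<or> e1 * y * e3 = 0"
    by (cases rule: nf.cases) (simp_all add: mult.assoc)
  then show "e1 * y * e3 \<in> ospan {k, b * d}" using osubD(1)[OF ospan_osub] subsetD[OF ospan_base] by metis
qed

lemma leftI: "p \<in> L \<Longrightarrow> y \<in> L \<Longrightarrow> x = p * y \<Longrightarrow> x \<in> {p * y | y. y \<in> L}" by blast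

lemma block12_left: assumes "x \<in> L" shows "\<exists>y\<in>L. e1 * x * e2 = b * y"
proof -
  have "e1 * x * e2 \<in> {b * y | y. y \<in> L}"
  proof (rule block_span[OF left_ideal_osub span2 _ assms])
    fix y assume "y \<in> left_basis"
    then have "e1 * y * e2 \<in> {0, b, b * (g * b)}"
      unfolding left_basis_def
      by (elim UnE CollectE conjE exE) (erule nf.cases, simp_all add: mult.assoc, auto simp: mult.assoc)
    then show "e1 * y * e2 \<in> {b * y | y. y \<in> L}" using leftI[of b 0] leftI[of b e2] leftI[of b "g * b"] by auto
  qed simp
  then show ?thesis by blast
qed

lemma block13_left: assumes "x \<in> L" shows "\<exists>y\<in>L. e1 * x * e3 = k * y"
proof -
  have "e1 * x * e3 \<in> {k * y | y. y \<in> L}"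
  proof (rule block_span[OF left_ideal_osub span2 _ assms])
    fix y assume "y \<in> left_basis"
    then have "e1 * y * e3 \<in> {0, k, k * (l * k)}"
      unfolding left_basis_def
      by (elim UnE CollectE conjE exE) (erule nf.cases, simp_all add: mult.assoc, auto simp: mult.assoc)
    then show "e1 * y * e3 \<in> {k * y | y. y \<in> L}" using leftI[of k 0] leftI[of k e3] leftI[of k "l * k"] by auto
  qed simp
  then show ?thesis by blast
qed

lemma block23_left: assumes "x \<in> L" shows "\<exists>y\<in>L. e2 * x * e3 = d * y"
proof -
  have alts: "alt d h i \<in> {d * y | y. y \<in> L}" for i
    by (cases i) (use leftI[of d e3] leftI[of d "h * alt d h (i - 1)"] in auto)
  have "e2 * x * e3 \<in> {d * y | y. y \<in> L}"
  proof (rule block_span[OF left_ideal_osub span2 _ assms])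
    fix y assume "y \<in> left_basis"
    then have "e2 * y * e3 \<in> {0} \<union> range (alt d h)"
      unfolding left_basis_def
      by (elim UnE CollectE conjE exE) (erule nf.cases, simp_all add: mult.assoc, auto simp: mult.assoc)
    then show "e2 * y * e3 \<in> {d * y | y. y \<in> L}" using leftI[of d 0] alts by auto
  qed simp
  then show ?thesis by blast
qed

text \<open>Words grow on the right to follow the filtration \<open>W\<close>, but act on modules by
  growing on the left; \<open>arrow_word_left\<close> reconciles the two. Products of arrows that do
  not compose are allowed.\<close>

inductive arrow_word :: "nat \<Rightarrow> 'a alg \<Rightarrow> bool" where
  arrow_word_0: "arrow_word 0 (idn N)"
| arrow_word_Suc: "arrow_word m x \<Longrightarrow> a \<in> {b,g,d,h,k,l} \<Longrightarrow> arrow_word (Suc m) (x * a)"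

lemma arrow_word_W: "arrow_word m x \<Longrightarrow> x \<in> W m"
  by (induction rule: arrow_word.induct) (auto intro: idn_W W_arrow)

lemma arrow_word_left: "arrow_word m x \<Longrightarrow> a \<in> {b,g,d,h,k,l} \<Longrightarrow> arrow_word (Suc m) (a * x)"
proof (induction rule: arrow_word.induct)
  case arrow_word_0
  have "a * idn N = idn N * a" by (simp add: cen_commute)
  then show ?case using arrow_word_Suc[OF arrow_word.arrow_word_0 arrow_word_0] by simp
next
  case (arrow_word_Suc m x a')
  then show ?case using arrow_word.arrow_word_Suc[of "Suc m" "a * x" a'] by (simp add: mult.assoc)
qed

text \<open>No normal form is deeper than \<open>2 * c\<close>, so beyond that level the filtration
  consists of \<open>pu L\<close> alone.\<close>

lemma arrow_word_long: assumes "arrow_word m x" "2 * c < m" shows "\<exists>z\<in>L. x = sc pu z"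
proof -
  have "NFset m = {}" using nf_bound assms(2) by (fastforce simp: NFset_def)
  moreover have "osub (sc pu ` L)" unfolding osub_def
  proof (intro conjI ballI)
    show "0 \<in> sc pu ` L" by (rule image_eqI[of _ _ 0]) auto
    show "x + y \<in> sc pu ` L" if "x \<in> sc pu ` L" "y \<in> sc pu ` L" for x y
      using that by (auto simp flip: sc_distrib)
    show "sc a x \<in> sc pu ` L" if ax: "a \<in> Ov" "x \<in> sc pu ` L" for a x
    proof -
      obtain z where "z \<in> L" "x = sc pu z" using ax by auto
      then show ?thesis using ax by (intro image_eqI[of _ _ "sc a z"]) (auto simp: mult.commute)
    qed
  qed
  ultimately have "W m \<subseteq> sc pu ` L" unfolding W_def by (intro ospan_least) auto
  then show ?thesis using arrow_word_W[OF assms(1)] by blast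
qed

end

section \<open>The centre surjects onto the diagonal blocks\<close>

locale symmetric_presentation = quiver_presentation Ov pu N L c e1 e2 e3 b g d h k l 
  for Ov :: "'a::field set" and pu N L c e1 e2 e3 b g d h k l +
  fixes T :: "'a alg \<Rightarrow> 'a alg \<Rightarrow> 'a"
  assumes Tadd1: "x \<in> ANset N \<Longrightarrow> y \<in> ANset N \<Longrightarrow> z \<in> ANset N \<Longrightarrow> T (x + y) z = T x z + T y z"
    and Tsc1: "x \<in> ANset N \<Longrightarrow> z \<in> ANset N \<Longrightarrow> T (sc a x) z = a * T x z"
    and Tsym: "x \<in> ANset N \<Longrightarrow> y \<in> ANset N \<Longrightarrow> T x y = T y x"
    and Tassoc: "x \<in> ANset N \<Longrightarrow> y \<in> ANset N \<Longrightarrow> z \<in> ANset N \<Longrightarrow> T (x * y) z = T x (y * z)"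
    and Tnd: "x \<in> ANset N \<Longrightarrow> (\<And>y. y \<in> ANset N \<Longrightarrow> T x y = 0) \<Longrightarrow> x = 0"
    and Tdual: "x \<in> ANset N \<Longrightarrow> x \<in> L \<longleftrightarrow> (\<forall>y\<in>L. T x y \<in> Ov)"
    and NC: "N = c + 5"
begin

lemma LAN [simp]: "x \<in> L \<Longrightarrow> x \<in> ANset N" using LA by blast
lemmas AN_cl [simp] = ANset_closed cen_ANset

lemma Tadd2: "x \<in> ANset N \<Longrightarrow> y \<in> ANset N \<Longrightarrow> z \<in> ANset N \<Longrightarrow> T z (x + y) = T z x + T z y"
  using Tadd1 Tsym by simp

lemma Tsc2: "x \<in> ANset N \<Longrightarrow> z \<in> ANset N \<Longrightarrow> T z (sc a x) = a * T z x"
  using Tsc1 Tsym by simp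

lemma T0: "z \<in> ANset N \<Longrightarrow> T z 0 = 0" "z \<in> ANset N \<Longrightarrow> T 0 z = 0"
  using Tsc2[of 0 z 0] Tsc1[of 0 z 0] by simp_all

lemma T_eq_zero: assumes x: "x \<in> ANset N" and *: "\<And>y. y \<in> L \<Longrightarrow> T x y = 0" shows "x = 0"
proof (rule Tnd[OF x])
  fix y :: "'a alg" assume y: "y \<in> ANset N"
  obtain m where "sc (pu ^ m) y \<in> L" using Lfull[OF y] by blast
  then have "pu ^ m * T x y = 0" using * Tsc2[OF y x] by metis
  then show "T x y = 0" by simp
qed

text \<open>Pairing with a central element is a trace, hence insensitive to rotating a closed
  path.\<close>

lemma T_cen_comm: assumes "x \<in> ANset N" "y \<in> ANset N" shows "T (cen N z) (x * y) = T (cen N z) (y * x)"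
proof -
  have "T (cen N z) (x * y) = T (cen N z * x) y" using assms by (simp add: Tassoc)
  also have "\<dots> = T (x * cen N z) y" by (simp add: cen_commute)
  also have "\<dots> = T x (cen N z * y)" using assms by (simp add: Tassoc)
  also have "\<dots> = T (cen N z * y) x" using assms by (simp add: Tsym)
  also have "\<dots> = T (cen N z) (y * x)" using assms by (simp add: Tassoc)
  finally show ?thesis .
qed

lemma T_cen_sum: assumes "x \<in> ANset N"
  shows "T (cen N z) x = (\<Sum>i<N. z i * T (cen N (\<lambda>j. if j = i then 1 else 0)) x)"
proof -
  have "T (\<Sum>i\<in>I. sc (z i) (cen N (\<lambda>j. if j = i then 1 else 0))) x
      = (\<Sum>i\<in>I. z i * T (cen N (\<lambda>j. if j = i then 1 else 0)) x)" if "finite I" for I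
    using that
  proof induction
    case empty
    then show ?case using assms T0 by simp
  next
    case (insert i I)
    then show ?case using assms by (simp add: Tadd1 Tsc1 ANset_sum)
  qed
  then show ?thesis by (subst cen_eq_sum) simp
qed

text \<open>A trace vanishes on the off-diagonal blocks, so only the three diagonal blocks
  contribute.\<close>

lemma T_cen_block: assumes x: "x \<in> L"
  shows "T (cen N z) x = T (cen N z) (e1 * x * e1) + T (cen N z) (e2 * x * e2) + T (cen N z) (e3 * x * e3)"
proof -
  have z: "T (cen N z) (e * y) = T (cen N z) (e * y * e)" if "e \<in> L" "e * e = e" "y \<in> L" for e y
    using T_cen_comm[of e "e * y" z] that by (simp flip: mult.assoc)
  have "x = (e1 + e2 + e3) * x" using x by (simp add: e_sum)
  then have "x = e1 * x + e2 * x + e3 * x" by (simp add: distrib_right)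
  then have "T (cen N z) x = T (cen N z) (e1 * x + e2 * x + e3 * x)" by simp
  also have "\<dots> = T (cen N z) (e1 * x) + T (cen N z) (e2 * x) + T (cen N z) (e3 * x)"
    using x by (simp add: Tadd2)
  finally show ?thesis using z x by simp
qed

lemma T_ospan: 
  assumes X: "0 \<in> X" "\<And>s t. s \<in> X \<Longrightarrow> t \<in> X \<Longrightarrow> s + t \<in> X" "\<And>a s. a \<in> Ov \<Longrightarrow> s \<in> X \<Longrightarrow> a * s \<in> X"
    and z: "z \<in> ANset N" and S: "S \<subseteq> ANset N" "\<And>y. y \<in> S \<Longrightarrow> T z y \<in> X" and x: "x \<in> ospan S"
  shows "T z x \<in> X"
proof -
  have "osub {x \<in> ANset N. T z x \<in> X}"
    unfolding osub_def using X z by (auto simp: T0 Tadd2 Tsc2)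
  then have "ospan S \<subseteq> {x \<in> ANset N. T z x \<in> X}" using S by (intro ospan_least) auto
  then show ?thesis using x by blast
qed

definition bs :: "nat \<Rightarrow> 'a alg" where
  "bs j = (if j = 0 then e1 else if j = 1 then e2 else if j = 2 then e3 else if j = 3 then b * g
     else if j = 4 then k * l else if j = 5 then k * (h * g) else d * alt h d (j - 6))"

text \<open>\<open>bs2\<close> and \<open>bs3\<close> rotate each class to a path based at vertex 2
  or 3 where there is one, and otherwise keep \<open>bs j\<close>. All three families have the same
  values under a central trace, so one linear system serves the three vertices.\<close>

definition bs2 :: "nat \<Rightarrow> 'a alg" where
  "bs2 j = (if j = 3 then g * b else if j = 5 then g * (k * h) else bs j)"

definition bs3 :: "nat \<Rightarrow> 'a alg" where
  "bs3 j = (if j = 4 then l * k else if j = 5 then h * (g * k) else if j \<ge> 6 then h * alt d h (j - 6) else bs j)"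

lemma bs_L [simp]: "bs j \<in> L" "bs2 j \<in> L" "bs3 j \<in> L"
  by (auto simp: bs_def bs2_def bs3_def)

lemma S_bs: "S11 \<subseteq> bs ` {..<N}" "S22 \<subseteq> bs2 ` {..<N}" "S33 \<subseteq> bs3 ` {..<N}"
proof -
  have I: "y = f j \<Longrightarrow> j < N \<Longrightarrow> y \<in> f ` {..<N}" for y and f :: "nat \<Rightarrow> 'a alg" and j by auto
  show "S11 \<subseteq> bs ` {..<N}" unfolding S11_def
    using I[of _ bs 0] I[of _ bs 3] I[of _ bs 4] I[of _ bs 5] c2 by (simp add: bs_def NC)
  have "d * alt h d i \<in> bs2 ` {..<N}" if "i < c - 1" for i
    by (rule I[of _ _ "i + 6"]) (use that in \<open>auto simp: bs2_def bs_def NC\<close>)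
  then show "S22 \<subseteq> bs2 ` {..<N}" unfolding S22_def
    using I[of _ bs2 1] I[of _ bs2 3] I[of _ bs2 5] c2 by (auto simp: bs2_def bs_def NC)
  have "h * alt d h i \<in> bs3 ` {..<N}" if "i < c - 1" for i
    by (rule I[of _ _ "i + 6"]) (use that in \<open>auto simp: bs3_def bs_def NC\<close>)
  then show "S33 \<subseteq> bs3 ` {..<N}" unfolding S33_def
    using I[of _ bs3 2] I[of _ bs3 4] I[of _ bs3 5] c2 by (auto simp: bs3_def bs_def NC)
qed

lemma T_bs2: "T (cen N z) (bs2 j) = T (cen N z) (bs j)"
  using T_cen_comm[of g b z] T_cen_comm[of g "k * h" z] by (auto simp: bs2_def bs_def mult.assoc)

lemma T_bs3: "T (cen N z) (bs3 j) = T (cen N z) (bs j)"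
proof -
  have "T (cen N z) (h * alt d h i) = T (cen N z) (d * alt h d i)" for i
    using T_cen_comm[of d "alt h d i" z] by (simp flip: alt_mult)
  then show ?thesis using T_cen_comm[of l k z] T_cen_comm[of "h * g" k z]
    by (auto simp: bs3_def bs_def mult.assoc)
qed

text \<open>Applied with two choices of \<open>X\<close>: \<open>{0}\<close> for the injectivity
  behind \<open>solve\<close>, and \<open>Ov\<close> for integrality of the central element.\<close>

lemma T_cen_mem:
  assumes X: "0 \<in> X" "\<And>s t. s \<in> X \<Longrightarrow> t \<in> X \<Longrightarrow> s + t \<in> X" "\<And>a s. a \<in> Ov \<Longrightarrow> s \<in> X \<Longrightarrow> a * s \<in> X"
    and bs: "\<And>j. j < N \<Longrightarrow> T (cen N z) (bs j) \<in> X" and x: "x \<in> L"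
  shows "T (cen N z) x \<in> X"
proof -
  have "T (cen N z) (e1 * x * e1) \<in> X"
    by (rule T_ospan[OF X _ _ _ subsetD[OF ospan_mono[OF S_bs(1)] block11[OF x]]]) (use bs in auto)
  moreover have "T (cen N z) (e2 * x * e2) \<in> X"
    by (rule T_ospan[OF X _ _ _ subsetD[OF ospan_mono[OF S_bs(2)] block22[OF x]]]) (use bs in \<open>auto simp: T_bs2\<close>)
  moreover have "T (cen N z) (e3 * x * e3) \<in> X"
    by (rule T_ospan[OF X _ _ _ subsetD[OF ospan_mono[OF S_bs(3)] block33[OF x]]]) (use bs in \<open>auto simp: T_bs3\<close>)
  ultimately show ?thesis using X(2) T_cen_block[OF x] by simp
qed

text \<open>A vector in the kernel would give a central element pairing to zero with every closed
  path, hence with all of \<open>L\<close>, against non-degeneracy. So the \<open>N\<close> by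
  \<open>N\<close> system is invertible.\<close>

lemma solve: "\<exists>z. \<forall>j<N. T (cen N z) (bs j) = y j"
proof -
  let ?a = "\<lambda>j i. T (cen N (\<lambda>j. if j = i then 1 else 0)) (bs j)"
  have "\<exists>B. (\<forall>i<N. \<forall>j<N. (\<Sum>t<N. ?a i t * B t j) = (if i = j then 1 else 0)) \<and>
            (\<forall>i<N. \<forall>j<N. (\<Sum>t<N. B i t * ?a t j) = (if i = j then 1 else 0))"
  proof (rule square_system_inverse)
    fix z assume "\<forall>j<N. (\<Sum>i<N. ?a j i * z i) = 0"
    then have "T (cen N z) (bs j) \<in> {0}" if "j < N" for j
      using that by (subst T_cen_sum) (auto simp: mult.commute)
    then have "T (cen N z) x = 0" if "x \<in> L" for x
      using T_cen_mem[of "{0}" z x] that by auto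
    then have "cen N z = 0" by (intro T_eq_zero) auto
    then have "ent (cen N z) i 0 0 = 0" for i by (simp add: ent_simps)
    moreover have "0 < adim i" for i by (simp add: adim_def)
    ultimately show "\<forall>i<N. z i = 0" unfolding ent_cen by (metis (full_types))
  qed
  then obtain B where B: "\<forall>i<N. \<forall>j<N. (\<Sum>t<N. ?a i t * B t j) = (if i = j then 1 else 0)" by blast
  show ?thesis
  proof (intro exI[of _ "\<lambda>i. \<Sum>t<N. B i t * y t"] allI impI)
    fix j assume j: "j < N"
    have "T (cen N (\<lambda>i. \<Sum>t<N. B i t * y t)) (bs j) = (\<Sum>i<N. \<Sum>t<N. ?a j i * B i t * y t)"
      by (subst T_cen_sum) (auto simp: sum_distrib_left sum_distrib_right mult_ac)
    also have "\<dots> = (\<Sum>t<N. (\<Sum>i<N. ?a j i * B i t) * y t)"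
      by (subst sum.swap) (simp add: sum_distrib_right)
    also have "\<dots> = (\<Sum>t<N. if j = t then y t else 0)"
      by (rule sum.cong) (use B j in auto)
    finally show "T (cen N (\<lambda>i. \<Sum>t<N. B i t * y t)) (bs j) = y j" using j by simp
  qed
qed

text \<open>A central element is determined by its values under \<open>T\<close> on the \<open>N\<close> closed paths \<open>bs j\<close>, and \<open>N\<close> is
  also the dimension of the centre of the algebra, so these values can be prescribed; they only see closed paths
  up to rotation.\<close>

lemma centre_surj_gen:
  assumes x: "x \<in> L" "e * x * e = x" and e: "e \<in> L" "e * e = e"
    and rb: "\<And>j. rb j \<in> L" "\<And>z j. T (cen N z) (rb j) = T (cen N z) (bs j)"
    and span: "\<And>y. y \<in> L \<Longrightarrow> e * y * e \<in> ospan (rb ` {..<N})"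
  shows "\<exists>z. cen N z \<in> L \<and> cen N z * e = x"
proof -
  \<comment> \<open>The prescribed values are those of \<open>x\<close> itself. They are integral
    since \<open>x\<close> and \<open>rb j\<close> lie in \<open>L\<close>, and duality then puts
    the central element into \<open>L\<close>.\<close>
  obtain z where z: "\<forall>j<N. T (cen N z) (bs j) = T x (rb j)" using solve[of "\<lambda>j. T x (rb j)"] by blast
  have xO: "T x (rb j) \<in> Ov" for j using Tdual[of x] x rb by auto
  have "cen N z \<in> L" unfolding Tdual[OF cen_ANset]
  proof
    fix y assume "y \<in> L"
    then show "T (cen N z) y \<in> Ov" by (rule T_cen_mem[rotated 4]) (use z xO in auto)
  qed
  moreover have "cen N z * e = x"
  proof -
    \<comment> \<open>Both elements lie in the block of \<open>e\<close>, so pairing with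
      \<open>y\<close> sees only \<open>e * y * e\<close>, and on that block they agree by the
      choice of \<open>z\<close>.\<close>
    have "cen N z * e - x = 0"
    proof (rule T_eq_zero)
      fix y assume y: "y \<in> L"
      have "T (cen N z * e) y = T (cen N z) (e * y)" using e y by (simp add: Tassoc)
      also have "\<dots> = T (cen N z) (e * y * e)"
        using T_cen_comm[of e "e * y" z] e y by (simp flip: mult.assoc)
      finally have 1: "T (cen N z * e) y = T (cen N z) (e * y * e)" .
      have "T x y = T (e * (x * e)) y" using x by (simp add: mult.assoc)
      also have "\<dots> = T e (x * e * y)" using e x y by (simp add: Tassoc)
      also have "\<dots> = T (x * (e * y)) e" using e x y by (simp add: Tsym mult.assoc)
      also have "\<dots> = T x (e * y * e)" using e x y by (simp add: Tassoc)
      finally have 2: "T x y = T x (e * y * e)" .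
      have "T (cen N z - x) (e * y * e) \<in> {0}"
      proof (rule T_ospan[OF _ _ _ _ _ _ span[OF y]])
        show "T (cen N z - x) w \<in> {0}" if "w \<in> rb ` {..<N}" for w
          using that z rb x Tadd1[of "cen N z" "sc (-1) x" w] Tsc1[of x w "-1"] by (auto simp: sc_distrib)
      qed (use x rb in auto)
      then have "T (cen N z) (e * y * e) = T x (e * y * e)"
        using x e y Tadd1[of "cen N z" "sc (-1) x" "e * y * e"] Tsc1[of x "e * y * e" "-1"] by (auto simp: sc_distrib)
      then have "T (cen N z * e) y = T x y" using 1 2 by simp
      then show "T (cen N z * e - x) y = 0"
        using x e y Tadd1[of "cen N z * e" "sc (-1) x" y] Tsc1[of x y "-1"] by (auto simp: sc_distrib)
    qed (use x e in auto)
    then show ?thesis by simp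
  qed
  ultimately show ?thesis by blast
qed

lemma centre_surj:
  assumes "x \<in> L"
  shows "\<exists>z. cen N z \<in> L \<and> cen N z * e1 = e1 * x * e1"
    "\<exists>z. cen N z \<in> L \<and> cen N z * e2 = e2 * x * e2"
    "\<exists>z. cen N z \<in> L \<and> cen N z * e3 = e3 * x * e3"
proof -
  have a: "e * (e * x * e) * e = e * x * e" if "e * e = e" for e
    by (simp add: mult.assoc that) (simp flip: mult.assoc add: that)
  show "\<exists>z. cen N z \<in> L \<and> cen N z * e1 = e1 * x * e1"
    by (rule centre_surj_gen[of _ _ bs]) (use assms a subsetD[OF ospan_mono[OF S_bs(1)] block11] in auto)
  show "\<exists>z. cen N z \<in> L \<and> cen N z * e2 = e2 * x * e2"
    by (rule centre_surj_gen[of _ _ bs2]) (use assms a T_bs2 subsetD[OF ospan_mono[OF S_bs(2)] block22] in auto)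
  show "\<exists>z. cen N z \<in> L \<and> cen N z * e3 = e3 * x * e3"
    by (rule centre_surj_gen[of _ _ bs3]) (use assms a T_bs3 subsetD[OF ospan_mono[OF S_bs(3)] block33] in auto)
qed

end

section \<open>Simple modules and adapted bases\<close>

text \<open>The column of \<open>D0\<close> carried by the \<open>r\<close>-th diagonal place of component \<open>i\<close>; no row of \<open>D0\<close> has an entry above 1.\<close>

definition lbl :: "nat \<Rightarrow> nat \<Rightarrow> nat" where
  "lbl i r = (if i < 3 then i else if i \<le> 4 then r else if i = 5 then 2 * r else r + 1)"

text \<open>For \<open>i < N\<close> and \<open>j < 3\<close> its rank in component \<open>i\<close>
  is \<open>D0 i j\<close>; these are the idempotents onto which the lifted vertices are
  conjugated.\<close>

definition eps :: "nat \<Rightarrow> nat \<Rightarrow> 'a::field alg" where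
  "eps N j = Alg (\<lambda>i r s. if i < N \<and> r < adim i \<and> r = s \<and> lbl i r = j then 1 else 0)"

lemma ent_eps: "ent (eps N j) i r s = (if i < N \<and> r < adim i \<and> r = s \<and> lbl i r = j then 1 else 0)"
  unfolding eps_def by (subst Alg_inverse) auto

lemma lbl_less: "r < adim i \<Longrightarrow> lbl i r < 3"
  by (auto simp: lbl_def adim_def split: if_splits)

lemma lbl_inj: "r < adim i \<Longrightarrow> s < adim i \<Longrightarrow> lbl i r = lbl i s \<Longrightarrow> r = s"
  by (auto simp: lbl_def adim_def split: if_splits)

lemma D0_lbl: "r < adim i \<Longrightarrow> D0 i (lbl i r) = 1"
proof -
  assume r: "r < adim i"
  consider "i = 0" | "i = 1" | "i = 2" | "i = 3" | "i = 4" | "i = 5" | "6 \<le> i" by linarith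
  then show ?thesis
  proof cases
    case 4
    then have "r = 0 \<or> r = 1 \<or> r = 2" using r by (auto simp: adim_def)
    then show ?thesis using 4 by (auto simp: D0_def D0row_def lbl_def)
  next
    case 5
    then have "r = 0 \<or> r = 1" using r by (auto simp: adim_def)
    then show ?thesis using 5 by (auto simp: D0_def D0row_def lbl_def)
  next
    case 6
    then have "r = 0 \<or> r = 1" using r by (auto simp: adim_def)
    then show ?thesis using 6 by (auto simp: D0_def D0row_def lbl_def numeral_2_eq_2)
  next
    case 7
    then have "r = 0 \<or> r = 1" using r by (auto simp: adim_def)
    then show ?thesis using 7 by (auto simp: D0_def D0row_def lbl_def)
  qed (auto simp: D0_def D0row_def lbl_def)
qed

text \<open>A vector becomes a first matrix column, which turns the module action into multiplication.\<close>

definition cv :: "nat \<Rightarrow> 'a::field vect \<Rightarrow> 'a alg" where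
  "cv i v = Alg (\<lambda>j r s. if j = i \<and> r < adim i \<and> s = 0 then v r else 0)"

lemma adim_pos [simp]: "0 < adim i" by (simp add: adim_def)

lemma ent_cv: "ent (cv i v) j r s = (if j = i \<and> r < adim i \<and> s = 0 then v r else 0)"
  unfolding cv_def by (subst Alg_inverse) auto

lemma cv_vadd: "cv i (vadd v w) = cv i v + cv i w"
  by (rule alg_eqI) (simp add: ent_cv ent_simps vadd_def)
lemma cv_vsub: "cv i (vsub v w) = cv i v - cv i w"
  by (rule alg_eqI) (simp add: ent_cv ent_simps vsub_def)
lemma cv_vscal: "cv i (vscal c v) = sc c (cv i v)"
  by (rule alg_eqI) (simp add: ent_cv ent_simps vscal_def)
lemma cv_0: "cv i (\<lambda>_. 0) = 0"
  by (rule alg_eqI) (simp add: ent_cv ent_simps)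
lemma cv_vact: "cv i (vact i (ent a) v) = a * cv i v"
  by (rule alg_eqI) (auto simp: ent_cv ent_simps vact_def intro!: sum.cong sum.neutral)
lemma cv_inj: assumes "v \<in> Vset i" "w \<in> Vset i" "cv i v = cv i w" shows "v = w"
proof
  fix r
  show "v r = w r"
  proof (cases "r < adim i")
    case True
    have "ent (cv i v) i r 0 = ent (cv i w) i r 0" using assms(3) by simp
    then show ?thesis using True by (simp add: ent_cv)
  next
    case False
    then show ?thesis using assms(1,2) by (simp add: Vset_def)
  qed
qed
lemma cv_ANset: "i < N \<Longrightarrow> cv i v \<in> ANset N" by (auto simp: ANset_iff ent_cv)
lemma vact_Vset: "vact i a v \<in> Vset i" by (simp add: Vset_def vact_def)

context full_order begin

definition lsub :: "'a alg set \<Rightarrow> bool" where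
  "lsub X \<longleftrightarrow> X \<subseteq> ANset N \<and> 0 \<in> X \<and> (\<forall>x\<in>X. \<forall>y\<in>X. x + y \<in> X) \<and> (\<forall>a\<in>L. \<forall>x\<in>X. a * x \<in> X)"

lemma lsubD: assumes "lsub X"
  shows "x \<in> X \<Longrightarrow> x \<in> ANset N" "0 \<in> X" "x \<in> X \<Longrightarrow> y \<in> X \<Longrightarrow> x + y \<in> X" "a \<in> L \<Longrightarrow> x \<in> X \<Longrightarrow> a * x \<in> X"
  using assms by (auto simp: lsub_def)

lemma lsub_osub: assumes X: "lsub X" shows "osub X"
proof -
  have "sc a x \<in> X" if "a \<in> Ov" "x \<in> X" for a x
  proof -
    have "sc a (idn N) * x \<in> X" using that Lone by (intro lsubD(4)[OF X]) auto
    then show ?thesis using lsubD(1)[OF X that(2)] by (simp add: idn_mult)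
  qed
  then show ?thesis using X by (auto simp: osub_def lsub_def)
qed

text \<open>Vectors from distinct layers of a chain reaching down to \<open>pu\<close> times its top
  are independent over the whole field. Divide a relation by a coefficient of minimal valuation.
  Among the terms whose coefficient is now a unit, take the one in the highest layer: all other
  terms lie at least one layer deeper, so this one would too.\<close>

lemma chain_indep:
  assumes lsub: "\<And>i. i \<le> n \<Longrightarrow> lsub (X i)" and dec: "\<And>i j. i \<le> j \<Longrightarrow> j \<le> n \<Longrightarrow> X j \<subseteq> X i"
    and pX: "\<And>x. x \<in> X 0 \<Longrightarrow> sc pu x \<in> X n"
    and fin: "finite I" and t: "inj_on t I" "\<And>r. r \<in> I \<Longrightarrow> t r < n"
    and w: "\<And>r. r \<in> I \<Longrightarrow> w r \<in> X (t r)" "\<And>r. r \<in> I \<Longrightarrow> w r \<notin> X (Suc (t r))"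
    and sum: "(\<Sum>r\<in>I. sc (c r) (w r)) = 0"
  shows "\<forall>r\<in>I. c r = 0"
proof (rule ccontr)
  assume "\<not> (\<forall>r\<in>I. c r = 0)"
  then have "{r\<in>I. c r \<noteq> 0} \<noteq> {}" by auto
  moreover have "finite {r\<in>I. c r \<noteq> 0}" using fin by simp
  ultimately have "\<exists>i\<in>{r\<in>I. c r \<noteq> 0}. \<forall>j\<in>{r\<in>I. c r \<noteq> 0}. c j * inverse (c i) \<in> Ov"
    by (intro min_valuation) simp_all
  then obtain i where i: "i \<in> I" "c i \<noteq> 0" "\<forall>j\<in>{r\<in>I. c r \<noteq> 0}. c j * inverse (c i) \<in> Ov" by blast
  define d where "d j = c j * inverse (c i)" for j
  have dO: "d j \<in> Ov" if "j \<in> I" for j using i(3) that by (cases "c j = 0") (auto simp: d_def)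
  \<comment> \<open>The indices with unit coefficient; \<open>i\<close> is among them because its
    own coefficient has become 1.\<close>
  define U where "U = {r\<in>I. d r \<notin> piO Ov pu 1}"
  have "i \<in> U" using i one_notin_piO by (simp add: U_def d_def)
  have "finite U" using fin by (simp add: U_def)
  then have "Min (t ` U) \<in> t ` U" using \<open>i \<in> U\<close> by (intro Min_in) auto
  then obtain r where r: "r \<in> U" "t r = Min (t ` U)" by (metis imageE)
  then have r: "r \<in> U" "\<forall>j\<in>U. t r \<le> t j" using \<open>finite U\<close> by simp_all
  have rI: "r \<in> I" and ru: "d r \<notin> piO Ov pu 1" using r by (auto simp: U_def)
  have inv: "inverse (d r) \<in> Ov" "d r \<noteq> 0" using O_unit[OF dO[OF rI] ru] ru piO_closed(1) by metis+
  have Xr: "lsub (X (Suc (t r)))" using lsub t(2)[OF rI] by simp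
  note oX = lsub_osub[OF Xr]
  have mem: "sc (d j) (w j) \<in> X (Suc (t r))" if j: "j \<in> I - {r}" for j
  proof (cases "j \<in> U")
    case True
    then have "t r < t j" using r(2) j rI t(1) by (metis DiffE inj_onD insertCI le_neq_implies_less)
    then have "w j \<in> X (Suc (t r))" using w(1)[of j] dec[of "Suc (t r)" "t j"] t(2)[of j] j by auto
    then show ?thesis using dO j by (intro osubD(3)[OF oX]) auto
  next
    case False
    then obtain y where y: "y \<in> Ov" "d j = pu * y" using j by (auto simp: U_def piO_def)
    have "w j \<in> X 0" using w(1)[of j] dec[of 0 "t j"] t(2)[of j] j by auto
    then have "sc pu (w j) \<in> X (Suc (t r))" using pX dec[of "Suc (t r)" n] t(2)[OF rI] by auto
    then have "sc y (sc pu (w j)) \<in> X (Suc (t r))" using osubD(3)[OF oX y(1)] by blast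
    then show ?thesis using y by (simp add: mult.commute)
  qed
  have "(\<Sum>j\<in>I. sc (d j) (w j)) = sc (inverse (c i)) (\<Sum>r\<in>I. sc (c r) (w r))"
    by (simp add: sc_sum d_def mult.commute)
  then have "(\<Sum>j\<in>I. sc (d j) (w j)) = 0" using sum by simp
  moreover have "(\<Sum>j\<in>I. sc (d j) (w j)) = sc (d r) (w r) + (\<Sum>j\<in>I - {r}. sc (d j) (w j))"
    using fin rI by (rule sum.remove)
  ultimately have eq: "sc (d r) (w r) = - (\<Sum>j\<in>I - {r}. sc (d j) (w j))" by (simp add: eq_neg_iff_add_eq_0)
  have "- (\<Sum>j\<in>I - {r}. sc (d j) (w j)) \<in> X (Suc (t r))"
    using mem by (intro osubD(4)[OF oX] osub_sum[OF oX]) auto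
  then have "sc (inverse (d r)) (sc (d r) (w r)) \<in> X (Suc (t r))"
    unfolding eq using inv by (intro osubD(3)[OF oX]) auto
  then show False using w(2)[OF rI] inv by simp
qed

end

context quiver_presentation begin

text \<open>Arrows are nilpotent modulo \<open>pu\<close>, so they act as zero on a simple factor
  \<open>X / Y\<close>. The kernel of each idempotent on the factor is then a submodule, hence zero
  or everything, and exactly one idempotent survives.\<close>

lemma simple_vertex:
  assumes X: "lsub X" and Y: "lsub Y" and YX: "Y \<subset> X" and pX: "\<And>x. x \<in> X \<Longrightarrow> sc pu x \<in> Y"
    and simple: "\<And>Z. lsub Z \<Longrightarrow> Y \<subseteq> Z \<Longrightarrow> Z \<subseteq> X \<Longrightarrow> Z = Y \<or> Z = X"
  shows "\<exists>e\<in>{e1,e2,e3}. (\<forall>v\<in>X. e * v - v \<in> Y) \<and> (\<forall>f\<in>{e1,e2,e3} - {e}. \<forall>v\<in>X. f * v \<in> Y)"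
proof -
  let ?A = "{b,g,d,h,k,l}" and ?E = "{e1,e2,e3}"
  note oX = lsub_osub[OF X] and oY = lsub_osub[OF Y]
  have YX': "x \<in> Y \<Longrightarrow> x \<in> X" for x using YX by blast
  have AL: "a \<in> ?A \<Longrightarrow> a \<in> L" and EL: "a \<in> ?E \<Longrightarrow> a \<in> L" for a by auto
  define Z where "Z = {v \<in> X. \<forall>a\<in>?A. a * v \<in> Y}"
  have ae: "a * e = a \<or> a * e = 0" if "a \<in> ?A" "e \<in> ?E" for a e using that by auto
  have "L \<subseteq> {y \<in> L. \<forall>v\<in>Z. y * v \<in> Z}" (is "_ \<subseteq> ?S")
  proof (rule gen)
    show "osub ?S" unfolding osub_def Z_def
      using lsubD(2,3)[OF X] lsubD(2,3)[OF Y] osubD(3)[OF oX] osubD(3)[OF oY] by (auto simp: distrib_right distrib_left)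
    show "x * y \<in> ?S" if "x \<in> ?S" "y \<in> ?S" for x y using that by (auto simp: mult.assoc)
    show "sc pu x \<in> ?S" if x: "x \<in> L" for x
    proof -
      have "a * (x * v) \<in> X" if "a \<in> L" "v \<in> X" for a v using that x lsubD(4)[OF X] by blast
      then show ?thesis unfolding Z_def using x AL osubD(3)[OF oX] lsubD(4)[OF X] pX by auto
    qed
    show "{e1, e2, e3, b, g, d, h, k, l} \<subseteq> ?S"
    proof
      fix x assume "x \<in> {e1, e2, e3, b, g, d, h, k, l}"
      then consider "x \<in> ?E" | "x \<in> ?A" by blast
      then show "x \<in> ?S"
      proof cases
        case 1
        have "x * v \<in> Z" if v: "v \<in> Z" for v
        proof -
          have vX: "v \<in> X" and vA: "a \<in> ?A \<Longrightarrow> a * v \<in> Y" for a using v by (auto simp: Z_def)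
          have "x * v \<in> X" using vX EL[OF 1] lsubD(4)[OF X] by blast
          moreover have "a * (x * v) \<in> Y" if a: "a \<in> ?A" for a
          proof -
            have "a * (x * v) = a * x * v" by (simp add: mult.assoc)
            then show ?thesis using ae[OF a 1] vA[OF a] lsubD(2)[OF Y] by auto
          qed
          ultimately show ?thesis by (simp add: Z_def)
        qed
        then show ?thesis using EL[OF 1] by blast
      next
        case 2
        have "x * v \<in> Z" if v: "v \<in> Z" for v
        proof -
          have xv: "x * v \<in> Y" using v 2 by (auto simp: Z_def)
          have "a * (x * v) \<in> Y" if "a \<in> ?A" for a using xv AL[OF that] lsubD(4)[OF Y] by blast
          then show ?thesis using YX'[OF xv] by (simp add: Z_def)
        qed
        then show ?thesis using AL[OF 2] by blast
      qed
    qed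
  qed
  then have Zst: "y \<in> L \<Longrightarrow> v \<in> Z \<Longrightarrow> y * v \<in> Z" for y v by blast
  have lZ: "lsub Z" unfolding lsub_def
    using Zst lsubD[OF X] lsubD(2,3)[OF Y] by (auto simp: Z_def distrib_left)
  have YZ: "Y \<subseteq> Z" unfolding Z_def using YX' AL lsubD(4)[OF Y] by blast
  \<comment> \<open>Otherwise arrows could be applied to a vector outside \<open>Y\<close>
    indefinitely without entering \<open>Y\<close>. A word of \<open>2 * c + 1\<close> arrows lies
    in \<open>pu L\<close>, however, and \<open>pu L\<close> maps \<open>X\<close> into
    \<open>Y\<close>.\<close>
  have "Z \<noteq> Y"
  proof
    assume ZY: "Z = Y"
    obtain v where v: "v \<in> X" "v \<notin> Y" using YX by blast
    have "\<exists>x. arrow_word m x \<and> x * v \<notin> Y" for m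
    proof (induction m)
      case 0
      have "idn N * v = v" using lsubD(1)[OF X v(1)] by (rule idn_mult)
      then show ?case using v arrow_word_0 by metis
    next
      case (Suc m)
      then obtain x where x: "arrow_word m x" "x * v \<notin> Y" by blast
      have "x \<in> L" using arrow_word_W[OF x(1)] W_L by blast
      then have "x * v \<in> X" using v lsubD(4)[OF X] by blast
      then obtain a where a: "a \<in> ?A" "a * (x * v) \<notin> Y" using x(2) ZY unfolding Z_def by blast
      then show ?case using arrow_word_left[OF x(1) a(1)] by (auto simp: mult.assoc)
    qed
    then obtain x where x: "arrow_word (Suc (2 * c)) x" "x * v \<notin> Y" by blast
    obtain z where z: "z \<in> L" "x = sc pu z" using arrow_word_long[OF x(1)] by auto
    have "z * v \<in> X" using z v lsubD(4)[OF X] by blast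
    then show False using pX z x(2) by auto
  qed
  then have ZX: "Z = X" using simple[OF lZ YZ] by (auto simp: Z_def)
  then have aX: "a \<in> ?A \<Longrightarrow> v \<in> X \<Longrightarrow> a * v \<in> Y" for a v by (auto simp: Z_def)
  \<comment> \<open>The preimage in \<open>X\<close> of the kernel of \<open>e\<close> on
    \<open>X / Y\<close>. It is a submodule because the arrows already act as zero and the other
    idempotents are orthogonal to \<open>e\<close>.\<close>
  define R where "R e = {v \<in> X. e * v \<in> Y}" for e
  have R: "R e = Y \<or> R e = X" if e: "e \<in> ?E" for e
  proof -
    have ea: "e * a = a \<or> e * a = 0" if "a \<in> ?A" for a using e that by auto
    have ee: "e * f = f \<or> e * f = 0" if "f \<in> ?E" for f using e that by auto
    have "L \<subseteq> {y \<in> L. \<forall>v\<in>R e. y * v \<in> R e}" (is "_ \<subseteq> ?S")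
    proof (rule gen)
      show "osub ?S" unfolding osub_def R_def
        using lsubD(2,3)[OF X] lsubD(2,3)[OF Y] osubD(3)[OF oX] osubD(3)[OF oY] by (auto simp: distrib_right distrib_left)
      show "x * y \<in> ?S" if "x \<in> ?S" "y \<in> ?S" for x y using that by (auto simp: mult.assoc)
      show "sc pu x \<in> ?S" if x: "x \<in> L" for x
      proof -
        have "a * (x * v) \<in> X" if "a \<in> L" "v \<in> X" for a v using that x lsubD(4)[OF X] by blast
        then show ?thesis unfolding R_def using x EL[OF e] osubD(3)[OF oX] lsubD(4)[OF X] pX by auto
      qed
      show "{e1, e2, e3, b, g, d, h, k, l} \<subseteq> ?S"
      proof
        fix x assume "x \<in> {e1, e2, e3, b, g, d, h, k, l}"
        then have x: "x \<in> ?E \<or> x \<in> ?A" and xL: "x \<in> L" by auto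
        have "x * v \<in> R e" if v: "v \<in> R e" for v
        proof -
          have vX: "v \<in> X" and evY: "e * v \<in> Y" using v by (auto simp: R_def)
          have "e * x = 0 \<or> x \<in> ?A \<or> x = e" using x e by auto
          then have "e * x * v \<in> Y"
          proof (elim disjE)
            assume "x \<in> ?A"
            then show ?thesis using aX[of x v] ea[of x] lsubD(2)[OF Y] vX by auto
          next
            assume "x = e"
            then show ?thesis using evY e by auto
          qed (use lsubD(2)[OF Y] in simp)
          then show ?thesis using lsubD(4)[OF X xL vX] by (simp add: R_def mult.assoc)
        qed
        then show "x \<in> ?S" using xL by blast
      qed
    qed
    then have st: "y \<in> L \<Longrightarrow> v \<in> R e \<Longrightarrow> y * v \<in> R e" for y v by blast
    have "lsub (R e)" unfolding lsub_def
      using st lsubD[OF X] lsubD(2,3)[OF Y] by (auto simp: R_def distrib_left)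
    moreover have "Y \<subseteq> R e" "R e \<subseteq> X" unfolding R_def using YX' EL[OF e] lsubD(4)[OF Y] by auto
    ultimately show ?thesis using simple by blast
  qed
  obtain v where v: "v \<in> X" "v \<notin> Y" using YX by blast
  have dec: "x = e1 * x + e2 * x + e3 * x" if "x \<in> X" for x
    using idn_mult(1)[OF lsubD(1)[OF X that]] by (simp flip: distrib_right add: e_sum)
  have "\<exists>e\<in>?E. e * v \<notin> Y"
  proof (rule ccontr)
    assume "\<not> ?thesis"
    then have "e1 * v + e2 * v + e3 * v \<in> Y" by (intro lsubD(3)[OF Y]) auto
    then show False using dec[OF v(1)] v(2) by simp
  qed
  then obtain e where e: "e \<in> ?E" "e * v \<notin> Y" by blast
  have "R e \<noteq> X" using e v by (auto simp: R_def)
  then have Re: "R e = Y" using R[OF e(1)] by blast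
  have eid: "e * e = e" using e by auto
  have 1: "e * u - u \<in> Y" if u: "u \<in> X" for u
  proof -
    have "e * u \<in> X" using u EL[OF e(1)] lsubD(4)[OF X] by blast
    then have "e * u - u \<in> X" using u by (intro osubD(5)[OF oX])
    moreover have "e * (e * u - u) = 0" by (simp add: right_diff_distrib eid flip: mult.assoc)
    ultimately have "e * u - u \<in> R e" using lsubD(2)[OF Y] by (simp add: R_def)
    then show ?thesis using Re by simp
  qed
  have 2: "f * u \<in> Y" if f: "f \<in> ?E - {e}" and u: "u \<in> X" for f u
  proof -
    have "f * e = 0" using f e by auto
    then have "f * (u - e * u) = f * u" by (simp add: right_diff_distrib flip: mult.assoc)
    moreover have "- (e * u - u) \<in> Y" using 1[OF u] by (rule osubD(4)[OF oY])
    then have "u - e * u \<in> Y" by simp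
    then have "f * (u - e * u) \<in> Y" using f EL lsubD(4)[OF Y] by blast
    ultimately show ?thesis by simp
  qed
  show ?thesis using 1 2 e(1) by blast
qed

end

context full_order begin

lemma submod_lsub:
  assumes "i < N" "submod (ent ` L) i X" "X \<subseteq> Vset i"
  shows "lsub (cv i ` X)"
  unfolding lsub_def
proof (intro conjI ballI)
  show "cv i ` X \<subseteq> ANset N" using cv_ANset[OF assms(1)] by blast
  show "0 \<in> cv i ` X" using assms(2) by (intro image_eqI[of _ _ "\<lambda>_. 0"]) (auto simp: cv_0 submod_def)
  show "x + y \<in> cv i ` X" if "x \<in> cv i ` X" "y \<in> cv i ` X" for x y
    using that assms(2) by (auto simp: submod_def simp flip: cv_vadd)
  show "a * x \<in> cv i ` X" if "a \<in> L" "x \<in> cv i ` X" for a x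
    using that assms(2) by (auto simp: submod_def simp flip: cv_vact)
qed

lemma lsub_submod:
  assumes "lsub Z" "Z \<subseteq> cv i ` Vset i"
  shows "submod (ent ` L) i {v \<in> Vset i. cv i v \<in> Z}" "Z = cv i ` {v \<in> Vset i. cv i v \<in> Z}"
proof -
  show "Z = cv i ` {v \<in> Vset i. cv i v \<in> Z}" using assms(2) by auto
  show "submod (ent ` L) i {v \<in> Vset i. cv i v \<in> Z}"
    unfolding submod_def using lsubD[OF assms(1)]
    by (auto simp: cv_0 cv_vadd cv_vact vact_Vset) (auto simp: Vset_def vadd_def)
qed

end

section \<open>Simultaneous diagonalisation of the lifted vertices\<close>

context quiver_presentation begin

text \<open>Each diagonal place of component \<open>i\<close> is matched with the unique composition
  factor carrying its label, and a vector fixed by the idempotent of that factor is taken from its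
  layer. By \<open>chain_indep\<close> these vectors are the columns of an invertible matrix
  \<open>U\<close>, and they are common eigenvectors of the idempotents.\<close>

lemma adapted_basis:
  assumes D: "has_decomp_matrix N Ov pu (ent ` L) D0" and N3: "3 \<le> N"
  shows "\<exists>U V gg. U \<in> ANset N \<and> V \<in> ANset N \<and> U * V = idn N \<and> V * U = idn N \<and>
    (\<forall>j<3. gg j \<in> {e1,e2,e3}) \<and>
    (\<forall>e\<in>{e1,e2,e3}. V * e * U = (\<Sum>j<3. if gg j = e then eps N j else 0))"
proof -
  let ?E = "{e1,e2,e3}"
  have EL: "e \<in> L" and EE: "e * e = e" if "e \<in> ?E" for e using that by auto
  have E0: "e * f = 0" if "e \<in> ?E" "f \<in> ?E" "e \<noteq> f" for e f using that by auto
  from D[unfolded has_decomp_matrix_def] obtain M Ms and lab :: "nat \<Rightarrow> nat \<Rightarrow> nat" where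
    DD: "\<forall>i<N. full_lattice Ov (ent ` L) i (M i) \<and> comp_series (ent ` L) pu i (M i) (Ms i)"
    "\<forall>i<N. \<forall>t. \<forall>i'<N. \<forall>t'. Suc t < length (Ms i) \<longrightarrow> Suc t' < length (Ms i') \<longrightarrow>
        (sq_iso (ent ` L) i (Ms i ! t) (Ms i ! Suc t) i' (Ms i' ! t') (Ms i' ! Suc t') \<longleftrightarrow> lab i t = lab i' t')"
    "\<forall>i<N. \<forall>j<3. card {t. Suc t < length (Ms i) \<and> lab i t = j} = D0 i j"
    by (elim exE conjE) (rule that)
  have latt: "full_lattice Ov (ent ` L) i (M i)" and
    ser: "comp_series (ent ` L) pu i (M i) (Ms i)" if "i < N" for i using DD(1) that by simp_all
  have iso: "sq_iso (ent ` L) i (Ms i ! t) (Ms i ! Suc t) i' (Ms i' ! t') (Ms i' ! Suc t') \<longleftrightarrow> lab i t = lab i' t'"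
    if "i < N" "i' < N" "Suc t < length (Ms i)" "Suc t' < length (Ms i')" for i t i' t' using DD(2) that by simp
  have cnt: "card {t. Suc t < length (Ms i) \<and> lab i t = j} = D0 i j" if "i < N" "j < 3" for i j
    using DD(3) that by simp
  define n where "n i = length (Ms i) - 1" for i
  define X where "X i t = cv i ` (Ms i ! t)" for i t
  have lt_n: "Suc t < length (Ms i) \<longleftrightarrow> t < n i" for i t by (auto simp: n_def)
  have ne: "Ms i \<noteq> []" and Ms0: "Ms i ! 0 = M i" and Msn: "Ms i ! n i = {vscal pu v | v. v \<in> M i}"
    and sub: "\<And>t. t \<le> n i \<Longrightarrow> submod (ent ` L) i (Ms i ! t)"
    and Mstep: "\<And>t. t < n i \<Longrightarrow> Ms i ! Suc t \<subset> Ms i ! t"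
    and simple: "\<And>t Z. t < n i \<Longrightarrow> submod (ent ` L) i Z \<Longrightarrow> Ms i ! Suc t \<subseteq> Z \<Longrightarrow> Z \<subseteq> Ms i ! t \<Longrightarrow> Z = Ms i ! Suc t \<or> Z = Ms i ! t"
    if i: "i < N" for i
  proof -
    have s: "Ms i \<noteq> []" "Ms i ! 0 = M i" "last (Ms i) = {vscal pu v | v. v \<in> M i}" 
      "\<forall>t<length (Ms i). submod (ent ` L) i (Ms i ! t)"
      "\<forall>t. Suc t < length (Ms i) \<longrightarrow> Ms i ! Suc t \<subset> Ms i ! t \<and>
        (\<forall>Z. submod (ent ` L) i Z \<and> Ms i ! Suc t \<subseteq> Z \<and> Z \<subseteq> Ms i ! t \<longrightarrow> Z = Ms i ! Suc t \<or> Z = Ms i ! t)"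
      using ser[OF i] unfolding comp_series_def by simp_all
    show "Ms i \<noteq> []" "Ms i ! 0 = M i" using s by simp_all
    show "Ms i ! n i = {vscal pu v | v. v \<in> M i}" using s by (simp add: last_conv_nth n_def)
    show "submod (ent ` L) i (Ms i ! t)" if "t \<le> n i" for t
    proof -
      have "t < length (Ms i)" using that s(1) by (cases "Ms i") (auto simp: n_def)
      then show ?thesis using s(4) by blast
    qed
    show "Ms i ! Suc t \<subset> Ms i ! t" if "t < n i" for t using s(5) that lt_n by blast
    show "Z = Ms i ! Suc t \<or> Z = Ms i ! t" if "t < n i" "submod (ent ` L) i Z" "Ms i ! Suc t \<subseteq> Z" "Z \<subseteq> Ms i ! t" for t Z
      using s(5) that lt_n by blast
  qed
  have MV: "M i \<subseteq> Vset i" if i: "i < N" for i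
  proof -
    obtain m g' where g': "\<forall>j<m. g' j \<in> Vset i" "M i = {vsum m (\<lambda>j. vscal (c j) (g' j)) | c. \<forall>j<m. c j \<in> Ov}"
      using latt[OF i] unfolding full_lattice_def by blast
    show ?thesis unfolding g'(2) using g'(1) by (auto simp: Vset_def vsum_def vscal_def)
  qed
  have Msdec: "t \<le> t' \<Longrightarrow> t' \<le> n i \<Longrightarrow> Ms i ! t' \<subseteq> Ms i ! t" if i: "i < N" for i t t'
  proof (induction t' rule: dec_induct)
    case (step m)
    then show ?case using Mstep[OF i, of m] by auto
  qed auto
  have MsV: "Ms i ! t \<subseteq> Vset i" if i: "i < N" and t: "t \<le> n i" for i t
    using Msdec[OF i, of 0 t] t MV[OF i] Ms0[OF i] by auto
  have Xlsub: "lsub (X i t)" if i: "i < N" and t: "t \<le> n i" for i t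
    unfolding X_def by (rule submod_lsub[OF i sub[OF i t] MsV[OF i t]])
  have Xdec: "X i t' \<subseteq> X i t" if "i < N" "t \<le> t'" "t' \<le> n i" for i t t'
    unfolding X_def using Msdec[OF that(1) that(2) that(3)] by blast
  have XpX: "sc pu x \<in> X i (n i)" if "i < N" "x \<in> X i 0" for i x
    using that Ms0[OF that(1)] Msn[OF that(1)] unfolding X_def by (auto simp flip: cv_vscal)
  have Xiff: "cv i v \<in> X i t \<longleftrightarrow> v \<in> Ms i ! t" if "i < N" "t \<le> n i" "v \<in> Vset i" for i t v
    unfolding X_def using cv_inj[OF that(3)] MsV[OF that(1,2)] by blast
  have Xstep: "X i (Suc t) \<subset> X i t" if i: "i < N" and t: "t < n i" for i t
  proof -
    obtain v where v: "v \<in> Ms i ! t" "v \<notin> Ms i ! Suc t" using Mstep[OF i t] by blast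
    have vV: "v \<in> Vset i" using v(1) MsV[OF i, of t] t by auto
    have "cv i v \<in> X i t" "cv i v \<notin> X i (Suc t)" using Xiff[OF i _ vV] v t by auto
    then show ?thesis using Xdec[OF i, of t "Suc t"] t by auto
  qed
  have Xsimple: "Z = X i (Suc t) \<or> Z = X i t" if i: "i < N" and t: "t < n i" and Z: "lsub Z" "X i (Suc t) \<subseteq> Z" "Z \<subseteq> X i t" for i t Z
  proof -
    have "Z \<subseteq> cv i ` Vset i" using Z(3) MsV[OF i, of t] t by (auto simp: X_def)
    note Z' = lsub_submod[OF Z(1) this]
    let ?Z = "{v \<in> Vset i. cv i v \<in> Z}"
    have "Ms i ! Suc t \<subseteq> ?Z" using Z(2) MsV[OF i, of "Suc t"] t by (auto simp: X_def)
    moreover have "?Z \<subseteq> Ms i ! t" using Z(3) Xiff[OF i, of t] t by auto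
    ultimately have "?Z = Ms i ! Suc t \<or> ?Z = Ms i ! t" using simple[OF i t Z'(1)] by blast
    then show ?thesis
    proof (elim disjE)
      assume a: "?Z = Ms i ! Suc t"
      show ?thesis using Z'(2) unfolding a X_def by (rule disjI1)
    next
      assume a: "?Z = Ms i ! t"
      show ?thesis using Z'(2) unfolding a X_def by (rule disjI2)
    qed
  qed
  \<comment> \<open>\<open>e\<close> acts as the identity on the factor at position \<open>t\<close>
    of component \<open>i\<close>, and the other two idempotents act as zero.\<close>
  define vx where "vx i t e \<longleftrightarrow> e \<in> ?E \<and> (\<forall>v\<in>X i t. e * v - v \<in> X i (Suc t)) \<and> (\<forall>f\<in>?E - {e}. \<forall>v\<in>X i t. f * v \<in> X i (Suc t))" for i t e
  have vx_ex: "\<exists>e. vx i t e" if i: "i < N" and t: "t < n i" for i t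
  proof -
    have "\<exists>e\<in>?E. (\<forall>v\<in>X i t. e * v - v \<in> X i (Suc t)) \<and> (\<forall>f\<in>?E - {e}. \<forall>v\<in>X i t. f * v \<in> X i (Suc t))"
    proof (rule simple_vertex)
      show "lsub (X i t)" "lsub (X i (Suc t))" using Xlsub[OF i] t by auto
      show "X i (Suc t) \<subset> X i t" by (rule Xstep[OF i t])
      show "sc pu x \<in> X i (Suc t)" if "x \<in> X i t" for x
        using that XpX[OF i] Xdec[OF i, of 0 t] Xdec[OF i, of "Suc t" "n i"] t by auto
      show "Z = X i (Suc t) \<or> Z = X i t" if "lsub Z" "X i (Suc t) \<subseteq> Z" "Z \<subseteq> X i t" for Z
        using Xsimple[OF i t that] .
    qed
    then show ?thesis unfolding vx_def by blast
  qed
  \<comment> \<open>Equal labels mean isomorphic factors, also across different components, and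
    isomorphic factors select the same idempotent. Hence the idempotent depends on the label
    alone.\<close>
  have vx_unique: "e = e'" if i: "i < N" "t < n i" and i': "i' < N" "t' < n i'" and l: "lab i t = lab i' t'"
    and v: "vx i t e" "vx i' t' e'" for i t i' t' e e'
  proof (rule ccontr)
    assume "e \<noteq> e'"
    then have eE: "e \<in> ?E - {e'}" "e \<in> L" using v EL[of e] by (auto simp: vx_def)
    have "sq_iso (ent ` L) i (Ms i ! t) (Ms i ! Suc t) i' (Ms i' ! t') (Ms i' ! Suc t')"
      using iso[OF i(1) i'(1)] i i' l lt_n by blast
    then obtain f where f: "\<forall>x\<in>Ms i ! t. f x \<in> Ms i' ! t'"
      "\<forall>a\<in>ent ` L. \<forall>x\<in>Ms i ! t. vsub (f (vact i a x)) (vact i' a (f x)) \<in> Ms i' ! Suc t'"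
      "\<forall>x\<in>Ms i ! t. f x \<in> Ms i' ! Suc t' \<longleftrightarrow> x \<in> Ms i ! Suc t"
      unfolding sq_iso_def by blast
    obtain x where x: "x \<in> Ms i ! t" "x \<notin> Ms i ! Suc t" using Mstep[OF i] by blast
    have xV: "x \<in> Vset i" using x(1) MsV[OF i(1), of t] i(2) by auto
    have fxV: "f x \<in> Vset i'" using f(1) x(1) MsV[OF i'(1), of t'] i'(2) by auto
    let ?y = "vact i (ent e) x"
    have lX: "lsub (X i (Suc t))" and lX': "lsub (X i' (Suc t'))" using Xlsub i i' by auto
    have "cv i x \<in> X i t" using x(1) by (auto simp: X_def)
    then have "cv i ?y - cv i x \<in> X i (Suc t)" using v(1) by (simp add: vx_def cv_vact)
    moreover have "cv i x \<notin> X i (Suc t)" using Xiff[OF i(1) _ xV] x i(2) by simp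
    ultimately have "cv i ?y \<notin> X i (Suc t)" using osubD(5)[OF lsub_osub[OF lX], of "cv i ?y" "cv i ?y - cv i x"] by auto
    then have y1: "?y \<notin> Ms i ! Suc t" by (auto simp: X_def)
    have y0: "?y \<in> Ms i ! t" using sub[OF i(1), of t] i(2) x(1) eE(2) by (auto simp: submod_def)
    have "cv i' (f x) \<in> X i' t'" using f(1) x(1) by (auto simp: X_def)
    then have 1: "cv i' (vact i' (ent e) (f x)) \<in> X i' (Suc t')" using v(2) eE by (simp add: vx_def cv_vact)
    have "vsub (f ?y) (vact i' (ent e) (f x)) \<in> Ms i' ! Suc t'" using f(2) eE(2) x(1) by blast
    then have "cv i' (vsub (f ?y) (vact i' (ent e) (f x))) \<in> X i' (Suc t')" by (auto simp: X_def)
    then have "cv i' (f ?y) - cv i' (vact i' (ent e) (f x)) \<in> X i' (Suc t')" by (simp add: cv_vsub)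
    from lsubD(3)[OF lX' this 1] have "cv i' (f ?y) \<in> X i' (Suc t')" by simp
    moreover have "f ?y \<in> Vset i'" using f(1) y0 MsV[OF i'(1), of t'] i'(2) by auto
    ultimately have "f ?y \<in> Ms i' ! Suc t'" using Xiff[OF i'(1)] i'(2) by simp
    then have "?y \<in> Ms i ! Suc t" using f(3) y0 by blast
    then show False using y1 by simp
  qed
  \<comment> \<open>By \<open>vx_unique\<close> the choice is forced for every label that
    occurs.\<close>
  define gg where "gg j = (SOME e. \<exists>i t. i < N \<and> t < n i \<and> lab i t = j \<and> vx i t e)" for j
  have gg: "vx i t (gg (lab i t))" if i: "i < N" and t: "t < n i" for i t
  proof -
    obtain e where e: "vx i t e" using vx_ex[OF i t] by blast
    then have "\<exists>i' t'. i' < N \<and> t' < n i' \<and> lab i' t' = lab i t \<and> vx i' t' (gg (lab i t))"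
      unfolding gg_def using i t by (intro someI[of "\<lambda>e. \<exists>i' t'. i' < N \<and> t' < n i' \<and> lab i' t' = lab i t \<and> vx i' t' e" e]) blast
    then obtain i' t' where "i' < N" "t' < n i'" "lab i' t' = lab i t" "vx i' t' (gg (lab i t))" by blast
    then show ?thesis using vx_unique[OF i t, of i' t' e] e by metis
  qed
  \<comment> \<open>The decomposition matrix supplies the layer. Applying the idempotent to a vector
    of that layer changes it only by an element of the next layer, so the result is still outside
    the next layer and is now fixed.\<close>
  have "\<exists>t w. t < n i \<and> lab i t = lbl i r \<and> w \<in> X i t \<and> w \<notin> X i (Suc t) \<and> gg (lbl i r) * w = w"
    if i: "i < N" and r: "r < adim i" for i r
  proof -
    have "card {t. Suc t < length (Ms i) \<and> lab i t = lbl i r} = 1"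
      using cnt[OF i lbl_less[OF r]] D0_lbl[OF r] by simp
    then have "{t. Suc t < length (Ms i) \<and> lab i t = lbl i r} \<noteq> {}" by (metis card.empty zero_neq_one)
    then obtain t where t: "t < n i" "lab i t = lbl i r" using lt_n by auto
    obtain v where v: "v \<in> X i t" "v \<notin> X i (Suc t)" using Xstep[OF i t(1)] by blast
    let ?e = "gg (lbl i r)"
    have e: "?e \<in> ?E" "?e * v - v \<in> X i (Suc t)" using gg[OF i t(1)] v t by (auto simp: vx_def)
    have eL: "?e \<in> L" using e(1) by (rule EL)
    have lX: "lsub (X i (Suc t))" "lsub (X i t)" using Xlsub[OF i] t by auto
    have "?e * v \<in> X i t" using lsubD(4)[OF lX(2) eL v(1)] .
    moreover have "?e * v \<notin> X i (Suc t)"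
      using osubD(5)[OF lsub_osub[OF lX(1)] _ e(2), of "?e * v"] v(2) by auto
    moreover have "?e * ?e = ?e" using e(1) by (rule EE)
    then have "?e * (?e * v) = ?e * v" by (simp flip: mult.assoc)
    ultimately show ?thesis using t by blast
  qed
  then have "\<forall>i r. \<exists>t w. i < N \<longrightarrow> r < adim i \<longrightarrow> t < n i \<and> lab i t = lbl i r \<and> w \<in> X i t \<and> w \<notin> X i (Suc t) \<and> gg (lbl i r) * w = w"
    by blast
  then obtain tt w where tw: "\<And>i r. i < N \<Longrightarrow> r < adim i \<Longrightarrow> tt i r < n i \<and> lab i (tt i r) = lbl i r \<and> 
      w i r \<in> X i (tt i r) \<and> w i r \<notin> X i (Suc (tt i r)) \<and> gg (lbl i r) * w i r = w i r"
    unfolding choice_iff by blast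
  have wcv: "w i r \<in> cv i ` Vset i" if "i < N" "r < adim i" for i r
    using tw[OF that] MsV[OF that(1), of "tt i r"] by (auto simp: X_def)
  have went: "ent (w i r) j p q = 0" if "i < N" "r < adim i" "j \<noteq> i \<or> q \<noteq> 0" for i r j p q
    using wcv[OF that(1,2)] that(3) by (auto simp: ent_cv)
  have indep: "\<forall>s<adim i. z s = 0" if i: "i < N" and z: "\<forall>r<adim i. (\<Sum>s<adim i. ent (w i s) i r 0 * z s) = 0" for i z
  proof -
    have "(\<Sum>s\<in>{..<adim i}. sc (z s) (w i s)) = 0"
    proof (rule alg_eqI)
      fix j p q assume j: "p < adim j" "q < adim j"
      show "ent (\<Sum>s<adim i. sc (z s) (w i s)) j p q = ent 0 j p q"
      proof (cases "j = i \<and> q = 0")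
        case True
        then show ?thesis using z j by (simp add: ent_sum ent_simps mult.commute)
      next
        case False
        then show ?thesis using went[OF i] by (simp add: ent_sum ent_simps)
      qed
    qed
    moreover have "inj_on (tt i) {..<adim i}"
      using tw[OF i] lbl_inj by (intro inj_onI) (metis lessThan_iff)
    ultimately have "\<forall>s\<in>{..<adim i}. z s = 0"
      by (intro chain_indep[of "n i" "X i" "{..<adim i}" "tt i" "w i" z]) (use Xlsub Xdec XpX i tw in auto)
    then show ?thesis by simp
  qed
  have "\<exists>B. (\<forall>r<adim i. \<forall>s<adim i. (\<Sum>t<adim i. ent (w i t) i r 0 * B t s) = (if r = s then 1 else 0)) \<and>
      (\<forall>r<adim i. \<forall>s<adim i. (\<Sum>t<adim i. B r t * ent (w i s) i t 0) = (if r = s then 1 else 0))" if "i < N" for i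
    using square_system_inverse[of "adim i" "\<lambda>r s. ent (w i s) i r 0"] indep[OF that] by blast
  then have "\<forall>i. \<exists>B. i < N \<longrightarrow> (\<forall>r<adim i. \<forall>s<adim i. (\<Sum>t<adim i. ent (w i t) i r 0 * B t s) = (if r = s then 1 else 0)) \<and>
      (\<forall>r<adim i. \<forall>s<adim i. (\<Sum>t<adim i. B r t * ent (w i s) i t 0) = (if r = s then 1 else 0))" by blast
  then obtain B where B: "\<And>i r s. i < N \<Longrightarrow> r < adim i \<Longrightarrow> s < adim i \<Longrightarrow> (\<Sum>t<adim i. ent (w i t) i r 0 * B i t s) = (if r = s then 1 else 0)"
    "\<And>i r s. i < N \<Longrightarrow> r < adim i \<Longrightarrow> s < adim i \<Longrightarrow> (\<Sum>t<adim i. B i r t * ent (w i s) i t 0) = (if r = s then 1 else 0)"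
    unfolding choice_iff by blast
  define U where "U = Alg (\<lambda>i r s. if i < N \<and> r < adim i \<and> s < adim i then ent (w i s) i r 0 else 0)"
  define V where "V = Alg (\<lambda>i r s. if i < N \<and> r < adim i \<and> s < adim i then B i r s else 0)"
  have entU: "ent U i r s = (if i < N \<and> r < adim i \<and> s < adim i then ent (w i s) i r 0 else 0)" for i r s
    unfolding U_def by (subst Alg_inverse) auto
  have entV: "ent V i r s = (if i < N \<and> r < adim i \<and> s < adim i then B i r s else 0)" for i r s
    unfolding V_def by (subst Alg_inverse) auto
  have UA: "U \<in> ANset N" "V \<in> ANset N" by (auto simp: ANset_iff entU entV)
  have UV: "U * V = idn N"
  proof (rule alg_eqI)
    fix i r s assume "r < adim i" "s < adim i"
    then show "ent (U * V) i r s = ent (idn N) i r s"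
      using B(1)[of i r s] by (cases "i < N") (simp_all add: ent_simps ent_cen entU entV)
  qed
  have VU: "V * U = idn N"
  proof (rule alg_eqI)
    fix i r s assume "r < adim i" "s < adim i"
    then show "ent (V * U) i r s = ent (idn N) i r s"
      using B(2)[of i r s] by (cases "i < N") (simp_all add: ent_simps ent_cen entU entV)
  qed
  have eU: "e * U = U * (\<Sum>j<3. if gg j = e then eps N j else 0)" if e: "e \<in> ?E" for e
  proof (rule alg_eqI)
    fix i r s assume rs: "r < adim i" "s < adim i"
    show "ent (e * U) i r s = ent (U * (\<Sum>j<3. if gg j = e then eps N j else 0)) i r s"
    proof (cases "i < N")
      case True
      have 1: "ent (e * U) i r s = ent (e * w i s) i r 0"
        using True rs by (simp add: ent_simps entU)
      have gE: "gg (lbl i s) \<in> ?E" using gg[OF True] tw[OF True rs(2)] by (metis vx_def)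
      have 2: "e * w i s = (if gg (lbl i s) = e then w i s else 0)"
      proof (cases "gg (lbl i s) = e")
        case False
        then have "e * gg (lbl i s) = 0" using E0[OF e gE] by auto
        then have "e * (gg (lbl i s) * w i s) = 0" by (simp flip: mult.assoc)
        then show ?thesis using False tw[OF True rs(2)] by simp
      qed (use tw[OF True rs(2)] in simp)
      have 3: "ent (\<Sum>j<3. if gg j = e then eps N j else 0) i t s = (if t = s \<and> gg (lbl i s) = e then 1 else 0)" if "t < adim i" for t
      proof -
        have "ent (\<Sum>j<3. if gg j = e then eps N j else 0) i t s = (\<Sum>j<3. if j = lbl i s then (if t = s \<and> gg (lbl i s) = e then 1 else 0) else 0)"
          unfolding ent_sum using True that by (intro sum.cong) (auto simp: ent_eps ent_simps)
        then show ?thesis using lbl_less[OF rs(2)] by simp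
      qed
      have "ent (U * (\<Sum>j<3. if gg j = e then eps N j else 0)) i r s = (\<Sum>t<adim i. if t = s then (if gg (lbl i s) = e then ent U i r s else 0) else 0)"
        unfolding times_alg.rep_eq by (rule sum.cong[OF refl], subst 3) simp_all
      also have "\<dots> = (if gg (lbl i s) = e then ent (w i s) i r 0 else 0)" using rs True by (simp add: entU)
      finally show ?thesis unfolding 1 2 by (simp add: ent_simps)
    next
      case False
      then have "ent x i p q = 0" if "x \<in> ANset N" for x :: "'a alg" and p q using that by (simp add: ANset_iff)
      from this[OF ANset_closed(6)[OF UA(1)]] this[OF ANset_closed(5)[OF UA(1)]] show ?thesis by simp
    qed
  qed
  have "V * e * U = (\<Sum>j<3. if gg j = e then eps N j else 0)" if e: "e \<in> ?E" for e
  proof -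
    have "(\<Sum>j<3. if gg j = e then eps N j else 0 :: 'a alg) \<in> ANset N"
      by (rule ANset_sum) (auto simp: ANset_iff ent_eps ent_simps)
    then show ?thesis by (simp add: mult.assoc eU[OF e] idn_mult VU flip: mult.assoc[of V U])
  qed
  moreover have "gg j \<in> ?E" if "j < 3" for j
  proof -
    have j: "j < N" "0 < adim j" "lbl j 0 = j" using that N3 by (auto simp: lbl_def)
    then show ?thesis using gg[OF j(1)] tw[OF j(1,2)] by (metis vx_def)
  qed
  ultimately show ?thesis using UA UV VU by blast
qed

end

section \<open>Normal forms of orders\<close>

text \<open>The entries are the places whose row and column labels are the two ends of the arrow:
  labels 0 and 1 meet in components 3 and 4, labels 0 and 2 in components 3 and 5, labels 1 and 2 in
  component 3 and in all from 6 on.\<close>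

definition beta0 :: "'a::field alg" where "beta0 = mu 3 0 1 + mu 4 0 1"
definition kappa0 :: "'a::field alg" where "kappa0 = mu 3 0 2 + mu 5 0 1"
definition delta0 :: "nat \<Rightarrow> 'a::field alg" where
  "delta0 N = Alg (\<lambda>i r s. if i < N \<and> (i = 3 \<and> r = 1 \<and> s = 2 \<or> 6 \<le> i \<and> r = 0 \<and> s = 1) then 1 else 0)"

lemma ent_delta0: "ent (delta0 N) i r s = (if i < N \<and> (i = 3 \<and> r = 1 \<and> s = 2 \<or> 6 \<le> i \<and> r = 0 \<and> s = 1) then 1 else 0)"
  unfolding delta0_def by (subst Alg_inverse) (auto simp: adim_def)

lemma ent_eps_left: "ent (eps N j * x) i r s = (if i < N \<and> r < adim i \<and> lbl i r = j then ent x i r s else 0)"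
proof -
  have "ent (eps N j * x) i r s = (\<Sum>t<adim i. if t = r then (if i < N \<and> r < adim i \<and> lbl i r = j then ent x i r s else 0) else 0)"
    unfolding times_alg.rep_eq by (rule sum.cong) (auto simp: ent_eps)
  then show ?thesis by (auto simp: sum.delta')
qed

lemma ent_eps_right: "ent (x * eps N j) i r s = (if i < N \<and> s < adim i \<and> lbl i s = j then ent x i r s else 0)"
proof -
  have "ent (x * eps N j) i r s = (\<Sum>t<adim i. if t = s then (if i < N \<and> s < adim i \<and> lbl i s = j then ent x i r s else 0) else 0)"
    unfolding times_alg.rep_eq by (rule sum.cong) (auto simp: ent_eps)
  then show ?thesis by (auto simp: sum.delta')
qed

lemma eps_ANset [simp]: "eps N j \<in> ANset N" by (simp add: ANset_iff ent_eps)

lemma eps_mult: "eps N i * eps N j = (if i = j then eps N i else 0)"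
  by (rule alg_eqI) (auto simp: ent_eps_left ent_eps zero_alg.rep_eq)

lemma eps_sum: "eps N 0 + eps N 1 + eps N 2 = idn N"
proof (rule alg_eqI)
  fix i r s assume "r < adim i" "s < adim i"
  then show "ent (eps N 0 + eps N 1 + eps N 2) i r s = ent (idn N) i r s"
    using lbl_less[of r i] by (auto simp: ent_simps ent_eps ent_cen)
qed

lemma beta0_eps: "N \<ge> 6 \<Longrightarrow> eps N 0 * beta0 = beta0" "N \<ge> 6 \<Longrightarrow> beta0 * eps N 1 = beta0"
  by (rule alg_eqI; auto simp: ent_eps_left ent_eps_right beta0_def plus_alg.rep_eq ent_mu lbl_def adim_def)+

lemma kappa0_eps: "N \<ge> 6 \<Longrightarrow> eps N 0 * kappa0 = kappa0" "N \<ge> 6 \<Longrightarrow> kappa0 * eps N 2 = kappa0"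
  by (rule alg_eqI; auto simp: ent_eps_left ent_eps_right kappa0_def plus_alg.rep_eq ent_mu lbl_def adim_def)+

lemma delta0_eps: "N \<ge> 6 \<Longrightarrow> eps N 1 * delta0 N = delta0 N" "N \<ge> 6 \<Longrightarrow> delta0 N * eps N 2 = delta0 N"
  by (rule alg_eqI; auto simp: ent_eps_left ent_eps_right ent_delta0 lbl_def adim_def)+

text \<open>Component 3 is the only one carrying all three labels, so the composite of the two
  arrows has a single nonzero entry.\<close>

lemma beta0_delta0: assumes "N \<ge> 6" shows "beta0 * delta0 N = mu 3 0 2"
proof (rule alg_eqI)
  fix i r s assume rs: "r < adim i" "s < adim i"
  have "adim 3 = Suc (Suc (Suc 0))" by (simp add: adim_def)
  then show "ent (beta0 * delta0 N) i r s = ent (mu 3 0 2) i r s"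
    using rs assms by (cases "i = 3"; cases "i = 4") (auto simp: ent_simps beta0_def ent_mu ent_delta0 lessThan_Suc)
qed

text \<open>Collects what the comparison of two orders uses. \<open>C\<close> is a parameter of its
  own so that two orders can share it literally, whereas \<open>kp\<close> and \<open>T\<close> may
  differ between them.\<close>

locale normal_form = dvr Ov pu for Ov :: "'a::field set" and pu +
  fixes N :: nat and L C :: "'a alg set" and kp :: 'a and T :: "'a alg \<Rightarrow> 'a alg \<Rightarrow> 'a"
  assumes N6: "N \<ge> 6"
    and sub: "L \<subseteq> ANset N" and osub: "osub L" and mult: "x \<in> L \<Longrightarrow> y \<in> L \<Longrightarrow> x * y \<in> L"
    and epsL: "j < 3 \<Longrightarrow> eps N j \<in> L"
    and CL: "C \<subseteq> L"
    and diag: "x \<in> L \<Longrightarrow> j < 3 \<Longrightarrow> \<exists>z\<in>C. eps N j * x * eps N j = eps N j * z"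
    and arrows: "beta0 \<in> L" "delta0 N \<in> L" "sc kp kappa0 \<in> L" and kp: "kp \<noteq> 0"
    and left: "x \<in> L \<Longrightarrow> \<exists>y\<in>L. eps N 0 * x * eps N 1 = beta0 * y"
      "x \<in> L \<Longrightarrow> \<exists>y\<in>L. eps N 1 * x * eps N 2 = delta0 N * y"
      "x \<in> L \<Longrightarrow> \<exists>y\<in>L. eps N 0 * x * eps N 2 = sc kp kappa0 * y"
    and pair: "x \<in> L \<Longrightarrow> \<exists>s\<in>Ov. \<exists>t\<in>Ov. eps N 0 * x * eps N 2 = sc s (sc kp kappa0) + sc t (beta0 * delta0 N)"
    and Tsym: "x \<in> ANset N \<Longrightarrow> y \<in> ANset N \<Longrightarrow> T x y = T y x"
    and Tassoc: "x \<in> ANset N \<Longrightarrow> y \<in> ANset N \<Longrightarrow> z \<in> ANset N \<Longrightarrow> T (x * y) z = T x (y * z)"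
    and Tdual: "x \<in> ANset N \<Longrightarrow> x \<in> L \<longleftrightarrow> (\<forall>y\<in>L. T x y \<in> Ov)"
begin

text \<open>An arrow absorbs the idempotent at its end, so only the diagonal block of the right
  factor matters, and by \<open>diag\<close> that block comes from \<open>C\<close>.\<close>

lemma left_C: 
  assumes x: "x \<in> L"
  shows "\<exists>z\<in>C. eps N 0 * x * eps N 1 = beta0 * (eps N 1 * z)"
    "\<exists>z\<in>C. eps N 1 * x * eps N 2 = delta0 N * (eps N 2 * z)"
    "\<exists>z\<in>C. eps N 0 * x * eps N 2 = sc kp kappa0 * (eps N 2 * z)"
proof -
  have gen: "\<exists>z\<in>C. eps N i * x * eps N j = a * (eps N j * z)"
    if asm: "\<exists>y\<in>L. eps N i * x * eps N j = a * y" "a * eps N j = a" "j < 3" for i j a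
  proof -
    obtain y where y: "y \<in> L" "eps N i * x * eps N j = a * y" using asm(1) by blast
    obtain z where z: "z \<in> C" "eps N j * y * eps N j = eps N j * z" using diag[OF y(1) asm(3)] by blast
    have "eps N i * x * eps N j = eps N i * x * eps N j * eps N j" by (simp add: mult.assoc eps_mult)
    also have "\<dots> = a * eps N j * y * eps N j" by (simp add: y(2) asm(2))
    also have "\<dots> = a * (eps N j * y * eps N j)" by (simp add: mult.assoc)
    also have "\<dots> = a * (eps N j * z)" by (simp add: z(2))
    finally show ?thesis using z(1) by blast
  qed
  show "\<exists>z\<in>C. eps N 0 * x * eps N 1 = beta0 * (eps N 1 * z)"
    by (rule gen[OF left(1)[OF x] beta0_eps(2)[OF N6]]) simp
  show "\<exists>z\<in>C. eps N 1 * x * eps N 2 = delta0 N * (eps N 2 * z)"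
    by (rule gen[OF left(2)[OF x] delta0_eps(2)[OF N6]]) simp
  show "\<exists>z\<in>C. eps N 0 * x * eps N 2 = sc kp kappa0 * (eps N 2 * z)"
    by (rule gen[OF left(3)[OF x]]) (simp_all add: kappa0_eps(2)[OF N6])
qed

end

text \<open>Write \<open>beta0 * delta0 N\<close> as \<open>kp\<close> times \<open>kappa0\<close>
  times some \<open>z\<close> from \<open>C\<close>. The same \<open>z\<close> belongs to the second
  order, and there \<open>kp'\<close> times \<open>kappa0\<close> times \<open>z\<close> equals the
  ratio times \<open>beta0 * delta0 N\<close>. Used in both directions, this makes the ratio a
  unit.\<close>

lemma normal_form_ratio:
  assumes 1: "normal_form Ov pu N L C kp T" and 2: "normal_form Ov pu N L' C kp' T'"
  shows "kp' * inverse kp \<in> Ov"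
proof -
  interpret a: normal_form Ov pu N L C kp T by (rule 1)
  interpret b: normal_form Ov pu N L' C kp' T' by (rule 2)
  have bd: "beta0 * delta0 N \<in> L" using a.arrows a.mult by blast
  have e: "eps N 0 * (beta0 * delta0 N) * eps N 2 = beta0 * delta0 N"
    by (metis mult.assoc beta0_eps(1)[OF a.N6] delta0_eps(2)[OF a.N6])
  obtain z where z: "z \<in> C" "beta0 * delta0 N = sc kp kappa0 * (eps N 2 * z)"
    using a.left_C(3)[OF bd] unfolding e by blast
  define w where "w = sc kp' kappa0 * (eps N 2 * z)"
  have w_eq: "w = sc (kp' * inverse kp) (beta0 * delta0 N)"
    unfolding w_def z(2) using a.kp by (simp add: mult.assoc)
  have w: "w \<in> L'" unfolding w_def using b.arrows b.epsL[of 2] b.CL z(1) by (intro b.mult) auto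
  have "eps N 0 * w * eps N 2 = w" unfolding w_eq by (simp add: e)
  then obtain s t where st: "t \<in> Ov" "w = sc s (sc kp' kappa0) + sc t (beta0 * delta0 N)"
    using b.pair[OF w] by metis
  have ent_bd: "ent (beta0 * delta0 N) 5 0 1 = (0::'a)" "ent (beta0 * delta0 N) 3 0 2 = (1::'a)"
    "ent kappa0 5 0 1 = (1::'a)" "ent kappa0 3 0 2 = (1::'a)"
    by (simp_all add: beta0_delta0[OF a.N6] ent_mu kappa0_def ent_simps adim_def)
  \<comment> \<open>Component 5 sees \<open>kappa0\<close> but not \<open>beta0 * delta0 N\<close>,
    so the coefficient of \<open>kappa0\<close> vanishes; the entry in component 3 then identifies
    the ratio with the integral coefficient \<open>t\<close>.\<close>
  have "ent w 5 0 1 = s * kp'" unfolding st(2) by (simp add: plus_alg.rep_eq sc.rep_eq ent_bd del: One_nat_def)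
  moreover have "ent w 5 0 1 = 0" unfolding w_eq by (simp add: sc.rep_eq ent_bd del: One_nat_def)
  ultimately have "s = 0" using b.kp by simp
  then have "ent w 3 0 2 = t" unfolding st(2) by (simp add: plus_alg.rep_eq sc.rep_eq ent_bd del: One_nat_def)
  moreover have "ent w 3 0 2 = kp' * inverse kp" unfolding w_eq by (simp add: sc.rep_eq ent_bd del: One_nat_def)
  ultimately show ?thesis using st(1) by simp
qed

text \<open>Diagonal and upper blocks are built from arrows and the common \<open>C\<close>. Only
  the block from column 0 to column 2 involves \<open>kp\<close>, and there the integral ratio
  converts one scalar into the other.\<close>

lemma normal_form_upper:
  assumes 1: "normal_form Ov pu N L C kp T" and 2: "normal_form Ov pu N L' C kp' T'" and x: "x \<in> L" and ij: "i \<le> j" "j < 3"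
  shows "eps N i * x * eps N j \<in> L'"
proof -
  interpret a: normal_form Ov pu N L C kp T by (rule 1)
  interpret b: normal_form Ov pu N L' C kp' T' by (rule 2)
  have CL: "z \<in> C \<Longrightarrow> z \<in> L'" for z using b.CL by blast
  note e = b.epsL and ar = b.arrows(1,2)
  consider "i = j" | "i = 0" "j = 1" | "i = 1" "j = 2" | "i = 0" "j = 2" using ij by linarith
  then show ?thesis
  proof cases
    case 1
    then show ?thesis using a.diag[OF x ij(2)] CL e[OF ij(2)] b.mult by metis
  next
    case 2
    then show ?thesis using a.left_C(1)[OF x] CL e[of 1] ar b.mult by (metis one_less_numeral_iff semiring_norm(77))
  next
    case 3
    obtain z where z: "z \<in> C" "eps N 1 * x * eps N 2 = delta0 N * (eps N 2 * z)" using a.left_C(2)[OF x] by blast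
    have "delta0 N * (eps N 2 * z) \<in> L'" using CL[OF z(1)] e[of 2] ar by (intro b.mult) auto
    then show ?thesis using 3 z by simp
  next
    case 4
    obtain z where z: "z \<in> C" "eps N 0 * x * eps N 2 = sc kp kappa0 * (eps N 2 * z)" using a.left_C(3)[OF x] by blast
    have "sc kp' kappa0 * (eps N 2 * z) \<in> L'" using CL[OF z(1)] e[of 2] b.arrows(3) by (intro b.mult) auto
    moreover have "kp * inverse kp' \<in> Ov" using normal_form_ratio[OF assms(2,1)] .
    ultimately have "sc (kp * inverse kp') (sc kp' kappa0 * (eps N 2 * z)) \<in> L'" using a.osubD(3)[OF b.osub] by blast
    moreover have "sc (kp * inverse kp') (sc kp' kappa0 * (eps N 2 * z)) = sc kp kappa0 * (eps N 2 * z)"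
      using b.kp by (simp add: mult.assoc)
    ultimately show ?thesis using 4 z by simp
  qed
qed

text \<open>If \<open>y\<close> lies below the diagonal and \<open>u\<close> above it, then \<open>T y u\<close> is the value of \<open>T\<close> at \<open>y * u\<close> and the unit, and
  \<open>y * u\<close> lies in a diagonal block, which both orders share.\<close>

lemma normal_form_lower:
  assumes 1: "normal_form Ov pu N L C kp T" and 2: "normal_form Ov pu N L' C kp' T'" and x: "x \<in> L" and ij: "j < i" "i < 3"
  shows "eps N i * x * eps N j \<in> L'"
proof -
  interpret a: normal_form Ov pu N L C kp T by (rule 1)
  interpret b: normal_form Ov pu N L' C kp' T' by (rule 2)
  let ?y = "eps N i * x * eps N j"
  have xA: "x \<in> ANset N" using x a.sub by blast
  have yL: "?y \<in> L" using x a.epsL ij by (intro a.mult) auto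
  have yA: "?y \<in> ANset N" using yL a.sub by blast
  have idL: "idn N \<in> L'" unfolding eps_sum[symmetric] using b.epsL by (intro a.osubD(2)[OF b.osub]) auto
  have "T' ?y g \<in> Ov" if g: "g \<in> L'" for g
  proof -
    have gA: "g \<in> ANset N" using g b.sub by blast
    define u where "u = eps N j * g * eps N i"
    have uL: "u \<in> L" unfolding u_def by (rule normal_form_upper[OF 2 1 g]) (use ij in auto)
    have uA: "u \<in> ANset N" using uL a.sub by blast
    have "T' ?y g = T' (eps N i * (?y * eps N j)) g" by (simp add: mult.assoc eps_mult) (simp add: eps_mult flip: mult.assoc)
    also have "\<dots> = T' (eps N i) (?y * eps N j * g)" using yA gA by (simp add: b.Tassoc ANset_closed)
    also have "\<dots> = T' (?y * (eps N j * g)) (eps N i)" using yA gA by (simp add: b.Tsym ANset_closed mult.assoc)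
    also have "\<dots> = T' ?y (eps N j * g * eps N i)" using yA gA by (subst b.Tassoc) (simp_all add: ANset_closed)
    also have "\<dots> = T' ?y (u * idn N)" using uA by (simp add: idn_mult(2) flip: u_def)
    also have "\<dots> = T' (?y * u) (idn N)" by (rule b.Tassoc[symmetric]) (use yA uA in \<open>simp_all add: cen_ANset\<close>)
    finally have eq: "T' ?y g = T' (?y * u) (idn N)" .
    have "?y * u = eps N i * (?y * u) * eps N i" unfolding u_def by (simp add: mult.assoc eps_mult) (simp add: eps_mult flip: mult.assoc)
    moreover have "eps N i * (?y * u) * eps N i \<in> L'" by (rule normal_form_upper[OF 1 2 a.mult[OF yL uL]]) (use ij in auto)
    ultimately have "?y * u \<in> L'" by simp
    then have "T' (?y * u) (idn N) \<in> Ov" using b.Tdual[of "?y * u"] b.sub idL by blast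
    then show ?thesis using eq by simp
  qed
  then show ?thesis using b.Tdual[OF yA] by blast
qed

lemma normal_form_subset:
  assumes 1: "normal_form Ov pu N L C kp T" and 2: "normal_form Ov pu N L' C kp' T'"
  shows "L \<subseteq> L'"
proof
  fix x assume x: "x \<in> L"
  interpret a: normal_form Ov pu N L C kp T by (rule 1)
  interpret b: normal_form Ov pu N L' C kp' T' by (rule 2)
  have xA: "x \<in> ANset N" using x a.sub by blast
  have part: "eps N i * x * eps N j \<in> L'" if "i < 3" "j < 3" for i j
    using normal_form_upper[OF 1 2 x, of i j] normal_form_lower[OF 1 2 x, of j i] that by (cases "i \<le> j") auto
  have dec: "y = eps N 0 * y + eps N 1 * y + eps N 2 * y" "y = y * eps N 0 + y * eps N 1 + y * eps N 2" if "y \<in> ANset N" for y :: "'a alg"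
    using idn_mult[OF that] by (simp_all flip: distrib_right distrib_left add: eps_sum del: One_nat_def)
  have row: "eps N i * x \<in> L'" if "i < 3" for i
  proof -
    have "eps N i * x * eps N 0 + eps N i * x * eps N 1 + eps N i * x * eps N 2 \<in> L'"
      using part[OF that] by (intro a.osubD(2)[OF b.osub]) auto
    then show ?thesis using dec(2)[of "eps N i * x"] xA by (simp add: ANset_closed)
  qed
  have "eps N 0 * x + eps N 1 * x + eps N 2 * x \<in> L'"
    using row by (intro a.osubD(2)[OF b.osub]) auto
  then show "x \<in> L'" using dec(1)[OF xA] by simp
qed

section \<open>Labelling the vertices\<close>

definition diag_alg :: "nat \<Rightarrow> (nat \<Rightarrow> nat \<Rightarrow> 'a::field) \<Rightarrow> 'a alg" where
  "diag_alg N a = Alg (\<lambda>i r s. if i < N \<and> r < adim i \<and> r = s then a i r else 0)"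

lemma ent_diag_alg: "ent (diag_alg N a) i r s = (if i < N \<and> r < adim i \<and> r = s then a i r else 0)"
  unfolding diag_alg_def by (subst Alg_inverse) auto

lemma diag_alg_ANset: "diag_alg N a \<in> ANset N" by (simp add: ANset_iff ent_diag_alg)

lemma ent_diag_alg_left: "ent (diag_alg N a * x) i r s = (if i < N then a i r * ent x i r s else 0)"
proof (cases "r < adim i")
  case True
  have "ent (diag_alg N a * x) i r s = (\<Sum>t<adim i. if t = r then (if i < N then a i r * ent x i r s else 0) else 0)"
    unfolding times_alg.rep_eq using True by (intro sum.cong) (auto simp: ent_diag_alg)
  then show ?thesis using True by simp
qed (simp add: ent_outside)

lemma ent_diag_alg_right: "ent (x * diag_alg N a) i r s = (if i < N then ent x i r s * a i s else 0)"
proof (cases "s < adim i")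
  case True
  have "ent (x * diag_alg N a) i r s = (\<Sum>t<adim i. if t = s then (if i < N then ent x i r s * a i s else 0) else 0)"
    unfolding times_alg.rep_eq using True by (intro sum.cong) (auto simp: ent_diag_alg)
  then show ?thesis using True by simp
qed (simp add: ent_outside)

lemma diag_alg_mult: assumes "\<And>i r. a i r * b i r = 1" shows "diag_alg N a * diag_alg N b = idn N"
  by (rule alg_eqI) (use assms in \<open>auto simp: ent_diag_alg_left ent_diag_alg ent_cen\<close>)

lemma conj_mult: 
  assumes "U * V = idn N" "x \<in> ANset N"
  shows "V * (x * y) * U = (V * x * U) * (V * y * U)"
proof -
  have "(V * x * U) * (V * y * U) = V * (x * (U * V) * y) * U" by (simp add: mult.assoc)
  then show ?thesis using idn_mult(2)[OF assms(2)] assms(1) by simp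
qed

text \<open>Were there no nonzero solution, the system padded with a zero row would be invertible,
  yet a zero row cannot produce the diagonal entry 1 of the identity.\<close>

lemma underdetermined:
  fixes a :: "nat \<Rightarrow> nat \<Rightarrow> 'a::field"
  shows "\<exists>z. (\<forall>j<n. (\<Sum>i<Suc n. a j i * z i) = 0) \<and> (\<exists>i<Suc n. z i \<noteq> 0)"
proof (rule ccontr)
  assume neg: "\<not> ?thesis"
  let ?a = "\<lambda>j i. if j < n then a j i else 0"
  have "\<exists>B. (\<forall>i<Suc n. \<forall>j<Suc n. (\<Sum>t<Suc n. ?a i t * B t j) = (if i = j then 1 else 0)) \<and>
            (\<forall>i<Suc n. \<forall>j<Suc n. (\<Sum>t<Suc n. B i t * ?a t j) = (if i = j then 1 else 0))"
  proof (rule square_system_inverse)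
    fix z assume z: "\<forall>j<Suc n. (\<Sum>i<Suc n. ?a j i * z i) = 0"
    have "(\<Sum>i<Suc n. a j i * z i) = 0" if "j < n" for j using z[rule_format, of j] that by simp
    then show "\<forall>i<Suc n. z i = 0" using neg by blast
  qed
  then obtain B where "\<forall>i<Suc n. \<forall>j<Suc n. (\<Sum>t<Suc n. ?a i t * B t j) = (if i = j then 1 else 0)" by blast
  from this[rule_format, of n n] show False by simp
qed

context symmetric_presentation begin

lemma symmetric_presentation_swap: "symmetric_presentation Ov pu N L c e1 e3 e2 k l h d b g T"
  using symmetric_presentation.axioms(2)[OF symmetric_presentation_axioms] by (intro symmetric_presentation.intro presentation_swap)

lemma symmetric_presentation_rotate: "c = 2 \<Longrightarrow> symmetric_presentation Ov pu N L c e2 e3 e1 d h l k g b T"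
  using symmetric_presentation.axioms(2)[OF symmetric_presentation_axioms] by (intro symmetric_presentation.intro presentation_rotate)

text \<open>The block of vertex 1 is spanned by four paths, whereas a wrong label would make it meet \<open>c + 2\<close> components.\<close>

lemma rank_bound:
  assumes UV: "U * V = idn N" "V * U = idn N" and A: "U \<in> ANset N" "V \<in> ANset N"
    and V: "V * e1 * U = eps N j" and j: "j = 1 \<or> j = 2"
  shows "c = 2"
proof (rule ccontr)
  assume "c \<noteq> 2"
  then have N8: "8 \<le> N" using c2 NC by simp
  \<comment> \<open>Five distinct components with a place labelled \<open>j\<close>: the 1x1
    component \<open>j\<close>, the 3x3 component, \<open>3 + j\<close>, 6 and 7. The last exists
    because \<open>c\<close> exceeds 2.\<close>
  define ix :: "nat \<Rightarrow> nat" where "ix i = (if i = 0 then j else if i = 1 then 3 else if i = 2 then 3 + j else if i = 3 then 6 else 7)" for i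
  have ixN: "ix i < N" for i using N8 j by (auto simp: ix_def)
  have ixinj: "ix i = ix i' \<Longrightarrow> i < 5 \<Longrightarrow> i' < 5 \<Longrightarrow> i = i'" for i i' using j by (auto simp: ix_def split: if_splits)
  have pos: "\<exists>r<adim (ix i). lbl (ix i) r = j" for i
  proof -
    have "(if ix i = 3 then j else if ix i = 4 then 1 else if ix i = 5 then 1 else if 6 \<le> ix i then j - 1 else 0) < adim (ix i) \<and>
       lbl (ix i) (if ix i = 3 then j else if ix i = 4 then 1 else if ix i = 5 then 1 else if 6 \<le> ix i then j - 1 else 0) = j"
      using j by (elim disjE) (auto simp: ix_def lbl_def adim_def)
    then show ?thesis by blast
  qed
  define sb :: "nat \<Rightarrow> 'a alg" where "sb m = (if m = 0 then e1 else if m = 1 then b * g else if m = 2 then k * l else k * (h * g))" for m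
  let ?one = "\<lambda>i. cen N (\<lambda>m. if m = i then 1 else 0) :: 'a alg"
  \<comment> \<open>Four paths against five scalars: some nonzero central element supported on these
    components pairs to zero with the whole block, hence annihilates \<open>e1\<close>. This
    contradicts the presence of label \<open>j\<close> in all five.\<close>
  obtain z where z: "\<forall>m<4. (\<Sum>i<Suc 4. T (?one (ix i)) (sb m) * z i) = 0" "\<exists>i<Suc 4. z i \<noteq> 0"
    using underdetermined[of 4 "\<lambda>m i. T (?one (ix i)) (sb m)"] by blast
  define zz where "zz m = (\<Sum>i<5. if ix i = m then z i else 0)" for m
  have zz: "zz (ix i) = z i" if "i < 5" for i
  proof -
    have "zz (ix i) = (\<Sum>i'<5. if i' = i then z i else 0)" unfolding zz_def
      by (rule sum.cong) (use ixinj that in auto)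
    then show ?thesis using that by simp
  qed
  have Tsb: "T (cen N zz) x = (\<Sum>i<5. T (?one (ix i)) x * z i)" if "x \<in> ANset N" for x
  proof -
    define t where "t m = T (?one m) x" for m
    have "T (cen N zz) x = (\<Sum>m<N. zz m * t m)" unfolding t_def by (rule T_cen_sum[OF that])
    also have "\<dots> = (\<Sum>m<N. \<Sum>i<5. if ix i = m then z i * t m else 0)"
      unfolding zz_def sum_distrib_right by (intro sum.cong refl) simp
    also have "\<dots> = (\<Sum>i<5. \<Sum>m<N. if ix i = m then z i * t m else 0)" by (rule sum.swap)
    also have "\<dots> = (\<Sum>i<5. t (ix i) * z i)" using ixN by (intro sum.cong refl) (simp add: mult.commute)
    finally show ?thesis unfolding t_def .
  qed
  have sbL: "sb m \<in> L" for m by (simp add: sb_def)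
  have "T (cen N zz) (sb m) = 0" if "m < 4" for m
  proof -
    have "Suc 4 = (5::nat)" by simp
    then show ?thesis using z(1) that by (subst Tsb) (auto simp: sbL simp del: sum.lessThan_Suc)
  qed
  from this[of 0] this[of 1] this[of 2] this[of 3]
  have S: "T (cen N zz) y \<in> {0}" if "y \<in> S11" for y
    using that unfolding S11_def by (auto simp: sb_def)
  have "T (cen N zz * e1) y = 0" if y: "y \<in> L" for y
  proof -
    have "T (cen N zz * e1) y = T (cen N zz) (e1 * (e1 * y))" using y by (simp add: Tassoc flip: mult.assoc[of e1 e1])
    also have "\<dots> = T (cen N zz) (e1 * y * e1)" using y by (subst T_cen_comm) auto
    also have "\<dots> \<in> {0}"
      by (rule T_ospan[OF _ _ _ _ _ _ block11[OF y]]) (use S in \<open>auto simp: S11_def\<close>)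
    finally show ?thesis by simp
  qed
  then have "cen N zz * e1 = 0" by (intro T_eq_zero) auto
  then have "V * (cen N zz * e1) * U = 0" by simp
  moreover have "V * (cen N zz * e1) * U = cen N zz * (V * e1 * U)"
    using cen_commute[of N zz V] by (simp add: mult.assoc) (simp flip: mult.assoc)
  ultimately have eq: "cen N zz * eps N j = 0" using V by simp
  have "z i = 0" if "i < 5" for i
  proof -
    obtain r where r: "r < adim (ix i)" "lbl (ix i) r = j" using pos by blast
    have "ent (cen N zz * eps N j) (ix i) r r = zz (ix i)" using r ixN by (simp add: ent_cen_mult_left ent_eps)
    then show ?thesis using eq zz[OF that] by (simp add: zero_alg.rep_eq)
  qed
  then show False using z(2) by auto
qed

text \<open>\<open>gg\<close> is a permutation of the vertices because no idempotent conjugates to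
  zero. It is undone by moving to the instance of the presentation in which the vertices are listed
  in the order \<open>gg 0\<close>, \<open>gg 1\<close>, \<open>gg 2\<close>.\<close>

lemma relabel:
  assumes D: "has_decomp_matrix N Ov pu (ent ` L) D0"
  shows "\<exists>U V f1 f2 f3 b' g' d' h' k' l'. U \<in> ANset N \<and> V \<in> ANset N \<and> U * V = idn N \<and> V * U = idn N \<and>
     V * f1 * U = eps N 0 \<and> V * f2 * U = eps N 1 \<and> V * f3 * U = eps N 2 \<and>
     symmetric_presentation Ov pu N L c f1 f2 f3 b' g' d' h' k' l' T"
proof -
  let ?E = "{e1,e2,e3}"
  obtain U V gg where *: "U \<in> ANset N" "V \<in> ANset N" "U * V = idn N" "V * U = idn N"
    "\<forall>j<3. gg j \<in> ?E" "\<forall>e\<in>?E. V * e * U = (\<Sum>j<3. if gg j = e then eps N j else 0)"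
    using adapted_basis[OF D] NC by auto
  have dist: "e1 \<noteq> e2" "e1 \<noteq> e3" "e2 \<noteq> e3" using e_nz e_id e_orth by metis+
  have sum3: "(\<Sum>j<3. F j) = F 0 + F 1 + F 2" for F :: "nat \<Rightarrow> 'a alg" by (simp add: numeral_3_eq_3 numeral_2_eq_2 One_nat_def)
  have surj: "\<exists>j<3. gg j = e" if e: "e \<in> ?E" for e
  proof (rule ccontr)
    assume "\<not> ?thesis"
    then have "(\<Sum>j<3. if gg j = e then eps N j else 0) = (0 :: 'a alg)" by (intro sum.neutral) auto
    then have "V * e * U = 0" using *(6) e by metis
    then have "U * (V * e * U) * V = 0" by simp
    moreover have "U * (V * e * U) * V = (U * V) * e * (U * V)" by (simp add: mult.assoc)
    moreover have "e \<in> ANset N" using e by auto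
    ultimately have "e = 0" using *(3) idn_mult[of e N] by simp
    then show False using e e_nz by auto
  qed
  have less3: "(j::nat) < 3 \<longleftrightarrow> j = 0 \<or> j = 1 \<or> j = 2" for j by auto
  have g012: "gg 0 \<in> ?E" "gg 1 \<in> ?E" "gg 2 \<in> ?E" using *(5) by simp_all
  have inj: "gg 0 \<noteq> gg 1" "gg 0 \<noteq> gg 2" "gg 1 \<noteq> gg 2"
    using surj[of e1] surj[of e2] surj[of e3] dist unfolding less3 by auto
  have V: "V * gg 0 * U = eps N 0" "V * gg 1 * U = eps N 1" "V * gg 2 * U = eps N 2"
    using bspec[OF *(6) g012(1)] bspec[OF *(6) g012(2)] bspec[OF *(6) g012(3)] inj inj[symmetric]
    unfolding sum3 by simp_all
  have key: ?thesis if "symmetric_presentation Ov pu N L c (gg 0) (gg 1) (gg 2) b' g' d' h' k' l' T" for b' g' d' h' k' l'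
    using that *(1-4) V by blast
  interpret sw: symmetric_presentation Ov pu N L c e1 e3 e2 k l h d b g T by (rule symmetric_presentation_swap)
  \<comment> \<open>Away from \<open>c = 2\<close> only the exchange of vertices 2 and 3 is a
    symmetry, and \<open>rank_bound\<close> excludes the other permutations.\<close>
  have g0: "gg 0 = e1" if "c \<noteq> 2"
  proof -
    obtain j where j: "j < 3" "gg j = e1" using surj[of e1] by auto
    have "j \<noteq> 1" "j \<noteq> 2" using rank_bound[OF *(3,4,1,2), of j] V j that by metis+
    then show ?thesis using j unfolding less3 by auto
  qed
  have cases: "gg 0 = e1 \<and> gg 1 = e2 \<and> gg 2 = e3 \<or> gg 0 = e1 \<and> gg 1 = e3 \<and> gg 2 = e2 \<or>
     gg 0 = e2 \<and> gg 1 = e3 \<and> gg 2 = e1 \<or> gg 0 = e2 \<and> gg 1 = e1 \<and> gg 2 = e3 \<or>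
     gg 0 = e3 \<and> gg 1 = e1 \<and> gg 2 = e2 \<or> gg 0 = e3 \<and> gg 1 = e2 \<and> gg 2 = e1"
    using g012 inj by (elim insertE emptyE) simp_all
  show ?thesis
  proof (cases "c = 2")
    case True
    note r1 = symmetric_presentation_rotate[OF True]
    note r2 = symmetric_presentation.symmetric_presentation_rotate[OF r1 True]
    show ?thesis using cases
      using key symmetric_presentation_axioms symmetric_presentation_swap r1 r2 symmetric_presentation.symmetric_presentation_swap[OF r1] symmetric_presentation.symmetric_presentation_swap[OF r2] by (elim disjE conjE) metis+
  next
    case False
    then have "gg 1 = e2 \<and> gg 2 = e3 \<or> gg 1 = e3 \<and> gg 2 = e2" using g0 cases dist by metis
    then show ?thesis using key symmetric_presentation_axioms symmetric_presentation_swap g0[OF False] by (elim disjE conjE) metis+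
  qed
qed

text \<open>The order is full, so its block between \<open>e\<close> and \<open>f\<close> contains,
  after conjugation, a multiple of the matrix unit at this place. Every element of the block is
  \<open>B * y\<close>, and \<open>B\<close> has at most one nonzero entry in the row concerned, so
  that entry cannot vanish.\<close>

lemma arrow_nonzero:
  assumes UV: "U * V = idn N" "V * U = idn N" and A: "U \<in> ANset N" "V \<in> ANset N"
    and e: "e \<in> L" "f \<in> L" "V * e * U = eps N p" "V * f * U = eps N q"
    and B: "B \<in> L" "e * B * f = B" "\<And>x. x \<in> L \<Longrightarrow> \<exists>y\<in>L. e * x * f = B * y"
    and irs: "i < N" "r < adim i" "s < adim i" "lbl i r = p" "lbl i s = q"
  shows "ent (V * B * U) i r s \<noteq> 0"
proof
  assume zero: "ent (V * B * U) i r s = 0"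
  define m :: "'a alg" where "m = mu i r s"
  have mA: "m \<in> ANset N" unfolding m_def by (rule mu_ANset[OF irs(1)])
  obtain n where n: "sc (pu ^ n) (U * m * V) \<in> L" using Lfull[of "U * m * V"] A by auto
  obtain y where y: "y \<in> L" "e * sc (pu ^ n) (U * m * V) * f = B * y" using B(3)[OF n] by blast
  have cm: "V * (x * w) * U = (V * x * U) * (V * w * U)" if "x \<in> ANset N" for x w
    by (rule conj_mult[OF UV(1) that])
  have VmU: "V * (U * m * V) * U = m"
  proof -
    have "V * (U * m * V) * U = (V * U) * m * (V * U)" by (simp add: mult.assoc)
    then show ?thesis using UV(2) idn_mult[OF mA] by simp
  qed
  have eA: "e \<in> ANset N" "f \<in> ANset N" "B \<in> ANset N" using e B by auto
  have "V * (e * sc (pu ^ n) (U * m * V) * f) * U = sc (pu ^ n) (eps N p * m * eps N q)"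
  proof -
    have "V * ((e * (U * m * V)) * f) * U = (V * e * U) * (V * (U * m * V) * U) * (V * f * U)"
      using eA A by (simp add: cm)
    then show ?thesis unfolding e VmU by simp
  qed
  moreover have "V * (B * y) * U = (V * B * U) * (V * y * U)" by (rule cm[OF eA(3)])
  ultimately have eq: "sc (pu ^ n) (eps N p * m * eps N q) = (V * B * U) * (V * y * U)" unfolding y(2) by simp
  have Bb: "V * B * U = eps N p * (V * B * U) * eps N q"
  proof -
    have "V * ((e * B) * f) * U = (V * e * U) * (V * B * U) * (V * f * U)" using eA by (simp add: cm)
    then show ?thesis using B(2) e by simp
  qed
  have "ent (V * B * U) i r t = 0" if "t < adim i" for t
  proof (cases "t = s")
    case False
    then have "lbl i t \<noteq> q" using lbl_inj[OF that irs(3)] irs(5) by auto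
    then show ?thesis by (subst Bb) (simp add: ent_eps_right)
  qed (use zero in simp)
  then have "ent ((V * B * U) * (V * y * U)) i r s = 0" unfolding times_alg.rep_eq[of "V * B * U"] by simp
  moreover have "ent (sc (pu ^ n) (eps N p * m * eps N q)) i r s = pu ^ n"
    using irs by (simp add: sc.rep_eq ent_eps_right ent_eps_left m_def ent_mu)
  ultimately show False using eq by simp
qed

end

section \<open>Rescaling the arrows and transporting the structure to the conjugated order\<close>

context symmetric_presentation begin

text \<open>Conjugation by a diagonal matrix keeps the diagonal idempotents and rescales the arrow
  entries, all of which are nonzero by \<open>arrow_nonzero\<close>.\<close>

lemma to_normal_form:
  assumes UV: "U * V = idn N" "V * U = idn N" and A: "U \<in> ANset N" "V \<in> ANset N"
    and eV: "V * e1 * U = eps N 0" "V * e2 * U = eps N 1" "V * e3 * U = eps N 2"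
  shows "\<exists>U V kp T'. U \<in> ANset N \<and> V \<in> ANset N \<and> U * V = idn N \<and> V * U = idn N \<and>
     normal_form Ov pu N ((\<lambda>x. V * x * U) ` L) {z \<in> L. \<forall>x\<in>L. z * x = x * z} kp T'"
proof -
  have N7: "7 \<le> N" using NC c2 by simp
  have b0: "e1 * b * e2 = b" and d0: "e2 * d * e3 = d" and k0: "e1 * k * e3 = k" by simp_all
  define B where "B = V * b * U"
  define D where "D = V * d * U"
  define K where "K = V * k * U"
  note nzb = arrow_nonzero[OF UV A inL(1,2) eV(1,2) inL(4) b0 block12_left, folded B_def]
  have inLd: "d \<in> L" by simp
  note nzd = arrow_nonzero[OF UV A inL(2,3) eV(2,3) inLd d0 block23_left, folded D_def]
  have inLk: "k \<in> L" by simp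
  note nzk = arrow_nonzero[OF UV A inL(1,3) eV(1,3) inLk k0 block13_left, folded K_def]
  have nz: "ent B 3 0 1 \<noteq> 0" "ent B 4 0 1 \<noteq> 0" "ent D 3 1 2 \<noteq> 0" "ent K 3 0 2 \<noteq> 0" "ent K 5 0 1 \<noteq> 0"
    "6 \<le> i \<Longrightarrow> i < N \<Longrightarrow> ent D i 0 1 \<noteq> 0" for i
    using nzb[of 3 0 1] nzb[of 4 0 1] nzd[of 3 1 2] nzk[of 3 0 2] nzk[of 5 0 1] nzd[of i 0 1] N7
    by (simp_all add: adim_def lbl_def)
  have cm: "V * (x * w) * U = (V * x * U) * (V * w * U)" if "x \<in> ANset N" for x w
    by (rule conj_mult[OF UV(1) that])
  have blkB: "B = eps N 0 * B * eps N 1"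
    using cm[of "e1 * b" e2] cm[of e1 b] eV by (simp add: B_def)
  have blkD: "D = eps N 1 * D * eps N 2"
    using cm[of "e2 * d" e3] cm[of e2 d] eV by (simp add: D_def)
  have blkK: "K = eps N 0 * K * eps N 2"
    using cm[of "e1 * k" e3] cm[of e1 k] eV by (simp add: K_def)
  have supp: "ent X i r s = (if i < N \<and> r < adim i \<and> s < adim i \<and> lbl i r = p \<and> lbl i s = q then ent X i r s else 0)"
    if "X = eps N p * X * eps N q" for X p q i r s
    by (subst (1) that) (auto simp: ent_eps_left ent_eps_right ent_outside)
  \<comment> \<open>Solved from the rule that conjugation multiplies the entry at
    \<open>(r, s)\<close> by \<open>inverse (a i r) * a i s\<close>, with place 0 normalised to 1.
    Component 3 is used up by making the entries of \<open>b\<close> and \<open>d\<close> equal to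
    1; component 5 is then adjusted so that the entry of \<open>k\<close> there agrees with the
    value \<open>kp\<close> left over in component 3.\<close>
  define a where "a i r = (if i = 3 then (if r = 1 then inverse (ent B 3 0 1) else if r = 2 then inverse (ent B 3 0 1 * ent D 3 1 2) else 1)
     else if r = 1 \<and> i = 4 then inverse (ent B 4 0 1)
     else if r = 1 \<and> i = 5 then ent K 3 0 2 * inverse (ent B 3 0 1 * ent D 3 1 2 * ent K 5 0 1)
     else if r = 1 \<and> 6 \<le> i \<and> i < N then inverse (ent D i 0 1) else 1)" for i r :: nat
  have a_nz: "a i r \<noteq> 0" for i r unfolding a_def using nz by auto
  define kp where "kp = ent K 3 0 2 * inverse (ent B 3 0 1 * ent D 3 1 2)"
  have kp: "kp \<noteq> 0" unfolding kp_def using nz by simp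
  define P where "P = diag_alg N a"
  define Q where "Q = diag_alg N (\<lambda>i r. inverse (a i r))"
  have PQ: "P * Q = idn N" "Q * P = idn N" unfolding P_def Q_def using a_nz by (auto intro!: diag_alg_mult)
  have PQA: "P \<in> ANset N" "Q \<in> ANset N" by (simp_all add: P_def Q_def diag_alg_ANset)
  have ent_QXP: "ent (Q * X * P) i r s = (if i < N then inverse (a i r) * ent X i r s * a i s else 0)" for X i r s
    by (simp add: P_def Q_def ent_diag_alg_left ent_diag_alg_right)
  have adim_cases: "r < adim i \<Longrightarrow> s < adim i \<Longrightarrow>
     (lbl i r = 0 \<and> lbl i s = 1 \<longleftrightarrow> (i = 3 \<or> i = 4) \<and> r = 0 \<and> s = 1) \<and>
     (lbl i r = 1 \<and> lbl i s = 2 \<longleftrightarrow> i = 3 \<and> r = 1 \<and> s = 2 \<or> 6 \<le> i \<and> r = 0 \<and> s = 1) \<and>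
     (lbl i r = 0 \<and> lbl i s = 2 \<longleftrightarrow> i = 3 \<and> r = 0 \<and> s = 2 \<or> i = 5 \<and> r = 0 \<and> s = 1)" for i r s
    by (auto simp: lbl_def adim_def split: if_splits)
  have QBP: "Q * B * P = beta0"
  proof (rule alg_eqI)
    fix i r s assume rs: "r < adim i" "s < adim i"
    have "ent B i r s = (if (i = 3 \<or> i = 4) \<and> r = 0 \<and> s = 1 then ent B i 0 1 else 0)"
      using supp[OF blkB, of i r s] adim_cases[OF rs] by (auto split: if_splits)
    then show "ent (Q * B * P) i r s = ent beta0 i r s"
      unfolding ent_QXP using rs N7 nz by (auto simp: beta0_def plus_alg.rep_eq ent_mu a_def adim_def)
  qed
  have QDP: "Q * D * P = delta0 N"
  proof (rule alg_eqI)
    fix i r s assume rs: "r < adim i" "s < adim i"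
    have "ent D i r s = (if i = 3 \<and> r = 1 \<and> s = 2 \<or> 6 \<le> i \<and> r = 0 \<and> s = 1 then ent D i r s else 0)"
      using supp[OF blkD, of i r s] adim_cases[OF rs] by (auto split: if_splits)
    then show "ent (Q * D * P) i r s = ent (delta0 N) i r s"
      unfolding ent_QXP ent_delta0 using rs N7 nz by (auto simp: a_def field_simps)
  qed
  have QKP: "Q * K * P = sc kp kappa0"
  proof (rule alg_eqI)
    fix i r s assume rs: "r < adim i" "s < adim i"
    have "ent K i r s = (if i = 3 \<and> r = 0 \<and> s = 2 \<or> i = 5 \<and> r = 0 \<and> s = 1 then ent K i r s else 0)"
      using supp[OF blkK, of i r s] adim_cases[OF rs] by (auto split: if_splits)
    then show "ent (Q * K * P) i r s = ent (sc kp kappa0) i r s"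
      unfolding ent_QXP using rs N7 nz by (auto simp: kappa0_def plus_alg.rep_eq sc.rep_eq ent_mu a_def kp_def adim_def field_simps)
  qed
  have Qeps: "Q * eps N j * P = eps N j" for j
    by (rule alg_eqI) (auto simp: ent_QXP ent_eps a_nz)
  define U' where "U' = U * P"
  define V' where "V' = Q * V"
  have conj2: "V' * x * U' = Q * (V * x * U) * P" for x by (simp add: U'_def V'_def mult.assoc)
  have A': "U' \<in> ANset N" "V' \<in> ANset N" using A by (simp_all add: U'_def V'_def)
  have UV': "U' * V' = idn N"
  proof -
    have "U' * V' = U * (P * Q) * V" by (simp add: U'_def V'_def mult.assoc)
    then show ?thesis using PQ idn_mult[OF A(1)] UV by simp
  qed
  have VU': "V' * U' = idn N"
  proof -
    have "V' * U' = Q * (V * U) * P" by (simp add: U'_def V'_def mult.assoc)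
    then show ?thesis using PQ idn_mult[OF PQA(2)] UV by simp
  qed
  define \<phi> where "\<phi> x = V' * x * U'" for x
  define \<psi> where "\<psi> x = U' * x * V'" for x
  have \<phi>b: "\<phi> b = beta0" and \<phi>d: "\<phi> d = delta0 N" and \<phi>k: "\<phi> k = sc kp kappa0"
    and \<phi>e: "\<phi> e1 = eps N 0" "\<phi> e2 = eps N 1" "\<phi> e3 = eps N 2"
    using QBP QDP QKP Qeps eV unfolding \<phi>_def conj2 B_def D_def K_def by simp_all
  have \<phi>m: "\<phi> (x * w) = \<phi> x * \<phi> w" if "x \<in> ANset N" for x w
    unfolding \<phi>_def by (rule conj_mult[OF UV' that])
  have \<psi>m: "\<psi> (x * w) = \<psi> x * \<psi> w" if "x \<in> ANset N" for x w
    unfolding \<psi>_def by (rule conj_mult[OF VU' that])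
  have \<phi>lin: "\<phi> (x + w) = \<phi> x + \<phi> w" "\<phi> (sc t x) = sc t (\<phi> x)" "\<phi> 0 = 0" for x w t
    by (simp_all add: \<phi>_def distrib_left distrib_right)
  have \<psi>\<phi>: "\<psi> (\<phi> x) = x" if "x \<in> ANset N" for x
  proof -
    have "\<psi> (\<phi> x) = (U' * V') * x * (U' * V')" by (simp add: \<phi>_def \<psi>_def mult.assoc)
    then show ?thesis using UV' idn_mult[OF that] by simp
  qed
  have \<phi>\<psi>: "\<phi> (\<psi> x) = x" if "x \<in> ANset N" for x
  proof -
    have "\<phi> (\<psi> x) = (V' * U') * x * (V' * U')" by (simp add: \<phi>_def \<psi>_def mult.assoc)
    then show ?thesis using VU' idn_mult[OF that] by simp
  qed
  have \<phi>A: "\<phi> x \<in> ANset N" and \<psi>A: "\<psi> x \<in> ANset N" if "x \<in> ANset N" for x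
    using A' that by (simp_all add: \<phi>_def \<psi>_def)
  define C where "C = {z \<in> L. \<forall>x\<in>L. z * x = x * z}"
  have cenC: "cen N z \<in> C" if "cen N z \<in> L" for z using that by (simp add: C_def cen_commute)
  \<comment> \<open>The conjugating element need not lie in \<open>L\<close>, but a multiple of it
    does, so elements commuting with \<open>L\<close> are fixed by the conjugation.\<close>
  have \<phi>C: "\<phi> z = z" if z: "z \<in> C" for z
  proof -
    have zA: "z \<in> ANset N" using z by (auto simp: C_def)
    obtain m where m: "sc (pu ^ m) U' \<in> L" using Lfull[OF A'(1)] by blast
    have "z * sc (pu ^ m) U' = sc (pu ^ m) U' * z" using z m by (auto simp: C_def)
    then have "z * U' = U' * z" by (simp add: sc_inj)
    then have "\<phi> z = V' * U' * z" by (simp add: \<phi>_def mult.assoc)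
    then show ?thesis using VU' idn_mult[OF zA] by simp
  qed
  \<comment> \<open>Pulling the form back along the inverse conjugation makes the conjugated order
    self-dual.\<close>
  define T' where "T' x y = T (\<psi> x) (\<psi> y)" for x y
  have img: "x \<in> \<phi> ` L \<longleftrightarrow> \<psi> x \<in> L" if "x \<in> ANset N" for x
    using \<psi>\<phi> \<phi>\<psi>[OF that] by (metis LAN image_iff)
  have centre: "\<exists>z\<in>C. eps N j * \<phi> x * eps N j = eps N j * z"
    if x: "x \<in> L" and e: "\<exists>z. cen N z \<in> L \<and> cen N z * e = e * x * e" "\<phi> e = eps N j" "e \<in> L" for x e j
  proof -
    obtain z where z: "cen N z \<in> L" "cen N z * e = e * x * e" using e(1) by blast
    have "eps N j * \<phi> x * eps N j = \<phi> (e * x * e)" using x e by (simp add: \<phi>m)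
    also have "\<dots> = \<phi> (e * cen N z)" by (simp add: cen_commute flip: z(2))
    also have "\<dots> = eps N j * cen N z" using e cenC[OF z(1)] by (simp add: \<phi>m \<phi>C)
    finally show ?thesis using cenC[OF z(1)] by blast
  qed
  have lefts: "\<exists>y\<in>\<phi> ` L. \<phi> e * \<phi> x * \<phi> f = \<phi> w * y"
    if ex: "\<exists>y\<in>L. e * x * f = w * y" and mem: "e \<in> L" "f \<in> L" "w \<in> L" "x \<in> L" for e f w x
  proof -
    obtain y where y: "y \<in> L" "e * x * f = w * y" using ex by blast
    have "\<phi> e * \<phi> x * \<phi> f = \<phi> (e * x * f)" using mem by (simp add: \<phi>m)
    also have "\<dots> = \<phi> w * \<phi> y" unfolding y(2) by (rule \<phi>m) (use mem in simp)
    finally show ?thesis using y(1) by blast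
  qed
  have "normal_form Ov pu N (\<phi> ` L) C kp T'"
  proof unfold_locales
    show "6 \<le> N" using N7 by simp
    show "\<phi> ` L \<subseteq> ANset N" using \<phi>A by auto
    show "osub (\<phi> ` L)" unfolding osub_def
    proof (intro conjI ballI)
      show "0 \<in> \<phi> ` L" by (rule image_eqI[of _ _ 0]) (simp_all add: \<phi>lin)
      show "x + y \<in> \<phi> ` L" if "x \<in> \<phi> ` L" "y \<in> \<phi> ` L" for x y using that by (auto simp flip: \<phi>lin(1))
      show "sc t x \<in> \<phi> ` L" if "t \<in> Ov" "x \<in> \<phi> ` L" for t x using that by (auto simp flip: \<phi>lin(2))
    qed
    show "x * y \<in> \<phi> ` L" if "x \<in> \<phi> ` L" "y \<in> \<phi> ` L" for x y
      using that by (auto simp flip: \<phi>m)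
    show "eps N j \<in> \<phi> ` L" if "j < 3" for j
    proof -
      have "j = 0 \<or> j = 1 \<or> j = 2" using that by auto
      then show ?thesis using \<phi>e inL(1,2,3) by (metis imageI)
    qed
    show "C \<subseteq> \<phi> ` L"
    proof
      fix z assume z: "z \<in> C"
      then have "\<phi> z \<in> \<phi> ` L" by (simp add: C_def)
      then show "z \<in> \<phi> ` L" using \<phi>C[OF z] by simp
    qed
    show "\<exists>z\<in>C. eps N j * x * eps N j = eps N j * z" if x: "x \<in> \<phi> ` L" and j: "j < 3" for x j
    proof -
      obtain y where y: "y \<in> L" "x = \<phi> y" using x by blast
      have "j = 0 \<or> j = 1 \<or> j = 2" using j by auto
      then show ?thesis
        using centre[OF y(1) centre_surj(1)[OF y(1)] \<phi>e(1)] centre[OF y(1) centre_surj(2)[OF y(1)] \<phi>e(2)]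
          centre[OF y(1) centre_surj(3)[OF y(1)] \<phi>e(3)] y(2) by (elim disjE) simp_all
    qed
    show "beta0 \<in> \<phi> ` L" "delta0 N \<in> \<phi> ` L" "sc kp kappa0 \<in> \<phi> ` L"
      using imageI[of b L \<phi>] imageI[of d L \<phi>] imageI[of k L \<phi>] unfolding \<phi>b \<phi>d \<phi>k by simp_all
    show "kp \<noteq> 0" by (rule kp)
    show "\<exists>y\<in>\<phi> ` L. eps N 0 * x * eps N 1 = beta0 * y" if x: "x \<in> \<phi> ` L" for x
    proof -
      obtain y where y: "y \<in> L" "x = \<phi> y" using x by blast
      show ?thesis using lefts[OF block12_left[OF y(1)] inL(1,2) _ y(1)] unfolding y(2) \<phi>b \<phi>e by simp
    qed
    show "\<exists>y\<in>\<phi> ` L. eps N 1 * x * eps N 2 = delta0 N * y" if x: "x \<in> \<phi> ` L" for x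
    proof -
      obtain y where y: "y \<in> L" "x = \<phi> y" using x by blast
      show ?thesis using lefts[OF block23_left[OF y(1)] inL(2,3) _ y(1)] unfolding y(2) \<phi>d \<phi>e by simp
    qed
    show "\<exists>y\<in>\<phi> ` L. eps N 0 * x * eps N 2 = sc kp kappa0 * y" if x: "x \<in> \<phi> ` L" for x
    proof -
      obtain y where y: "y \<in> L" "x = \<phi> y" using x by blast
      show ?thesis using lefts[OF block13_left[OF y(1)] inL(1,3) _ y(1)] unfolding y(2) \<phi>k \<phi>e by simp
    qed
    show "\<exists>s\<in>Ov. \<exists>t\<in>Ov. eps N 0 * x * eps N 2 = sc s (sc kp kappa0) + sc t (beta0 * delta0 N)" if x: "x \<in> \<phi> ` L" for x
    proof -
      obtain y where y: "y \<in> L" "x = \<phi> y" using x by blast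
      obtain s t where st: "s \<in> Ov" "t \<in> Ov" "e1 * y * e3 = sc s k + sc t (b * d)" using block13[OF y(1)] by blast
      have "eps N 0 * x * eps N 2 = \<phi> (e1 * y * e3)" using y by (simp add: \<phi>m \<phi>e)
      also have "\<dots> = sc s (\<phi> k) + sc t (\<phi> b * \<phi> d)" unfolding st(3) by (simp add: \<phi>lin \<phi>m)
      finally show ?thesis using st(1,2) unfolding \<phi>k \<phi>b \<phi>d by blast
    qed
    show "T' x y = T' y x" if "x \<in> ANset N" "y \<in> ANset N" for x y
      unfolding T'_def using that \<psi>A by (simp add: Tsym)
    show "T' (x * y) z = T' x (y * z)" if "x \<in> ANset N" "y \<in> ANset N" "z \<in> ANset N" for x y z
      unfolding T'_def using that \<psi>A by (simp add: \<psi>m Tassoc)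
    show "x \<in> \<phi> ` L \<longleftrightarrow> (\<forall>y\<in>\<phi> ` L. T' x y \<in> Ov)" if x: "x \<in> ANset N" for x
      unfolding img[OF x] Tdual[OF \<psi>A[OF x]] T'_def using \<psi>\<phi> by simp
  qed
  then show ?thesis using A' UV' VU' unfolding \<phi>_def C_def by blast
qed

lemma normalise:
  assumes D: "has_decomp_matrix N Ov pu (ent ` L) D0"
  shows "\<exists>U V kp T'. U \<in> ANset N \<and> V \<in> ANset N \<and> U * V = idn N \<and> V * U = idn N \<and>
     normal_form Ov pu N ((\<lambda>x. V * x * U) ` L) {z \<in> L. \<forall>x\<in>L. z * x = x * z} kp T'"
proof -
  obtain U V f1 f2 f3 b' g' d' h' k' l' where *: "U \<in> ANset N" "V \<in> ANset N" "U * V = idn N" "V * U = idn N"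
    "V * f1 * U = eps N 0" "V * f2 * U = eps N 1" "V * f3 * U = eps N 2"
    and s: "symmetric_presentation Ov pu N L c f1 f2 f3 b' g' d' h' k' l' T" using relabel[OF D] by blast
  show ?thesis by (rule symmetric_presentation.to_normal_form[OF s *(3,4,1,2,5-7)])
qed

end

section \<open>From the raw definitions to the theorem\<close>

lemma ent_raw:
  "ent (x + y) = eadd (ent x) (ent y)" "ent (x * y) = amul (ent x) (ent y)"
  "ent (sc a x) = escal a (ent x)" "ent (idn N) = aone N" "ent 0 = ezero"
  by (auto simp: fun_eq_iff eadd_def amul_def escal_def aone_def ezero_def ent_simps ent_cen)

lemma ent_esum: "ent (\<Sum>j<m. f j) = esum m (\<lambda>j. ent (f j))"
  by (auto simp: fun_eq_iff esum_def ent_sum)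

lemma ent_Alg: "x \<in> Aset N \<Longrightarrow> ent (Alg x) = x"
  by (subst Alg_inverse) (auto simp: Aset_def)

lemma ent_ANset: "ent ` ANset N = (Aset N :: 'a::field elem set)"
proof
  show "(Aset N :: 'a elem set) \<subseteq> ent ` ANset N"
  proof
    fix x :: "'a elem" assume x: "x \<in> Aset N"
    show "x \<in> ent ` ANset N" by (rule image_eqI[of _ _ "Alg x"]) (use ent_Alg[OF x] x in \<open>auto simp: ANset_def\<close>)
  qed
qed (auto simp: ANset_def)

lemma ent_eq_iff: "ent x = ent y \<longleftrightarrow> x = y" by (rule ent_inject)

lemma walk_alt: "walk 3 (concat (replicate m [Eta, Delta]) @ [Eta]) = Some 2"
  "walk 2 (concat (replicate m [Delta, Eta]) @ [Delta]) = Some 3"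
  by (induction m) auto

text \<open>\<open>path_lift\<close> ends with the idempotent of the final vertex, which the last
  arrow absorbs.\<close>

lemma path_lift_alt:
  assumes "ar Eta * e 2 = ar Eta" "ar Delta * e 3 = ar Delta"
  shows "path_lift e ar 3 (concat (replicate m [Eta, Delta]) @ [Eta]) = alt (ar Eta) (ar Delta) m"
    "path_lift e ar 2 (concat (replicate m [Delta, Eta]) @ [Delta]) = alt (ar Delta) (ar Eta) m"
  by (induction m) (use assms in auto)

context reduced_order begin

lemma quiver_presentation_exists:
  assumes c2: "c \<ge> 2"
  shows "\<exists>e1 e2 e3 b g d h k l. quiver_presentation Ov pu N L c e1 e2 e3 b g d h k l"
proof -
  obtain e ar where e: "\<forall>v\<in>{1,2,3}. e v \<in> L \<and> e v * e v = e v \<and> e v \<noteq> 0 \<and> (\<forall>w\<in>{1,2,3}. v \<noteq> w \<longrightarrow> e v * e w = 0)"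
     "e 1 + e 2 + e 3 = idn N"
    and ar: "\<forall>a. ar a \<in> L \<and> e (asrc a) * ar a = ar a \<and> ar a * e (atgt a) = ar a"
    and rel: "\<forall>p q. psub (pind p) (pind q) \<in> (rels c :: 'k palg set) \<longrightarrow> valid_path p \<longrightarrow> valid_path q \<longrightarrow>
        cong 1 (path_lift e ar (fst p) (snd p)) (path_lift e ar (fst q) (snd q))"
      "\<forall>p. pind p \<in> (rels c :: 'k palg set) \<longrightarrow> valid_path p \<longrightarrow> cong 1 (path_lift e ar (fst p) (snd p)) 0"
    and gen: "\<forall>S. osub S \<longrightarrow> (\<forall>x\<in>S. \<forall>y\<in>S. x * y \<in> S) \<longrightarrow> (\<forall>v\<in>{1,2,3}. e v \<in> S) \<longrightarrow> (\<forall>a. ar a \<in> S) \<longrightarrow>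
        (\<forall>x\<in>L. sc pu x \<in> S) \<longrightarrow> L \<subseteq> S"
    using presentation by (elim exE conjE) (rule that)
  have blk: "e 1 * ar Beta = ar Beta" "ar Beta * e 2 = ar Beta" "e 2 * ar Gamma = ar Gamma" "ar Gamma * e 1 = ar Gamma"
    "e 2 * ar Delta = ar Delta" "ar Delta * e 3 = ar Delta" "e 3 * ar Eta = ar Eta" "ar Eta * e 2 = ar Eta"
    "e 1 * ar Kappa = ar Kappa" "ar Kappa * e 3 = ar Kappa" "e 3 * ar Lam = ar Lam" "ar Lam * e 1 = ar Lam"
    using spec[OF ar, of Beta] spec[OF ar, of Gamma] spec[OF ar, of Delta] spec[OF ar, of Eta] spec[OF ar, of Kappa] spec[OF ar, of Lam]
    by simp_all
  note R1 = rel(1)[rule_format] and R2 = rel(2)[rule_format]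
  note pls = path_lift_alt[of ar e, OF blk(8,6)]
  have "quiver_presentation Ov pu N L c (e 1) (e 2) (e 3) (ar Beta) (ar Gamma) (ar Delta) (ar Eta) (ar Kappa) (ar Lam)"
  proof unfold_locales
    show "cong 1 (ar Beta * ar Delta) (ar Kappa * (ar Lam * ar Kappa))"
      using R1[of "(1, [Beta, Delta])" "(1, [Kappa, Lam, Kappa])"] blk by (simp add: rels_def valid_path_def)
    show "cong 1 (ar Eta * ar Gamma) (ar Lam * (ar Kappa * ar Lam))"
      using R1[of "(3, [Eta, Gamma])" "(3, [Lam, Kappa, Lam])"] blk by (simp add: rels_def valid_path_def)
    show "cong 1 (ar Delta * ar Lam) (ar Gamma * (ar Beta * ar Gamma))"
      using R1[of "(2, [Delta, Lam])" "(2, [Gamma, Beta, Gamma])"] blk by (simp add: rels_def valid_path_def)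
    show "cong 1 (ar Kappa * ar Eta) (ar Beta * (ar Gamma * ar Beta))"
      using R1[of "(1, [Kappa, Eta])" "(1, [Beta, Gamma, Beta])"] blk by (simp add: rels_def valid_path_def)
    show "cong 1 (ar Lam * ar Beta) (alt (ar Eta) (ar Delta) (c - 1))"
      using R1[of "(3, [Lam, Beta])" "(3, concat (replicate (c - 1) [Eta, Delta]) @ [Eta])"] blk pls walk_alt
      by (simp add: rels_def valid_path_def)
    show "cong 1 (ar Gamma * ar Kappa) (alt (ar Delta) (ar Eta) (c - 1))"
      using R1[of "(2, [Gamma, Kappa])" "(2, concat (replicate (c - 1) [Delta, Eta]) @ [Delta])"] blk pls walk_alt
      by (simp add: rels_def valid_path_def)
    show "cong 1 (ar Gamma * (ar Beta * ar Delta)) 0"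
      using R2[of "(2, [Gamma, Beta, Delta])"] blk by (simp add: rels_def valid_path_def)
    show "cong 1 (ar Delta * (ar Eta * ar Gamma)) 0"
      using R2[of "(2, [Delta, Eta, Gamma])"] blk by (simp add: rels_def valid_path_def)
    show "cong 1 (ar Lam * (ar Kappa * ar Eta)) 0"
      using R2[of "(3, [Lam, Kappa, Eta])"] blk by (simp add: rels_def valid_path_def)
    show "L \<subseteq> S" if S: "osub S" "\<And>x y. x \<in> S \<Longrightarrow> y \<in> S \<Longrightarrow> x * y \<in> S"
      "{e 1, e 2, e 3, ar Beta, ar Gamma, ar Delta, ar Eta, ar Kappa, ar Lam} \<subseteq> S" "\<And>x. x \<in> L \<Longrightarrow> sc pu x \<in> S" for S
    proof -
      have "ar a \<in> S" for a using S(3) by (cases a) auto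
      then show ?thesis using gen S by simp
    qed
  qed (use e ar blk c2 in simp_all)
  then show ?thesis by blast
qed

end

text \<open>Translates the raw hypotheses into the ring type. The centre is expressed through
  \<open>center Lm\<close>, so that hypothesis (iv) later yields one common parameter
  \<open>C\<close>.\<close>

lemma order_normal_form:
  fixes Ov :: "'a::field set" and red :: "'a \<Rightarrow> 'k::field"
  assumes dv: "complete_dvr Ov pu" and rm: "residue_map Ov pu red" and c2: "c \<ge> 2" and N: "N = c + 5"
    and ordr: "is_order N Ov Lm" and ri: "reduction_iso N Ov pu red c Lm"
    and sy: "symmetric_order N Ov Lm" and dm: "has_decomp_matrix N Ov pu Lm D0"
  defines "L \<equiv> {x. ent x \<in> Lm}"
  shows "ent ` L = Lm \<and> {z \<in> L. \<forall>x\<in>L. z * x = x * z} = {z. ent z \<in> center Lm} \<and>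
    (\<exists>U V kp T'. U \<in> ANset N \<and> V \<in> ANset N \<and> U * V = idn N \<and> V * U = idn N \<and>
     normal_form Ov pu N ((\<lambda>x. V * x * U) ` L) {z. ent z \<in> center Lm} kp T')"
proof -
  interpret dvr Ov pu by unfold_locales (rule dv)
  have lat: "olattice_A N Ov Lm" and one: "aone N \<in> Lm" and mul: "\<forall>x\<in>Lm. \<forall>y\<in>Lm. amul x y \<in> Lm"
    and full: "kspan_A Lm = Aset N" using ordr by (auto simp: is_order_def)
  obtain m g where g: "\<forall>j<m. g j \<in> Aset N" "Lm = {esum m (\<lambda>j. escal (c j) (g j)) | c. \<forall>j<m. c j \<in> Ov}"
    using lat unfolding olattice_A_def by blast
  have LmA: "Lm \<subseteq> Aset N" unfolding g(2) using g(1) by (auto simp: Aset_def esum_def escal_def)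
  have entL: "ent ` L = Lm"
  proof
    show "Lm \<subseteq> ent ` L"
    proof
      fix x assume x: "x \<in> Lm"
      then have xA: "x \<in> Aset N" using LmA by blast
      show "x \<in> ent ` L" by (rule image_eqI[of _ _ "Alg x"]) (use ent_Alg[OF xA] x in \<open>auto simp: L_def\<close>)
    qed
  qed (auto simp: L_def)
  have LA: "L \<subseteq> ANset N" using LmA by (auto simp: L_def ANset_def)
  define g' where "g' j = Alg (g j)" for j
  have g': "ent (g' j) = g j" if "j < m" for j unfolding g'_def using g(1) that ent_Alg by blast
  have es: "ent (\<Sum>j<m. sc (a j) (g' j)) = esum m (\<lambda>j. escal (a j) (g j))" for a
    unfolding ent_esum by (auto simp: esum_def ent_raw g' fun_eq_iff intro!: sum.cong)
  have Lg: "L = gspan m g'"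
  proof
    show "L \<subseteq> gspan m g'"
    proof
      fix x assume "x \<in> L"
      then have "ent x \<in> {esum m (\<lambda>j. escal (c j) (g j)) | c. \<forall>j<m. c j \<in> Ov}" unfolding g(2)[symmetric] by (simp add: L_def)
      then obtain a where a: "\<forall>j<m. a j \<in> Ov" "ent x = esum m (\<lambda>j. escal (a j) (g j))" by blast
      then have "x = (\<Sum>j<m. sc (a j) (g' j))" using es[of a] by (simp flip: ent_eq_iff)
      then show "x \<in> gspan m g'" using a(1) by (intro gspanI)
    qed
    show "gspan m g' \<subseteq> L"
    proof
      fix x assume "x \<in> gspan m g'"
      then obtain a where a: "\<forall>j<m. a j \<in> Ov" "x = (\<Sum>j<m. sc (a j) (g' j))" by (rule gspanE)
      have "ent x \<in> Lm" unfolding g(2) a(2) es using a(1) by blast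
      then show "x \<in> L" by (simp add: L_def)
    qed
  qed
  have Losub': "osub L" unfolding Lg by (rule gspan_osub)
  have fullL: "\<exists>n. sc (pu ^ n) x \<in> L" if x: "x \<in> ANset N" for x
  proof -
    have "ent x \<in> kspan_A Lm" using x full by (simp add: ANset_def)
    then obtain q a w where w: "ent x = esum q (\<lambda>j. escal (a j) (w j))" "\<forall>j<q. w j \<in> Lm"
      unfolding kspan_A_def by blast
    obtain n where n: "\<forall>t\<in>a ` {..<q}. pu ^ n * t \<in> Ov" using O_scale_finite[of "a ` {..<q}"] by auto
    have wA: "ent (Alg (w j)) = w j" if "j < q" for j using w(2) that LmA ent_Alg by blast
    have "ent x = ent (\<Sum>j<q. sc (a j) (Alg (w j)))"
      unfolding ent_esum w(1) by (auto simp: esum_def ent_raw wA fun_eq_iff intro!: sum.cong)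
    then have "x = (\<Sum>j<q. sc (a j) (Alg (w j)))" by (simp add: ent_eq_iff)
    then have "sc (pu ^ n) x = (\<Sum>j<q. sc (pu ^ n * a j) (Alg (w j)))" by (simp add: sc_sum)
    also have "\<dots> \<in> L"
    proof (rule osub_sum[OF Losub'])
      fix j assume "j \<in> {..<q}"
      then show "sc (pu ^ n * a j) (Alg (w j)) \<in> L"
        using n w(2) wA by (intro osubD(3)[OF Losub']) (auto simp: L_def)
    qed
    finally show ?thesis by blast
  qed
  interpret o: full_order Ov pu N L
  proof unfold_locales
    show "L \<subseteq> ANset N" by (rule LA)
    show "\<exists>m g. L = gspan m g" using Lg by blast
    show "idn N \<in> L" using one by (simp add: L_def ent_raw)
    show "x * y \<in> L" if "x \<in> L" "y \<in> L" for x y using mul that by (simp add: L_def ent_raw)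
    show "\<exists>n. sc (pu ^ n) x \<in> L" if "x \<in> ANset N" for x using fullL[OF that] .
  qed
  obtain f :: "'a elem \<Rightarrow> 'k palg" where f: "\<forall>x\<in>Lm. f x \<in> kQ"
     "\<forall>x\<in>Lm. \<forall>y\<in>Lm. psub (f (eadd x y)) (padd (f x) (f y)) \<in> Iideal c"
     "\<forall>x\<in>Lm. \<forall>y\<in>Lm. psub (f (amul x y)) (pmul (f x) (f y)) \<in> Iideal c"
     "psub (f (aone N)) pone \<in> Iideal c"
     "\<forall>a\<in>Ov. \<forall>x\<in>Lm. psub (f (escal a x)) (psc (red a) (f x)) \<in> Iideal c"
     "\<forall>z\<in>kQ. \<exists>x\<in>Lm. psub (f x) z \<in> Iideal c"
     "\<forall>x\<in>Lm. f x \<in> Iideal c \<longleftrightarrow> x \<in> {escal pu y | y. y \<in> Lm}"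
    using ri unfolding reduction_iso_def by (elim exE conjE) (rule that)
  interpret r: reduced_order Ov pu N L red "\<lambda>x. f (ent x)" c
  proof unfold_locales
    show "residue_map Ov pu red" by (rule rm)
    show "f (ent x) \<in> kQ" if "x \<in> L" for x using f(1) that by (simp add: L_def)
    show "peq c (f (ent (x + y))) (padd (f (ent x)) (f (ent y)))" if "x \<in> L" "y \<in> L" for x y
      using f(2) that by (simp add: L_def peq_def ent_raw)
    show "peq c (f (ent (x * y))) (pmul (f (ent x)) (f (ent y)))" if "x \<in> L" "y \<in> L" for x y
      using f(3) that by (simp add: L_def peq_def ent_raw)
    show "peq c (f (ent (idn N))) pone" using f(4) by (simp add: peq_def ent_raw)
    show "peq c (f (ent (sc a x))) (psc (red a) (f (ent x)))" if "a \<in> Ov" "x \<in> L" for a x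
      using f(5) that by (simp add: L_def peq_def ent_raw)
    show "\<exists>x\<in>L. peq c (f (ent x)) z" if "z \<in> kQ" for z
      using f(6) that unfolding peq_def entL[symmetric] by blast
    show "peq c (f (ent x)) (\<lambda>_. 0) \<longleftrightarrow> o.cong 1 x 0" if x: "x \<in> L" for x
    proof -
      have "peq c (f (ent x)) (\<lambda>_. 0) \<longleftrightarrow> f (ent x) \<in> Iideal c" by (simp add: peq_def psub_def)
      also have "\<dots> \<longleftrightarrow> ent x \<in> {escal pu y | y. y \<in> Lm}" using f(7) x by (simp add: L_def)
      also have "\<dots> \<longleftrightarrow> (\<exists>y\<in>L. ent x = escal pu (ent y))" unfolding entL[symmetric] by blast
      also have "\<dots> \<longleftrightarrow> (\<exists>y\<in>L. x = sc pu y)" by (simp flip: ent_raw(3) add: ent_eq_iff)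
      finally show ?thesis unfolding o.cong_zero_iff .
    qed
  qed
  obtain e1 e2 e3 b g0 d h k l where p: "quiver_presentation Ov pu N L c e1 e2 e3 b g0 d h k l" using r.quiver_presentation_exists[OF c2] by blast
  obtain T :: "'a elem \<Rightarrow> 'a elem \<Rightarrow> 'a" where T:
    "\<forall>x\<in>Aset N. \<forall>y\<in>Aset N. \<forall>z\<in>Aset N. \<forall>c.
         T (eadd x y) z = T x z + T y z \<and> T (escal c x) z = c * T x z \<and>
         T x (eadd y z) = T x y + T x z \<and> T x (escal c y) = c * T x y"
     "\<forall>x\<in>Aset N. \<forall>y\<in>Aset N. T x y = T y x"
     "\<forall>x\<in>Aset N. \<forall>y\<in>Aset N. \<forall>z\<in>Aset N. T (amul x y) z = T x (amul y z)"
     "\<forall>x\<in>Aset N. (\<forall>y\<in>Aset N. T x y = 0) \<longrightarrow> x = ezero"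
     "Lm = {x \<in> Aset N. \<forall>y\<in>Lm. T x y \<in> Ov}"
    using sy unfolding symmetric_order_def by (elim exE conjE) (rule that)
  have sp: "symmetric_presentation Ov pu N L c e1 e2 e3 b g0 d h k l (\<lambda>x y. T (ent x) (ent y))"
  proof (intro symmetric_presentation.intro p symmetric_presentation_axioms.intro)
    fix x y z :: "'a alg" and a
    assume x: "x \<in> ANset N"
    then have x': "ent x \<in> Aset N" by (simp add: ANset_def)
    show "T (ent (sc a x)) (ent z) = a * T (ent x) (ent z)" if "z \<in> ANset N"
      using T(1) x' that by (simp add: ent_raw ANset_def)
    show "x = 0" if "\<And>y. y \<in> ANset N \<Longrightarrow> T (ent x) (ent y) = 0"
    proof -
      have "\<forall>y\<in>Aset N. T (ent x) y = 0" unfolding ent_ANset[symmetric] using that by blast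
      then have "ent x = ent 0" using T(4) x' by (simp add: ent_raw)
      then show ?thesis by (simp add: ent_eq_iff)
    qed
    show "x \<in> L \<longleftrightarrow> (\<forall>y\<in>L. T (ent x) (ent y) \<in> Ov)"
    proof -
      have "x \<in> L \<longleftrightarrow> ent x \<in> {x \<in> Aset N. \<forall>y\<in>Lm. T x y \<in> Ov}" unfolding T(5)[symmetric] by (simp add: L_def)
      also have "\<dots> \<longleftrightarrow> (\<forall>y\<in>Lm. T (ent x) y \<in> Ov)" using x' by simp
      also have "\<dots> \<longleftrightarrow> (\<forall>y\<in>L. T (ent x) (ent y) \<in> Ov)" unfolding entL[symmetric] by blast
      finally show ?thesis .
    qed
    assume y: "y \<in> ANset N"
    then have y': "ent y \<in> Aset N" by (simp add: ANset_def)
    show "T (ent x) (ent y) = T (ent y) (ent x)" using T(2) x' y' by blast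
    assume "z \<in> ANset N"
    then have z': "ent z \<in> Aset N" by (simp add: ANset_def)
    show "T (ent (x + y)) (ent z) = T (ent x) (ent z) + T (ent y) (ent z)" using T(1) x' y' z' by (simp add: ent_raw)
    show "T (ent (x * y)) (ent z) = T (ent x) (ent (y * z))" using T(3) x' y' z' by (simp add: ent_raw)
  qed (rule N)
  have C: "{z \<in> L. \<forall>x\<in>L. z * x = x * z} = {z. ent z \<in> center Lm}"
    unfolding center_def entL[symmetric] by (auto simp: L_def ent_eq_iff simp flip: ent_raw(2))
  show ?thesis
    using entL C symmetric_presentation.normalise[OF sp dm[folded entL]] by simp
qed

theorem theorem4p2:
  fixes Ov :: "'a::field_char_0 set" and pu :: 'a and red :: "'a \<Rightarrow> 'k::field"
    and n :: nat and Lam Gam :: "'a elem set"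
  assumes "complete_dvr Ov pu"
    and "residue_map Ov pu red"
    and "alg_closed TYPE('k)" and "(2::'k) = 0"
    and "n \<ge> 3"
    and "is_order (6 + (2^(n-2) - 1)) Ov Lam" and "is_order (6 + (2^(n-2) - 1)) Ov Gam"
    and "reduction_iso (6 + (2^(n-2) - 1)) Ov pu red (2^(n-2)) Lam"
    and "reduction_iso (6 + (2^(n-2) - 1)) Ov pu red (2^(n-2)) Gam"
    and "symmetric_order (6 + (2^(n-2) - 1)) Ov Lam" and "symmetric_order (6 + (2^(n-2) - 1)) Ov Gam"
    and "has_decomp_matrix (6 + (2^(n-2) - 1)) Ov pu Lam D0"
    and "has_decomp_matrix (6 + (2^(n-2) - 1)) Ov pu Gam D0"
    and "center Lam = center Gam"
  shows "\<exists>u\<in>Aset (6 + (2^(n-2) - 1)). \<exists>v\<in>Aset (6 + (2^(n-2) - 1)).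
           amul u v = aone (6 + (2^(n-2) - 1)) \<and> amul v u = aone (6 + (2^(n-2) - 1)) \<and>
           {amul (amul u x) v | x. x \<in> Lam} = Gam"
proof -
  define N :: nat where "N = 6 + (2^(n-2) - 1)"
  define c :: nat where "c = 2^(n-2)"
  note hyps = assms[folded N_def c_def]
  have "n - 2 = Suc (n - 3)" using assms(5) by simp
  then have c2: "2 \<le> c" by (simp add: c_def)
  then have N: "N = c + 5" by (simp add: N_def c_def)
  obtain U V kp T where 1: "U \<in> ANset N" "V \<in> ANset N" "U * V = idn N" "V * U = idn N"
     "normal_form Ov pu N ((\<lambda>x. V * x * U) ` {x. ent x \<in> Lam}) {z. ent z \<in> center Lam} kp T"
    and L: "ent ` {x. ent x \<in> Lam} = Lam"
    using order_normal_form[OF hyps(1,2) c2 N hyps(6,8,10,12)] by blast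
  \<comment> \<open>Folding with the equality of centres gives both normal forms the same
    \<open>C\<close>, which is what \<open>normal_form_subset\<close> requires.\<close>
  obtain U' V' kp' T' where 2: "U' \<in> ANset N" "V' \<in> ANset N" "U' * V' = idn N" "V' * U' = idn N"
     "normal_form Ov pu N ((\<lambda>x. V' * x * U') ` {x. ent x \<in> Gam}) {z. ent z \<in> center Lam} kp' T'"
    and G: "ent ` {x. ent x \<in> Gam} = Gam"
    using order_normal_form[OF hyps(1,2) c2 N hyps(7,9,11,13), folded assms(14)] by blast
  have eq: "(\<lambda>x. V * x * U) ` {x. ent x \<in> Lam} = (\<lambda>x. V' * x * U') ` {x. ent x \<in> Gam}"
    using normal_form_subset[OF 1(5) 2(5)] normal_form_subset[OF 2(5) 1(5)] by blast
  have GA: "{x. ent x \<in> Gam} \<subseteq> ANset N"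
  proof -
    have "Gam \<subseteq> Aset N" using hyps(11) unfolding symmetric_order_def by blast
    then show ?thesis by (auto simp: ANset_def)
  qed
  \<comment> \<open>Conjugate the first order to the common normal form and from there back to the
    second.\<close>
  define u where "u = U' * V"
  define v where "v = U * V'"
  have uv: "u * v = idn N"
  proof -
    have "u * v = U' * (V * U) * V'" by (simp add: u_def v_def mult.assoc)
    then show ?thesis using 1 2 idn_mult[OF 2(1)] by simp
  qed
  have vu: "v * u = idn N"
  proof -
    have "v * u = U * (V' * U') * V" by (simp add: u_def v_def mult.assoc)
    then show ?thesis using 1 2 idn_mult[OF 1(1)] by simp
  qed
  have "(\<lambda>x. u * x * v) ` {x. ent x \<in> Lam} = (\<lambda>y. U' * y * V') ` (\<lambda>x. V * x * U) ` {x. ent x \<in> Lam}"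
    by (auto simp: u_def v_def mult.assoc image_image)
  also have "\<dots> = (\<lambda>x. U' * (V' * x * U') * V') ` {x. ent x \<in> Gam}" unfolding eq by (simp add: image_image)
  also have "\<dots> = (\<lambda>x. x) ` {x. ent x \<in> Gam}"
  proof (rule image_cong[OF refl])
    fix x assume "x \<in> {x. ent x \<in> Gam}"
    then have x: "x \<in> ANset N" using GA by blast
    have "U' * (V' * x * U') * V' = (U' * V') * x * (U' * V')" by (simp add: mult.assoc)
    then show "U' * (V' * x * U') * V' = x" using 2(3) idn_mult[OF x] by simp
  qed
  finally have conj: "(\<lambda>x. u * x * v) ` {x. ent x \<in> Lam} = {x. ent x \<in> Gam}" by simp
  have "{amul (amul (ent u) x) (ent v) | x. x \<in> Lam} = (\<lambda>x. amul (amul (ent u) x) (ent v)) ` ent ` {x. ent x \<in> Lam}"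
    unfolding L by blast
  also have "\<dots> = ent ` (\<lambda>x. u * x * v) ` {x. ent x \<in> Lam}" by (simp add: image_image ent_raw)
  also have "\<dots> = Gam" unfolding conj G ..
  finally have "{amul (amul (ent u) x) (ent v) | x. x \<in> Lam} = Gam" .
  moreover have "amul (ent u) (ent v) = aone N" "amul (ent v) (ent u) = aone N"
    using uv vu by (simp_all flip: ent_raw)
  moreover have "ent u \<in> Aset N" "ent v \<in> Aset N"
    using 1 2 ANset_closed(5)[of U' N V] ANset_closed(5)[of U N V'] by (simp_all add: u_def v_def ANset_def)
  ultimately show ?thesis unfolding N_def[symmetric] by blast
qed

end
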